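(* Let $\Omega\subset\mathbb C$ be a domain on which there exists a negative continuous subharmonic function $\rho$ satisfying $-\rho\le A\,\delta_\Omega^c$ on $\Omega$ for some constants $A,c>0$. Let $r_0>0$ be a given sufficiently small number. Then for every $0<\alpha<1/3$ there exists a constant $C>0$ depending only on $\alpha,r_0,\Omega$ such that for every closed set $E\subset\mathbb C$ whose logarithmic capacity $\mathcal C_l(E)$ is sufficiently small, and all $z,w\in\Omega$ with $\min\{\delta_{\Omega\setminus E}(z),\delta_{\Omega\setminus E}(w)\}\ge r_0$, $$|K_{\Omega\setminus E}(z,w)-K_\Omega(z,w)|\le C\left[\log\frac{r_0}{\mathcal C_l(E)}\right]^{-\alpha}.$$
   Context: For an open set $D\subset\mathbb C$, $K_D(z,w)$ is the Bergman kernel of $D$ (reproducing kernel of the space $A^2(D)$ of square-integrable holomorphic functions on $D$, holomorphic in $z$). $\delta_D(z)$ is the Euclidean distance from $z$ to $\mathbb C\setminus D$. $\mathcal C_l$ denotes the standard logarithmic capacity. *)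

theory Defs
  imports "HOL-Analysis.Analysis" "HOL-Complex_Analysis.Complex_Analysis"
begin

definition bdist :: "complex set \<Rightarrow> complex \<Rightarrow> real" where
  "bdist D z = infdist z (- D)"

definition continuous_subharmonic_on :: "complex set \<Rightarrow> (complex \<Rightarrow> real) \<Rightarrow> bool" where
  "continuous_subharmonic_on S u \<longleftrightarrow>
     open S \<and> continuous_on S u \<and>
     (\<forall>z\<in>S. \<exists>R>0. \<forall>r. 0 < r \<and> r < R \<longrightarrow>
        u z \<le> (1 / (2 * pi)) * integral {0..2*pi} (\<lambda>t. u (z + complex_of_real r * cis t)))"

definition bergman_space :: "complex set \<Rightarrow> (complex \<Rightarrow> complex) set" where
  "bergman_space D = {f. f holomorphic_on D \<and> set_integrable lborel D (\<lambda>z. (cmod (f z))\<^sup>2)}"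

definition is_bergman_kernel :: "complex set \<Rightarrow> (complex \<Rightarrow> complex \<Rightarrow> complex) \<Rightarrow> bool" where
  "is_bergman_kernel D K \<longleftrightarrow>
     (\<forall>w\<in>D. (\<lambda>z. K z w) \<in> bergman_space D) \<and>
     (\<forall>f\<in>bergman_space D. \<forall>w\<in>D. f w = (LINT z:D|lborel. f z * cnj (K z w)))"

definition bergman_kernel :: "complex set \<Rightarrow> complex \<Rightarrow> complex \<Rightarrow> complex" where
  "bergman_kernel D = (SOME K. is_bergman_kernel D K)"

text \<open>Logarithmic energy of a (probability) measure mu:
  I(mu) = double integral of log(1/|z-w|), with value +infinity on the diagonal.
  Split into positive and negative part.\<close>
definition log_energy :: "complex measure \<Rightarrow> ereal" where
  "log_energy \<mu> =
     enn2ereal (\<integral>\<^sup>+ z. \<integral>\<^sup>+ w. (if z = w then \<infinity> else ennreal (max 0 (- ln (cmod (z - w))))) \<partial>\<mu> \<partial>\<mu>)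
   - enn2ereal (\<integral>\<^sup>+ z. \<integral>\<^sup>+ w. ennreal (if z = w then 0 else max 0 (ln (cmod (z - w)))) \<partial>\<mu> \<partial>\<mu>)"

definition robin_const :: "complex set \<Rightarrow> ereal" where
  "robin_const K = (INF \<mu> \<in> {\<mu>. sets \<mu> = sets borel \<and> emeasure \<mu> UNIV = 1 \<and> emeasure \<mu> (- K) = 0}.
                        log_energy \<mu>)"

definition log_capacity_compact :: "complex set \<Rightarrow> real" where
  "log_capacity_compact K =
     (if robin_const K = \<infinity> then 0 else exp (- real_of_ereal (robin_const K)))"

text \<open>(Inner) logarithmic capacity of an arbitrary set: supremum over compact subsets
  (extended-real valued, since unbounded closed sets may have infinite capacity).\<close>
definition log_capacity :: "complex set \<Rightarrow> ereal" where
  "log_capacity E = (SUP K \<in> {K. compact K \<and> K \<subseteq> E}. ereal (log_capacity_compact K))"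

end

theory Submission
  imports Defs "HOL-Probability.Probability" "HOL-Real_Asymp.Real_Asymp"
begin

text \<open>
  Let \<open>D = \<Omega> - E\<close> and let \<open>h\<close> be the difference of the kernels of \<open>D\<close> and \<open>\<Omega>\<close> with pole \<open>w\<close>, extended by
  zero. Then \<open>h\<close> is orthogonal to the Bergman space of \<open>\<Omega>\<close> and \<open>\<parallel>h\<parallel>\<^sup>2 = h(w)\<close>. Up to a constant, the
  mean value property gives \<open>h(z) = \<langle>h, \<psi>\<rangle>\<close> for a radial bump \<open>\<psi>\<close> at \<open>z\<close>, and by Weyl's lemma \<open>\<psi>\<close> minus
  its Bergman projection is a limit of derivatives \<open>\<partial>v\<close> with \<open>v\<close> compactly supported in \<open>\<Omega>\<close>. Minimising the
  Dirichlet energy under truncation keeps \<open>v\<close> bounded in terms of the radius of the bump alone. If \<open>u\<close> is a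
  cutoff equal to 1 near \<open>E\<close> and to 0 near \<open>z\<close>, then \<open>\<langle>h, \<partial>((1 - u) v)\<rangle> = 0\<close> since \<open>h\<close> is holomorphic
  on \<open>D\<close>; hence \<open>\<bar>h(z)\<bar> \<le> \<parallel>h\<parallel> \<parallel>\<partial>(u v)\<parallel>\<close>, and by Caccioppoli's inequality the last norm is at most a
  constant times \<open>\<parallel>\<nabla>u\<parallel>\<close>. A truncated logarithmic potential of a nearly extremal discrete measure on \<open>E\<close>
  is such a cutoff with \<open>\<parallel>\<nabla>u\<parallel>\<^sup>2\<close> of order \<open>1 / log (r\<^sub>0 / cap E)\<close>. Using the bound at \<open>w\<close> and then
  at \<open>z\<close> shows that \<open>h(z)\<close> is of this order.
\<close>

section \<open>Continuously differentiable functions on the plane\<close>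

text \<open>Control of v times the gradient of u needs a sup bound on v, and finite Dirichlet energy
  gives none in the plane; hence the truncation. It yields a bound because the datum is traded for
  an explicit potential, bounded by 3r on the whole plane, whose gradient acts on test gradients
  exactly as the datum does. Exact minimisers leave the class of C1 functions with compact support,
  so near-minimisers replace them: the Euler-Lagrange equation becomes an inequality with error
  1/(n+1), and weak holomorphy holds only in the limit. The same device serves on the capacity side,
  where a discrete measure whose potential at every node is not far below the energy stands in for
  the equilibrium measure, at the price of additive constants. These only shift log (r0 / cap E),
  which is large. Each use of the pointwise bound brings a factor of order log^(-1/2): the use at w
  bounds the norm of h, the use at z brings the exponent to -1, and for a logarithm at least 1 this
  is below the power -\<alpha>.\<close>

text \<open>Gradients of real functions on the plane are complex numbers, \<open>g = \<partial>u/\<partial>x + \<i> \<partial>u/\<partial>y\<close>.\<close>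
definition C1 :: "(complex \<Rightarrow> real) \<Rightarrow> (complex \<Rightarrow> complex) \<Rightarrow> bool" where
  "C1 u g \<longleftrightarrow> (\<forall>z. GDERIV u z :> g z) \<and> continuous_on UNIV g"

definition C1c :: "complex set \<Rightarrow> (complex \<Rightarrow> real) \<Rightarrow> (complex \<Rightarrow> complex) \<Rightarrow> bool" where
  "C1c S u g \<longleftrightarrow> C1 u g \<and> (\<exists>K. compact K \<and> K \<subseteq> S \<and> (\<forall>z. z \<notin> K \<longrightarrow> u z = 0 \<and> g z = 0))"

lemma C1_GDERIV: "C1 u g \<Longrightarrow> GDERIV u z :> g z"
  by (simp add: C1_def)

lemma C1_cont: "C1 u g \<Longrightarrow> continuous_on UNIV u"
  unfolding C1_def gderiv_def
  by (meson continuous_at_imp_continuous_on has_derivative_continuous)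

lemma C1_cont_grad: "C1 u g \<Longrightarrow> continuous_on UNIV g"
  by (simp add: C1_def)

lemma C1_add: "C1 u g \<Longrightarrow> C1 v h \<Longrightarrow> C1 (\<lambda>z. u z + v z) (\<lambda>z. g z + h z)"
  by (simp add: C1_def GDERIV_add continuous_on_add)

lemma C1_diff: "C1 u g \<Longrightarrow> C1 v h \<Longrightarrow> C1 (\<lambda>z. u z - v z) (\<lambda>z. g z - h z)"
  by (simp add: C1_def GDERIV_diff continuous_on_diff)

lemma C1_mult: "C1 u g \<Longrightarrow> C1 v h \<Longrightarrow> C1 (\<lambda>z. u z * v z) (\<lambda>z. u z *\<^sub>R h z + v z *\<^sub>R g z)"
  using C1_cont[of u g] C1_cont[of v h]
  by (simp add: C1_def GDERIV_mult continuous_on_add continuous_on_scaleR)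

lemma C1_const: "C1 (\<lambda>z. k) (\<lambda>z. 0)"
  by (simp add: C1_def GDERIV_const)

lemma C1_cmult: "C1 u g \<Longrightarrow> C1 (\<lambda>z. k * u z) (\<lambda>z. k *\<^sub>R g z)"
  using C1_mult[OF C1_const[of k], of u g] by simp

lemma C1_compose:
  assumes "C1 u g" "\<And>x. DERIV f x :> f' x" "continuous_on UNIV f'"
  shows "C1 (\<lambda>z. f (u z)) (\<lambda>z. f' (u z) *\<^sub>R g z)"
proof -
  have "continuous_on UNIV (\<lambda>z. f' (u z))"
    by (rule continuous_on_compose2[OF assms(3) C1_cont[OF assms(1)]]) auto
  then show ?thesis
    using C1_cont_grad[OF assms(1)] GDERIV_DERIV_compose[OF C1_GDERIV[OF assms(1)] assms(2)]
    by (simp add: C1_def continuous_on_scaleR)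
qed

lemma C1_shift:
  assumes "C1 u g" shows "C1 (\<lambda>z. u (z + a)) (\<lambda>z. g (z + a))"
proof -
  have "GDERIV (\<lambda>z. u (z + a)) z :> g (z + a)" for z
  proof -
    have "((\<lambda>z. z + a) has_derivative (\<lambda>h. h)) (at z)"
      by (auto intro!: derivative_eq_intros)
    from has_derivative_compose[OF this, of u "\<lambda>h. h \<bullet> g (z + a)"]
    show ?thesis using C1_GDERIV[OF assms, of "z + a"] by (simp add: gderiv_def)
  qed
  moreover have "continuous_on UNIV (\<lambda>z. g (z + a))"
    by (rule continuous_on_compose2[OF C1_cont_grad[OF assms]]) (auto intro!: continuous_intros)
  ultimately show ?thesis by (simp add: C1_def)
qed

lemma GDERIV_inner_left: "GDERIV (\<lambda>z. z \<bullet> e) z :> e"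
  unfolding gderiv_def by (auto intro!: derivative_eq_intros)

lemma C1_inner: "C1 (\<lambda>z. z \<bullet> e) (\<lambda>z. e)"
  by (simp add: C1_def GDERIV_inner_left)

lemma C1_norm_sq: "C1 (\<lambda>z. (cmod z)\<^sup>2) (\<lambda>z. 2 *\<^sub>R z)"
proof -
  have "GDERIV (\<lambda>z. z \<bullet> z) z :> 2 *\<^sub>R z" for z :: complex
    unfolding gderiv_def by (rule has_derivative_eq_rhs[OF has_derivative_inner[OF has_derivative_ident has_derivative_ident]])
       (auto simp: inner_commute fun_eq_iff)
  then show ?thesis unfolding C1_def by (auto simp: power2_norm_eq_inner intro!: continuous_intros)
qed

lemma C1_grad_eq_0:
  assumes "C1 u g" "open U" "z \<in> U" "\<And>x. x \<in> U \<Longrightarrow> u x = k"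
  shows "g z = 0"
proof -
  have "(u has_derivative (\<lambda>h. h \<bullet> g z)) (at z)" using C1_GDERIV[OF assms(1)] by (simp add: gderiv_def)
  moreover have "(u has_derivative (\<lambda>h. 0)) (at z)"
    by (rule has_derivative_transform_within_open[OF has_derivative_const[of k] assms(2,3)]) (use assms(4) in auto)
  ultimately have "(\<lambda>h. h \<bullet> g z) = (\<lambda>h. 0)" by (rule has_derivative_unique)
  from fun_cong[OF this, of "g z"] show ?thesis by simp
qed

text \<open>The complement of a compact set is open, so a function vanishing there has zero gradient
  there as well.\<close>

lemma C1cI:
  assumes "C1 u g" "compact K" "K \<subseteq> S" "\<And>z. z \<notin> K \<Longrightarrow> u z = 0"
  shows "C1c S u g"
proof -
  have "g z = 0" if "z \<notin> K" for z
    by (rule C1_grad_eq_0[OF assms(1), of "- K"]) (use assms that compact_imp_closed in auto)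
  with assms show ?thesis unfolding C1c_def by blast
qed

lemma C1cD: "C1c S u g \<Longrightarrow> C1 u g"
  by (simp add: C1c_def)

lemma C1c_mono: "C1c S u g \<Longrightarrow> S \<subseteq> T \<Longrightarrow> C1c T u g"
  unfolding C1c_def by blast

lemma C1c_zero: "C1c S (\<lambda>z. 0) (\<lambda>z. 0)"
  by (rule C1cI[of _ _ "{}"]) (auto intro: C1_const)

lemma C1c_add:
  assumes "C1c S u g" "C1c S v h" shows "C1c S (\<lambda>z. u z + v z) (\<lambda>z. g z + h z)"
proof -
  from assms obtain K L where "compact K" "K \<subseteq> S" "compact L" "L \<subseteq> S"
    "\<And>z. z \<notin> K \<Longrightarrow> u z = 0" "\<And>z. z \<notin> L \<Longrightarrow> v z = 0" unfolding C1c_def by metis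
  then show ?thesis
    by (intro C1cI[of _ _ "K \<union> L"] C1_add) (use assms in \<open>auto simp: C1cD\<close>)
qed

lemma C1c_mult:
  assumes "C1c S u g" "C1 v h" shows "C1c S (\<lambda>z. v z * u z) (\<lambda>z. v z *\<^sub>R g z + u z *\<^sub>R h z)"
proof -
  from assms obtain K where "compact K" "K \<subseteq> S"
    "\<And>z. z \<notin> K \<Longrightarrow> u z = 0" unfolding C1c_def by metis
  then show ?thesis
    by (intro C1cI[of _ _ "K"] C1_mult) (use assms in \<open>auto simp: C1cD\<close>)
qed

lemma C1c_cmult: "C1c S u g \<Longrightarrow> C1c S (\<lambda>z. k * u z) (\<lambda>z. k *\<^sub>R g z)"
  using C1c_mult[OF _ C1_const[of k], of S u g] by simp

lemma C1c_diff: "C1c S u g \<Longrightarrow> C1c S v h \<Longrightarrow> C1c S (\<lambda>z. u z - v z) (\<lambda>z. g z - h z)"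
  using C1c_add[OF _ C1c_cmult[of S v h "-1"], of u g] by simp

section \<open>Integration by parts from translation invariance\<close>

lemma lborel_integral_shift:
  fixes f :: "'a::euclidean_space \<Rightarrow> 'b::{banach, second_countable_topology}"
  shows "(\<integral>x. f (x + a) \<partial>lborel) = integral\<^sup>L lborel f"
proof (cases "f \<in> borel_measurable borel")
  case True
  have "integral\<^sup>L lborel f = integral\<^sup>L (distr lborel borel ((+) a)) f"
    by (simp add: lborel_distr_plus)
  also have "\<dots> = (\<integral>x. f (a + x) \<partial>lborel)"
    by (rule integral_distr) (use True in auto)
  finally show ?thesis by (simp add: add.commute)
next
  case False
  have "(\<lambda>x. f (x + a)) \<notin> borel_measurable borel"
  proof
    assume "(\<lambda>x. f (x + a)) \<in> borel_measurable borel"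
    then have "(\<lambda>x. f ((x - a) + a)) \<in> borel_measurable borel"
      by (rule measurable_compose[rotated]) auto
    with False show False by simp
  qed
  with False have "\<not> integrable lborel f" "\<not> integrable lborel (\<lambda>x. f (x + a))"
    by (auto dest: borel_measurable_integrable)
  then show ?thesis by (simp add: not_integrable_integral_eq)
qed

lemma continuous_compact_support_integrable:
  fixes f :: "'a::euclidean_space \<Rightarrow> 'b::{banach, second_countable_topology}"
  assumes "continuous_on UNIV f" "compact K" "\<And>z. z \<notin> K \<Longrightarrow> f z = 0"
  shows "integrable lborel f"
proof -
  have "set_integrable lborel K f"
    using borel_integrable_compact[OF assms(2) continuous_on_subset[OF assms(1)]] by (simp add: set_integrable_def)
  moreover have "(\<lambda>x. indicator K x *\<^sub>R f x) = f" using assms(3) by (auto simp: fun_eq_iff indicator_def)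
  ultimately show ?thesis by (simp add: set_integrable_def)
qed

lemma continuous_compact_support_bounded:
  fixes f :: "'a::t2_space \<Rightarrow> 'b::real_normed_vector"
  assumes "continuous_on UNIV f" "compact K" "\<And>z. z \<notin> K \<Longrightarrow> f z = 0"
  obtains B where "B > 0" "\<And>z. norm (f z) \<le> B"
proof -
  have "compact (f ` K)" by (rule compact_continuous_image[OF continuous_on_subset[OF assms(1)] assms(2)]) auto
  then obtain B where B: "\<And>x. x \<in> K \<Longrightarrow> norm (f x) \<le> B"
    using compact_imp_bounded bounded_iff by (metis image_eqI)
  have "norm (f z) \<le> \<bar>B\<bar> + 1" for z
  proof (cases "z \<in> K")
    case True
    then show ?thesis using B[of z] by linarith
  qed (simp add: assms(3))
  then show ?thesis by (intro that[of "\<bar>B\<bar> + 1"]) auto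
qed

lemma C1_Lipschitz:
  assumes "C1 u g" "\<And>z. norm (g z) \<le> B"
  shows "\<bar>u x - u y\<bar> \<le> B * norm (x - y)"
proof -
  have "norm (u x - u y) \<le> B * norm (x - y)"
  proof (rule differentiable_bound[of UNIV u "\<lambda>z h. h \<bullet> g z"])
    show "(u has_derivative (\<lambda>h. h \<bullet> g z)) (at z within UNIV)" for z
      using C1_GDERIV[OF assms(1)] by (simp add: gderiv_def)
    show "onorm (\<lambda>h. h \<bullet> g z) \<le> B" for z
      by (rule onorm_le) (metis Cauchy_Schwarz_ineq2 assms(2) mult.commute mult_left_mono norm_ge_zero order_trans real_norm_def)
  qed auto
  then show ?thesis by simp
qed

lemma C1_diff_quotient_tendsto:
  assumes "C1 u g" "\<And>n::nat. t n \<noteq> (0::real)" "t \<longlonglongrightarrow> 0"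
  shows "(\<lambda>n. (u (z + t n *\<^sub>R d) - u z) / t n) \<longlonglongrightarrow> d \<bullet> g z"
proof -
  have 1: "((\<lambda>s. u (z + s *\<^sub>R d)) has_derivative (\<lambda>h. (h *\<^sub>R d) \<bullet> g z)) (at 0)"
  proof -
    have "((\<lambda>s. z + s *\<^sub>R d) has_derivative (\<lambda>h. h *\<^sub>R d)) (at 0)"
      by (auto intro!: derivative_eq_intros)
    from has_derivative_compose[OF this, of u "\<lambda>h. h \<bullet> g z"] show ?thesis
      using C1_GDERIV[OF assms(1), of z] by (simp add: gderiv_def)
  qed
  then have "DERIV (\<lambda>s. u (z + s *\<^sub>R d)) 0 :> d \<bullet> g z"
    by (simp add: has_field_derivative_def mult.commute[of _ "d \<bullet> g z"])
  then have "((\<lambda>h. (u (z + h *\<^sub>R d) - u z) / h) \<longlongrightarrow> d \<bullet> g z) (at 0)"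
    by (simp add: DERIV_def)
  then show ?thesis
    by (rule filterlim_compose) (use assms in \<open>auto simp: filterlim_at\<close>)
qed

lemma C1c_obtain:
  assumes "C1c S u g"
  obtains K where "compact K" "K \<subseteq> S" "\<And>z. z \<notin> K \<Longrightarrow> u z = 0" "\<And>z. z \<notin> K \<Longrightarrow> g z = 0"
  using assms unfolding C1c_def by metis

lemma C1c_integrable_grad: "C1c S u g \<Longrightarrow> integrable lborel g"
  by (metis C1c_obtain C1cD C1_cont_grad continuous_compact_support_integrable)

lemma C1c_bounded_grad:
  assumes "C1c S u g" obtains B where "B > 0" "\<And>z. norm (g z) \<le> B"
  by (metis C1c_obtain C1cD C1_cont_grad continuous_compact_support_bounded assms)

text \<open>Dominated convergence: the quotients are bounded by the sup of the gradient, and steps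
  of length at most 1 keep all shifted supports in one ball, on which the continuous
  \<open>h\<close> is bounded.\<close>

lemma integral_diff_quotient_tendsto:
  assumes u: "C1c S u g" and h: "continuous_on UNIV (h :: complex \<Rightarrow> real)"
    and t: "\<And>n::nat. t n \<noteq> (0::real)" "\<And>n. \<bar>t n\<bar> \<le> 1" "t \<longlonglongrightarrow> 0" and d: "norm d \<le> 1"
  shows "(\<lambda>n. \<integral>z. h z * ((u (z + t n *\<^sub>R d) - u z) / t n) \<partial>lborel) \<longlonglongrightarrow> (\<integral>z. h z * (d \<bullet> g z) \<partial>lborel)"
proof -
  obtain K where K: "compact K" "\<And>z. z \<notin> K \<Longrightarrow> u z = 0" "\<And>z. z \<notin> K \<Longrightarrow> g z = 0"
    using C1c_obtain[OF u] by metis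
  obtain B where B: "B > 0" "\<And>z. norm (g z) \<le> B" using C1c_bounded_grad[OF u] by blast
  have cu: "continuous_on UNIV u" using C1_cont C1cD u by blast
  have cg: "continuous_on UNIV g" using C1_cont_grad C1cD u by blast
  obtain R where R: "R > 0" "\<And>z. z \<in> K \<Longrightarrow> norm z \<le> R"
    using compact_imp_bounded[OF K(1)] bounded_pos by blast
  let ?C = "cball (0::complex) (R + 1)"
  obtain H where H: "\<And>z. z \<in> ?C \<Longrightarrow> norm (h z) \<le> H"
    using compact_continuous_image[OF continuous_on_subset[OF h], of ?C] compact_imp_bounded
    by (metis bounded_iff compact_cball image_eqI subset_UNIV)
  have [measurable]: "h \<in> borel_measurable borel" "u \<in> borel_measurable borel" "g \<in> borel_measurable borel"
    using h cu cg by (auto intro: borel_measurable_continuous_onI)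
  show ?thesis
  proof (rule integral_dominated_convergence[where w="\<lambda>z. indicator ?C z *\<^sub>R (H * B)"])
    show "integrable lborel (\<lambda>z. indicator ?C z *\<^sub>R (H * B))"
      using borel_integrable_compact[of ?C "\<lambda>z. H * B"] by auto
    show "AE z in lborel. (\<lambda>n. h z * ((u (z + t n *\<^sub>R d) - u z) / t n)) \<longlonglongrightarrow> h z * (d \<bullet> g z)"
      by (intro AE_I2 tendsto_mult tendsto_const C1_diff_quotient_tendsto[OF C1cD[OF u]] t)
    show "AE z in lborel. norm (h z * ((u (z + t n *\<^sub>R d) - u z) / t n)) \<le> indicator ?C z *\<^sub>R (H * B)" for n
    proof (intro AE_I2)
      fix z
      have q: "\<bar>(u (z + t n *\<^sub>R d) - u z) / t n\<bar> \<le> B"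
      proof -
        have "\<bar>u (z + t n *\<^sub>R d) - u z\<bar> \<le> B * norm (t n *\<^sub>R d)"
          using C1_Lipschitz[OF C1cD[OF u] B(2), of "z + t n *\<^sub>R d" z] by simp
        also have "\<dots> \<le> B * \<bar>t n\<bar>" using B(1) d by (auto intro!: mult_left_mono mult_left_le)
        finally show ?thesis using t(1)[of n] by (simp add: abs_divide pos_divide_le_eq)
      qed
      show "norm (h z * ((u (z + t n *\<^sub>R d) - u z) / t n)) \<le> indicator ?C z *\<^sub>R (H * B)"
      proof (cases "z \<in> ?C")
        case True
        have "\<bar>h z\<bar> * \<bar>(u (z + t n *\<^sub>R d) - u z) / t n\<bar> \<le> H * B"
          using H[OF True] q by (intro mult_mono) auto
        with True show ?thesis by (simp add: abs_mult)
      next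
        case False
        then have n1: "norm z > R + 1" by simp
        then have "z \<notin> K" using R by force
        moreover have "norm (z + t n *\<^sub>R d) > R"
        proof -
          have "norm (t n *\<^sub>R d) \<le> 1" using t(2)[of n] d by (simp add: mult_le_one)
          then show ?thesis using norm_diff_ineq[of z "t n *\<^sub>R d"] n1 by linarith
        qed
        then have "z + t n *\<^sub>R d \<notin> K" using R by force
        ultimately have "u z = 0" "u (z + t n *\<^sub>R d) = 0" using K by auto
        then show ?thesis using False by simp
      qed
    qed
    show "(\<lambda>z. h z * (d \<bullet> g z)) \<in> borel_measurable lborel"
      by measurable
    show "(\<lambda>z. h z * ((u (z + t n *\<^sub>R d) - u z) / t n)) \<in> borel_measurable lborel" for n
      by measurable
  qed
qed

lemma C1c_integrable:
  assumes "C1c S u g" "continuous_on UNIV h"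
  shows "integrable lborel (\<lambda>z. h z * u z :: real)"
proof -
  obtain K where K: "compact K" "\<And>z. z \<notin> K \<Longrightarrow> u z = 0" using C1c_obtain[OF assms(1)] by metis
  show ?thesis
    by (rule continuous_compact_support_integrable[OF _ K(1)])
       (use assms K(2) C1_cont[OF C1cD[OF assms(1)]] in \<open>auto intro!: continuous_intros\<close>)
qed

text \<open>Discrete integration by parts: translation invariance moves the difference quotient onto
  \<open>h\<close> with the opposite shift, so continuity of \<open>h\<close> suffices.\<close>

lemma integral_shift_diff_quotient:
  assumes u: "C1c S u g" and h: "continuous_on UNIV (h :: complex \<Rightarrow> real)"
  shows "(\<integral>z. h z * ((u (z + a) - u z) / t) \<partial>lborel) = (\<integral>z. ((h (z - a) - h z) / t) * u z \<partial>lborel)"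
proof -
  have ha: "continuous_on UNIV (\<lambda>z. h (z - a))"
    by (rule continuous_on_compose2[OF h]) (auto intro!: continuous_intros)
  have i1: "integrable lborel (\<lambda>z. h z * u z)" by (rule C1c_integrable[OF u h])
  have i2: "integrable lborel (\<lambda>z. h (z - a) * u z)" by (rule C1c_integrable[OF u ha])
  obtain K where K: "compact K" "\<And>z. z \<notin> K \<Longrightarrow> u z = 0" using C1c_obtain[OF u] by metis
  have i3: "integrable lborel (\<lambda>z. h z * u (z + a))"
  proof (rule continuous_compact_support_integrable[of _ "(\<lambda>x. x - a) ` K"])
    show "compact ((\<lambda>x. x - a) ` K)" using K(1) by (auto intro!: compact_continuous_image continuous_intros)
    show "continuous_on UNIV (\<lambda>z. h z * u (z + a))"
      by (intro continuous_intros h continuous_on_compose2[OF C1_cont[OF C1cD[OF u]]]) auto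
    show "h z * u (z + a) = 0" if "z \<notin> (\<lambda>x. x - a) ` K" for z
      using that K(2)[of "z + a"] by force
  qed
  have s: "(\<integral>z. h z * u (z + a) \<partial>lborel) = (\<integral>z. h (z - a) * u z \<partial>lborel)"
    using lborel_integral_shift[of "\<lambda>z. h (z - a) * u z" a] by simp
  have "(\<integral>z. h z * ((u (z + a) - u z) / t) \<partial>lborel) = (\<integral>z. (h z * u (z + a) - h z * u z) / t \<partial>lborel)"
    by (simp add: algebra_simps diff_divide_distrib)
  also have "\<dots> = ((\<integral>z. h (z - a) * u z \<partial>lborel) - (\<integral>z. h z * u z \<partial>lborel)) / t"
    using i1 i3 s by simp
  also have "\<dots> = (\<integral>z. (h (z - a) * u z - h z * u z) / t \<partial>lborel)"
    using i1 i2 by simp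
  also have "\<dots> = (\<integral>z. ((h (z - a) - h z) / t) * u z \<partial>lborel)"
    by (simp add: algebra_simps diff_divide_distrib)
  finally show ?thesis .
qed

text \<open>Moved onto the constant function 1, every difference quotient vanishes.\<close>

lemma integral_inner_grad_eq_0:
  assumes u: "C1c S u g" and d: "norm d \<le> 1"
  shows "(\<integral>z. d \<bullet> g z \<partial>lborel) = 0"
proof -
  let ?t = "\<lambda>n. inverse (real (Suc n))"
  have t: "\<And>n. ?t n \<noteq> 0" "\<And>n. \<bar>?t n\<bar> \<le> 1" "?t \<longlonglongrightarrow> 0"
    using LIMSEQ_inverse_real_of_nat by (auto simp: field_simps)
  have "(\<lambda>n. \<integral>z. 1 * ((u (z + ?t n *\<^sub>R d) - u z) / ?t n) \<partial>lborel) \<longlonglongrightarrow> (\<integral>z. 1 * (d \<bullet> g z) \<partial>lborel)"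
    by (rule integral_diff_quotient_tendsto[OF u _ t d]) auto
  moreover have "(\<integral>z. 1 * ((u (z + ?t n *\<^sub>R d) - u z) / ?t n) \<partial>lborel) = 0" for n
    by (subst integral_shift_diff_quotient[OF u]) auto
  ultimately show ?thesis using LIMSEQ_unique[OF tendsto_const[of 0]] by fastforce
qed

lemma integral_grad_eq_0:
  assumes u: "C1c S u g" shows "(\<integral>z. g z \<partial>lborel) = 0"
proof (rule complex_eqI)
  have i: "integrable lborel g" by (rule C1c_integrable_grad[OF u])
  show "Re (\<integral>z. g z \<partial>lborel) = Re 0"
    using integral_inner_grad_eq_0[OF u, of 1] integral_Re[OF i] by (simp add: inner_complex_def)
  show "Im (\<integral>z. g z \<partial>lborel) = Im 0"
    using integral_inner_grad_eq_0[OF u, of \<i>] integral_Im[OF i] by (simp add: inner_complex_def)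
qed

text \<open>For \<open>C\<^sup>2\<close> functions this is equality of mixed partials; a difference quotient in the
  imaginary direction replaces one derivative, so \<open>C\<^sup>1\<close> suffices.\<close>
lemma integral_curl_eq_0:
  assumes b: "C1 b gb" and v: "C1c S v gv"
  shows "(\<integral>z. Im (gb z) * Re (gv z) - Re (gb z) * Im (gv z) \<partial>lborel) = 0"
proof -
  let ?t = "\<lambda>n. inverse (real (Suc n))"
  let ?q = "\<lambda>n z. (b (z + ?t n *\<^sub>R \<i>) - b z) / ?t n"
  have t: "\<And>n. ?t n \<noteq> 0" "\<And>n. \<bar>?t n\<bar> \<le> 1" "?t \<longlonglongrightarrow> 0"
    using LIMSEQ_inverse_real_of_nat by (auto simp: field_simps)
  have t': "\<And>n. - ?t n \<noteq> 0" "\<And>n. \<bar>- ?t n\<bar> \<le> 1" "(\<lambda>n. - ?t n) \<longlonglongrightarrow> 0"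
    using t tendsto_minus[OF t(3)] by auto
  obtain K where K: "compact K" "\<And>z. z \<notin> K \<Longrightarrow> v z = 0" "\<And>z. z \<notin> K \<Longrightarrow> gv z = 0"
    using C1c_obtain[OF v] by metis
  have cb: "continuous_on UNIV b" "continuous_on UNIV gb" "continuous_on UNIV v" "continuous_on UNIV gv"
    using b v C1_cont C1_cont_grad C1cD by metis+
  have sh: "continuous_on UNIV (\<lambda>z. f (z + a))" if "continuous_on UNIV f" for f :: "complex \<Rightarrow> 'x::topological_space" and a
    by (rule continuous_on_compose2[OF that]) (auto intro!: continuous_intros)
  obtain R where R: "R > 0" "\<And>z. z \<in> K \<Longrightarrow> norm z \<le> R"
    using compact_imp_bounded[OF K(1)] bounded_pos by blast
  let ?C = "cball (0::complex) (R + 1)"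
  obtain B where B: "\<And>z. z \<in> ?C \<Longrightarrow> norm (gb z) \<le> B"
    using compact_continuous_image[OF continuous_on_subset[OF cb(2)], of ?C] compact_imp_bounded
    by (metis bounded_iff compact_cball image_eqI subset_UNIV)
  have B0: "B \<ge> 0" using B[of 0] R(1) norm_ge_zero[of "gb 0"] by (metis centre_in_cball less_eq_real_def order_trans add_nonneg_nonneg zero_le_one)
  \<comment> \<open>\<open>b\<close> is only locally Lipschitz. On the ball of radius
    \<open>R + 1\<close> its gradient is bounded, and the segment from a point of \<open>K\<close>
    to its shift stays inside.\<close>
  have qb: "\<bar>?q n z\<bar> \<le> B" if "z \<in> K" for n z
  proof -
    have zc: "z + s *\<^sub>R \<i> \<in> ?C" if "0 \<le> s" "s \<le> 1" for s
      using R(2)[OF \<open>z \<in> K\<close>] norm_triangle_ineq[of z "s *\<^sub>R \<i>"] that by simp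
    have "norm (b (z + ?t n *\<^sub>R \<i>) - b z) \<le> B * norm ((z + ?t n *\<^sub>R \<i>) - z)"
    proof (rule differentiable_bound[of ?C b "\<lambda>z h. h \<bullet> gb z"])
      show "(b has_derivative (\<lambda>h. h \<bullet> gb z)) (at z within ?C)" for z
        using C1_GDERIV[OF b] by (simp add: gderiv_def has_derivative_at_withinI)
      show "onorm (\<lambda>h. h \<bullet> gb z) \<le> B" if "z \<in> ?C" for z
        by (rule onorm_le) (metis Cauchy_Schwarz_ineq2 B[OF that] mult.commute mult_left_mono norm_ge_zero order_trans real_norm_def)
      show "z + ?t n *\<^sub>R \<i> \<in> ?C" using zc[of "?t n"] t(2)[of n] by simp
      show "z \<in> ?C" using zc[of 0] by simp
    qed auto
    then have "\<bar>b (z + ?t n *\<^sub>R \<i>) - b z\<bar> \<le> B * ?t n" by simp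
    then show ?thesis by (simp only: abs_divide) (simp add: field_simps)
  qed
  \<comment> \<open>For fixed \<open>n\<close> the quotient \<open>?q n\<close> is C1, so the
    x-derivative of \<open>?q n * v\<close> integrates to 0. The shift then moves the quotient from
    \<open>Re gb\<close> to \<open>v\<close> and reverses the step.\<close>
  have zero: "(\<integral>z. ?q n z * Re (gv z) \<partial>lborel) = (\<integral>z. Re (gb z) * ((v (z + (- ?t n) *\<^sub>R \<i>) - v z) / - ?t n) \<partial>lborel)" for n
  proof -
    have q: "C1 (\<lambda>z. ?q n z) (\<lambda>z. (1 / ?t n) *\<^sub>R (gb (z + ?t n *\<^sub>R \<i>) - gb z))"
      using C1_cmult[OF C1_diff[OF C1_shift[OF b, of "?t n *\<^sub>R \<i>"] b], of "1 / ?t n"] by simp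
    have c: "C1c S (\<lambda>z. ?q n z * v z) (\<lambda>z. ?q n z *\<^sub>R gv z + v z *\<^sub>R ((1 / ?t n) *\<^sub>R (gb (z + ?t n *\<^sub>R \<i>) - gb z)))"
      by (rule C1c_mult[OF v q])
    have "Re (\<integral>z. ?q n z *\<^sub>R gv z + v z *\<^sub>R ((1 / ?t n) *\<^sub>R (gb (z + ?t n *\<^sub>R \<i>) - gb z)) \<partial>lborel) = 0"
      using integral_grad_eq_0[OF c] by simp
    then have "(\<integral>z. ?q n z * Re (gv z) + ((Re (gb (z + ?t n *\<^sub>R \<i>)) - Re (gb z)) / ?t n) * v z \<partial>lborel) = 0"
      by (subst (asm) integral_Re[symmetric, OF C1c_integrable_grad[OF c]]) (simp add: mult.commute divide_inverse mult.assoc)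
    moreover have "integrable lborel (\<lambda>z. ?q n z * Re (gv z))"
      by (rule continuous_compact_support_integrable[OF _ K(1)])
         (use K(3) cb in \<open>auto intro!: continuous_intros sh\<close>)
    moreover have "integrable lborel (\<lambda>z. ((Re (gb (z + ?t n *\<^sub>R \<i>)) - Re (gb z)) / ?t n) * v z)"
      by (rule C1c_integrable[OF v]) (use cb in \<open>auto intro!: continuous_intros sh\<close>)
    ultimately have "(\<integral>z. ?q n z * Re (gv z) \<partial>lborel) = - (\<integral>z. ((Re (gb (z + ?t n *\<^sub>R \<i>)) - Re (gb z)) / ?t n) * v z \<partial>lborel)"
      by simp
    also have "(\<integral>z. ((Re (gb (z + ?t n *\<^sub>R \<i>)) - Re (gb z)) / ?t n) * v z \<partial>lborel)
        = (\<integral>z. Re (gb z) * ((v (z + (- ?t n) *\<^sub>R \<i>) - v z) / ?t n) \<partial>lborel)"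
      by (subst integral_shift_diff_quotient[OF v]) (use cb in \<open>auto intro!: continuous_intros\<close>)
    also have "\<dots> = (\<integral>z. - (Re (gb z) * ((v (z + (- ?t n) *\<^sub>R \<i>) - v z) / - ?t n)) \<partial>lborel)"
      by (simp add: minus_divide_right[symmetric])
    finally show ?thesis by simp
  qed
  have l1: "(\<lambda>n. \<integral>z. ?q n z * Re (gv z) \<partial>lborel) \<longlonglongrightarrow> (\<integral>z. Im (gb z) * Re (gv z) \<partial>lborel)"
  proof (rule integral_dominated_convergence[where w="\<lambda>z. B * \<bar>Re (gv z)\<bar>"])
    show "integrable lborel (\<lambda>z. B * \<bar>Re (gv z)\<bar>)"
      using C1c_integrable_grad[OF v] by simp
    show "AE z in lborel. (\<lambda>n. ?q n z * Re (gv z)) \<longlonglongrightarrow> Im (gb z) * Re (gv z)"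
      using C1_diff_quotient_tendsto[OF b t(1,3), of _ \<i>]
      by (intro AE_I2 tendsto_mult tendsto_const) (simp add: inner_complex_def)
    show "AE z in lborel. norm (?q n z * Re (gv z)) \<le> B * \<bar>Re (gv z)\<bar>" for n
    proof (intro AE_I2)
      fix z show "norm (?q n z * Re (gv z)) \<le> B * \<bar>Re (gv z)\<bar>"
      proof (cases "z \<in> K")
        case True
        show ?thesis unfolding real_norm_def abs_mult
          by (rule mult_right_mono[OF qb[OF True]]) simp
      qed (use K(3) in simp)
    qed
    show "(\<lambda>z. Im (gb z) * Re (gv z)) \<in> borel_measurable lborel"
      using cb by (auto intro!: borel_measurable_continuous_onI continuous_intros)
    show "(\<lambda>z. ?q n z * Re (gv z)) \<in> borel_measurable lborel" for n
      using cb by (auto intro!: borel_measurable_continuous_onI continuous_intros sh)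
  qed
  have l2: "(\<lambda>n. \<integral>z. Re (gb z) * ((v (z + (- ?t n) *\<^sub>R \<i>) - v z) / - ?t n) \<partial>lborel) \<longlonglongrightarrow> (\<integral>z. Re (gb z) * (\<i> \<bullet> gv z) \<partial>lborel)"
    by (rule integral_diff_quotient_tendsto[OF v _ t']) (use cb in \<open>auto intro!: continuous_intros\<close>)
  have "(\<integral>z. Im (gb z) * Re (gv z) \<partial>lborel) = (\<integral>z. Re (gb z) * (\<i> \<bullet> gv z) \<partial>lborel)"
    using LIMSEQ_unique[OF l1] l2 zero by simp
  moreover have "integrable lborel (\<lambda>z. Im (gb z) * Re (gv z))" "integrable lborel (\<lambda>z. Re (gb z) * Im (gv z))"
    using K(1,3) cb by (auto intro!: continuous_compact_support_integrable[OF _ K(1)] continuous_intros)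
  ultimately show ?thesis by (simp add: inner_complex_def)
qed

text \<open>Cauchy-Riemann in weak form: \<open>g\<close> is twice the derivative of \<open>u\<close> with respect to \<open>cnj z\<close>.\<close>
lemma holomorphic_integral_grad_eq_0:
  assumes f: "f holomorphic_on S" and S: "open S" and u: "C1c S u g"
  shows "(\<integral>z. indicator S z *\<^sub>R (f z * g z) \<partial>lborel) = 0"
proof -
  obtain K where K: "compact K" "K \<subseteq> S" "\<And>z. z \<notin> K \<Longrightarrow> u z = 0" "\<And>z. z \<notin> K \<Longrightarrow> g z = 0"
    using C1c_obtain[OF u] by metis
  have cl: "open (- K)" using K(1) compact_imp_closed by auto
  have cu: "continuous_on UNIV u" "continuous_on UNIV g" using u C1_cont C1_cont_grad C1cD by metis+
  \<comment> \<open>\<open>S\<close> and the complement of \<open>K\<close> are open and cover the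
    plane; the zero extension is continuous on each.\<close>
  have glue: "continuous_on UNIV (\<lambda>z. if z \<in> S then F z else 0)"
    if "continuous_on S F" "\<And>z. z \<notin> K \<Longrightarrow> F z = 0" for F :: "complex \<Rightarrow> 'x::real_normed_vector"
  proof -
    have "continuous_on (S \<union> - K) (\<lambda>z. if z \<in> S then F z else 0)"
    proof (rule continuous_on_open_Un[OF S cl])
      show "continuous_on S (\<lambda>z. if z \<in> S then F z else 0)"
        using that(1) by (rule continuous_on_eq) auto
      show "continuous_on (- K) (\<lambda>z. if z \<in> S then F z else 0)"
        by (rule continuous_on_eq[of _ "\<lambda>z. 0"]) (use that(2) in auto)
    qed
    moreover have "S \<union> - K = UNIV" using K(2) by auto
    ultimately show ?thesis by simp
  qed
  have cf: "continuous_on S f" using f holomorphic_on_imp_continuous_on by blast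
  have cf': "continuous_on S (deriv f)"
    using holomorphic_deriv[OF f S] holomorphic_on_imp_continuous_on by blast
  \<comment> \<open>\<open>A\<close> stands for \<open>Re\<close> or \<open>Im\<close>, and
    \<open>G\<close> is the gradient of \<open>A\<close> after \<open>f\<close>, expressed below
    through \<open>cnj (deriv f)\<close>.\<close>
  have main: "C1c S (\<lambda>z. if z \<in> S then A (f z) * u z else 0)
      (\<lambda>z. if z \<in> S then A (f z) *\<^sub>R g z + u z *\<^sub>R G z else 0)"
    if A: "bounded_linear A" and G: "continuous_on S G" "\<And>z h. z \<in> S \<Longrightarrow> A (deriv f z * h) = h \<bullet> G z" for A G
  proof (rule C1cI[OF _ K(1,2)])
    have "GDERIV (\<lambda>z. if z \<in> S then A (f z) * u z else 0) z :> (if z \<in> S then A (f z) *\<^sub>R g z + u z *\<^sub>R G z else 0)" for z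
    proof (cases "z \<in> S")
      case True
      have "(f has_derivative (\<lambda>h. deriv f z * h)) (at z)"
        using holomorphic_derivI[OF f S True] by (simp add: has_field_derivative_def)
      then have "((\<lambda>z. A (f z)) has_derivative (\<lambda>h. A (deriv f z * h))) (at z)"
        by (rule bounded_linear.has_derivative[OF A])
      then have "GDERIV (\<lambda>z. A (f z)) z :> G z"
        using G(2)[OF True] by (simp add: gderiv_def)
      from GDERIV_mult[OF this C1_GDERIV[OF C1cD[OF u], of z]]
      have "((\<lambda>z. A (f z) * u z) has_derivative (\<lambda>h. h \<bullet> (A (f z) *\<^sub>R g z + u z *\<^sub>R G z))) (at z)"
        by (simp add: gderiv_def)
      then have "((\<lambda>z. if z \<in> S then A (f z) * u z else 0) has_derivative (\<lambda>h. h \<bullet> (A (f z) *\<^sub>R g z + u z *\<^sub>R G z))) (at z)"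
        by (rule has_derivative_transform_within_open[OF _ S True]) auto
      with True show ?thesis by (simp add: gderiv_def)
    next
      case False
      then have "z \<in> - K" using K(2) by auto
      have "((\<lambda>z. if z \<in> S then A (f z) * u z else 0) has_derivative (\<lambda>h. 0)) (at z)"
        by (rule has_derivative_transform_within_open[OF has_derivative_const[of 0] cl \<open>z \<in> - K\<close>]) (use K(3) in auto)
      with False show ?thesis by (simp add: gderiv_def)
    qed
    moreover have "continuous_on UNIV (\<lambda>z. if z \<in> S then A (f z) *\<^sub>R g z + u z *\<^sub>R G z else 0)"
      by (rule glue)
         (use G(1) cf cu K in \<open>auto intro!: continuous_intros bounded_linear.continuous_on[OF A] intro: continuous_on_subset\<close>)
    ultimately show "C1 (\<lambda>z. if z \<in> S then A (f z) * u z else 0) (\<lambda>z. if z \<in> S then A (f z) *\<^sub>R g z + u z *\<^sub>R G z else 0)"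
      by (simp add: C1_def)
    show "(if z \<in> S then A (f z) * u z else 0) = 0" if "z \<notin> K" for z using K(3) that by auto
  qed
  have r: "C1c S (\<lambda>z. if z \<in> S then Re (f z) * u z else 0)
      (\<lambda>z. if z \<in> S then Re (f z) *\<^sub>R g z + u z *\<^sub>R cnj (deriv f z) else 0)"
    by (rule main[OF bounded_linear_Re])
       (auto simp: inner_complex_def algebra_simps intro!: continuous_intros cf')
  have i: "C1c S (\<lambda>z. if z \<in> S then Im (f z) * u z else 0)
      (\<lambda>z. if z \<in> S then Im (f z) *\<^sub>R g z + u z *\<^sub>R (\<i> * cnj (deriv f z)) else 0)"
    by (rule main[OF bounded_linear_Im])
       (auto simp: inner_complex_def algebra_simps intro!: continuous_intros cf')
  \<comment> \<open>\<open>f * g\<close> is the gradient of \<open>Re f * u\<close> plus \<i> times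
    that of \<open>Im f * u\<close>; the terms with \<open>deriv f\<close> cancel since the square
    of \<i> is -1.\<close>
  have "(\<lambda>z. indicator S z *\<^sub>R (f z * g z)) =
     (\<lambda>z. (if z \<in> S then Re (f z) *\<^sub>R g z + u z *\<^sub>R cnj (deriv f z) else 0)
        + \<i> * (if z \<in> S then Im (f z) *\<^sub>R g z + u z *\<^sub>R (\<i> * cnj (deriv f z)) else 0))"
    by (auto simp: fun_eq_iff complex_eq_iff algebra_simps)
  then have "(\<integral>z. indicator S z *\<^sub>R (f z * g z) \<partial>lborel) =
     (\<integral>z. (if z \<in> S then Re (f z) *\<^sub>R g z + u z *\<^sub>R cnj (deriv f z) else 0) \<partial>lborel)
     + \<i> * (\<integral>z. (if z \<in> S then Im (f z) *\<^sub>R g z + u z *\<^sub>R (\<i> * cnj (deriv f z)) else 0) \<partial>lborel)"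
    using C1c_integrable_grad[OF r] C1c_integrable_grad[OF i] by simp
  also have "\<dots> = 0" using integral_grad_eq_0[OF r] integral_grad_eq_0[OF i] by simp
  finally show ?thesis .
qed

section \<open>Square-integrable functions\<close>

text \<open>The choice t = -b/a in a quadratic bounded below. With e a norm it gives Cauchy-Schwarz;
  with e the slack of a near-minimiser it gives an approximate Euler-Lagrange equation.\<close>

lemma quadratic_bound:
  fixes a b e :: real
  assumes "a \<ge> 0" "e \<ge> 0" "\<And>t. t\<^sup>2 * a + 2 * t * b \<ge> - e\<^sup>2"
  shows "\<bar>b\<bar> \<le> e * sqrt a"
proof (cases "a = 0")
  case True
  have "b = 0"
  proof (rule ccontr)
    assume "b \<noteq> 0"
    then show False using assms(3)[of "- (e\<^sup>2 + 1) / (2 * b)"] True by simp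
  qed
  then show ?thesis using True by simp
next
  case False
  then have a: "a > 0" using assms(1) by simp
  have "(- b / a)\<^sup>2 * a + 2 * (- b / a) * b = - b\<^sup>2 / a"
    using a by (simp add: field_simps power2_eq_square)
  then have "b\<^sup>2 / a \<le> e\<^sup>2"
    using assms(3)[of "- b / a"] by linarith
  then have "b\<^sup>2 \<le> e\<^sup>2 * a"
    using a by (simp add: pos_divide_le_eq)
  then have "sqrt (b\<^sup>2) \<le> sqrt (e\<^sup>2 * a)" by (rule real_sqrt_le_mono)
  then show ?thesis using assms(2) by (simp add: real_sqrt_mult)
qed

text \<open>Members are functions on the whole plane; a function on \<open>S\<close> enters after
  extension by zero, as \<open>indicator S z *\<^sub>R f z\<close>.\<close>

definition L2 :: "(complex \<Rightarrow> complex) set" where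
  "L2 = {f. f \<in> borel_measurable borel \<and> integrable lborel (\<lambda>z. (cmod (f z))\<^sup>2)}"

text \<open>Where the square is not integrable, the integral defaults to 0; norm estimates are
  therefore accompanied by membership in \<open>L2\<close>.\<close>

definition nrm :: "(complex \<Rightarrow> complex) \<Rightarrow> real" where
  "nrm f = sqrt (\<integral>z. (cmod (f z))\<^sup>2 \<partial>lborel)"

lemma L2_meas: "f \<in> L2 \<Longrightarrow> f \<in> borel_measurable borel"
  and L2_int: "f \<in> L2 \<Longrightarrow> integrable lborel (\<lambda>z. (cmod (f z))\<^sup>2)"
  by (auto simp: L2_def)

lemma nrm_nonneg [simp]: "nrm f \<ge> 0"
  by (simp add: nrm_def)

lemma nrm_sq: "(nrm f)\<^sup>2 = (\<integral>z. (cmod (f z))\<^sup>2 \<partial>lborel)"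
  by (simp add: nrm_def)

lemma L2_dominated:
  assumes "f \<in> borel_measurable borel" "integrable lborel h" "\<And>z. (cmod (f z))\<^sup>2 \<le> h z"
  shows "f \<in> L2"
proof -
  have "(cmod (f z))\<^sup>2 \<le> \<bar>h z\<bar>" for z using assms(3)[of z] by linarith
  then show ?thesis
    unfolding L2_def using assms(1)
    by (auto intro!: Bochner_Integration.integrable_bound[OF assms(2)])
qed

lemma L2_mono:
  assumes "f \<in> borel_measurable borel" "h \<in> L2" "\<And>z. cmod (f z) \<le> cmod (h z)"
  shows "f \<in> L2" "nrm f \<le> nrm h"
proof -
  have le: "(cmod (f z))\<^sup>2 \<le> (cmod (h z))\<^sup>2" for z using assms(3) by (simp add: power_mono)
  show "f \<in> L2" by (rule L2_dominated[OF assms(1) L2_int[OF assms(2)] le])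
  then show "nrm f \<le> nrm h"
    unfolding nrm_def by (intro real_sqrt_le_mono integral_mono L2_int assms le)
qed

lemma L2_add:
  assumes "f \<in> L2" "h \<in> L2" shows "(\<lambda>z. f z + h z) \<in> L2"
proof (rule L2_dominated[where h="\<lambda>z. 2 * (cmod (f z))\<^sup>2 + 2 * (cmod (h z))\<^sup>2"])
  show "(cmod (f z + h z))\<^sup>2 \<le> 2 * (cmod (f z))\<^sup>2 + 2 * (cmod (h z))\<^sup>2" for z
  proof -
    have "(cmod (f z + h z))\<^sup>2 \<le> (cmod (f z) + cmod (h z))\<^sup>2" by (intro power_mono norm_triangle_ineq) auto
    also have "\<dots> \<le> 2 * (cmod (f z))\<^sup>2 + 2 * (cmod (h z))\<^sup>2"
      using zero_le_power2[of "cmod (f z) - cmod (h z)"] by (simp add: power2_eq_square algebra_simps)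
    finally show ?thesis .
  qed
  show "(\<lambda>z. f z + h z) \<in> borel_measurable borel"
    using assms[THEN L2_meas] by (rule borel_measurable_add)
  show "integrable lborel (\<lambda>z. 2 * (cmod (f z))\<^sup>2 + 2 * (cmod (h z))\<^sup>2)"
    using assms[THEN L2_int] by simp
qed

lemma L2_cmult: "f \<in> L2 \<Longrightarrow> (\<lambda>z. a * f z) \<in> L2"
  by (auto simp: L2_def norm_mult power_mult_distrib)

lemma L2_scaleR: "f \<in> L2 \<Longrightarrow> (\<lambda>z. a *\<^sub>R f z) \<in> L2"
  using L2_cmult[of f "of_real a"] by (simp add: scaleR_conv_of_real)

lemma L2_diff: "f \<in> L2 \<Longrightarrow> h \<in> L2 \<Longrightarrow> (\<lambda>z. f z - h z) \<in> L2"
  using L2_add[OF _ L2_cmult[of h "-1"], of f] by simp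

lemma L2_cnj: "f \<in> L2 \<Longrightarrow> (\<lambda>z. cnj (f z)) \<in> L2"
  using measurable_compose[of f borel borel cnj borel] borel_measurable_continuous_onI[of cnj]
  by (auto simp: L2_def continuous_on_cnj continuous_on_id)

lemma nrm_cnj: "nrm (\<lambda>z. cnj (f z)) = nrm f"
  by (simp add: nrm_def)

lemma nrm_cmult: "nrm (\<lambda>z. a * f z) = cmod a * nrm f"
  by (simp add: nrm_def norm_mult power_mult_distrib real_sqrt_mult)

lemma nrm_minus_commute: "nrm (\<lambda>z. f z - h z) = nrm (\<lambda>z. h z - f z)"
  by (simp add: nrm_def norm_minus_commute)

lemma L2_continuous:
  assumes "continuous_on UNIV f" "compact K" "\<And>z. z \<notin> K \<Longrightarrow> f z = 0"
  shows "f \<in> L2"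
  unfolding L2_def using assms
  by (auto intro!: borel_measurable_continuous_onI continuous_compact_support_integrable[OF _ assms(2)] continuous_intros)

lemma C1c_L2: assumes "C1c S u g" shows "g \<in> L2"
  by (metis C1c_obtain[OF assms] C1cD C1_cont_grad L2_continuous assms)

lemma L2_mult_integrable:
  assumes "f \<in> L2" "h \<in> L2" shows "integrable lborel (\<lambda>z. f z * h z)"
proof (rule Bochner_Integration.integrable_bound[where f="\<lambda>z. (cmod (f z))\<^sup>2 + (cmod (h z))\<^sup>2"])
  have "cmod (f z * h z) \<le> (cmod (f z))\<^sup>2 + (cmod (h z))\<^sup>2" for z
    using sum_squares_bound[of "cmod (f z)" "cmod (h z)"] mult_nonneg_nonneg[OF norm_ge_zero[of "f z"] norm_ge_zero[of "h z"]]
    unfolding norm_mult by linarith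
  then show "AE z in lborel. norm (f z * h z) \<le> norm ((cmod (f z))\<^sup>2 + (cmod (h z))\<^sup>2)" by auto
qed (use assms in \<open>auto simp: L2_def\<close>)

lemma L2_inner_integrable:
  assumes "f \<in> L2" "h \<in> L2" shows "integrable lborel (\<lambda>z. f z \<bullet> h z)"
proof -
  have "(\<lambda>z. f z \<bullet> h z) = (\<lambda>z. Re (f z * cnj (h z)))" by (simp add: inner_complex_def)
  then show ?thesis using integrable_Re[OF L2_mult_integrable[OF assms(1) L2_cnj[OF assms(2)]]] by (simp only:)
qed

lemma nrm_sq_add:
  assumes "f \<in> L2" "h \<in> L2"
  shows "(nrm (\<lambda>z. f z + t *\<^sub>R h z))\<^sup>2 = (nrm f)\<^sup>2 + 2 * t * (\<integral>z. f z \<bullet> h z \<partial>lborel) + t\<^sup>2 * (nrm h)\<^sup>2"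
proof -
  have "(cmod (f z + t *\<^sub>R h z))\<^sup>2 = (cmod (f z))\<^sup>2 + 2 * t * (f z \<bullet> h z) + t\<^sup>2 * (cmod (h z))\<^sup>2" for z
    by (simp add: power2_norm_eq_inner inner_add_left inner_add_right inner_commute algebra_simps) (simp add: power2_eq_square)
  then show ?thesis unfolding nrm_sq
    using L2_int[OF assms(1)] L2_int[OF assms(2)] L2_inner_integrable[OF assms] by simp
qed

lemma L2_norm_mult_le:
  assumes "f \<in> L2" "h \<in> L2"
  shows "(\<integral>z. cmod (f z) * cmod (h z) \<partial>lborel) \<le> nrm f * nrm h"
proof -
  let ?b = "\<integral>z. cmod (f z) * cmod (h z) \<partial>lborel"
  have i: "integrable lborel (\<lambda>z. cmod (f z) * cmod (h z))"
    using integrable_norm[OF L2_mult_integrable[OF assms]] by (simp add: norm_mult)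
  have "\<bar>?b\<bar> \<le> nrm f * sqrt ((nrm h)\<^sup>2)"
  proof (rule quadratic_bound)
    fix t
    have "0 \<le> (\<integral>z. (cmod (f z) + t * cmod (h z))\<^sup>2 \<partial>lborel)" by simp
    also have "\<dots> = (\<integral>z. (cmod (f z))\<^sup>2 + 2 * t * (cmod (f z) * cmod (h z)) + t\<^sup>2 * (cmod (h z))\<^sup>2 \<partial>lborel)"
      by (simp add: power2_sum power_mult_distrib algebra_simps)
    also have "\<dots> = (nrm f)\<^sup>2 + 2 * t * ?b + t\<^sup>2 * (nrm h)\<^sup>2"
      using i L2_int[OF assms(1)] L2_int[OF assms(2)] by (simp add: nrm_sq)
    finally show "- (nrm f)\<^sup>2 \<le> t\<^sup>2 * (nrm h)\<^sup>2 + 2 * t * ?b" by simp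
  qed auto
  then show ?thesis by simp
qed

lemma L2_Cauchy_Schwarz:
  assumes "f \<in> L2" "h \<in> L2"
  shows "cmod (\<integral>z. f z * h z \<partial>lborel) \<le> nrm f * nrm h"
  using integral_norm_bound[of lborel "\<lambda>z. f z * h z"] L2_norm_mult_le[OF assms] by (simp add: norm_mult)

lemma L2_inner_Cauchy_Schwarz:
  assumes "f \<in> L2" "h \<in> L2"
  shows "\<bar>\<integral>z. f z \<bullet> h z \<partial>lborel\<bar> \<le> nrm f * nrm h"
proof -
  have "\<bar>\<integral>z. f z \<bullet> h z \<partial>lborel\<bar> \<le> (\<integral>z. \<bar>f z \<bullet> h z\<bar> \<partial>lborel)"
    by (rule integral_abs_bound)
  also have "\<dots> \<le> (\<integral>z. cmod (f z) * cmod (h z) \<partial>lborel)"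
    using integrable_norm[OF L2_mult_integrable[OF assms]] L2_inner_integrable[OF assms]
    by (intro integral_mono) (auto simp: norm_mult Cauchy_Schwarz_ineq2)
  finally show ?thesis using L2_norm_mult_le[OF assms] by linarith
qed

lemma nrm_triangle:
  assumes "f \<in> L2" "h \<in> L2" shows "nrm (\<lambda>z. f z + h z) \<le> nrm f + nrm h"
proof (rule power2_le_imp_le)
  have "(nrm (\<lambda>z. f z + h z))\<^sup>2 \<le> (nrm f)\<^sup>2 + 2 * (nrm f * nrm h) + (nrm h)\<^sup>2"
    using nrm_sq_add[OF assms, of 1] L2_inner_Cauchy_Schwarz[OF assms] by simp
  then show "(nrm (\<lambda>z. f z + h z))\<^sup>2 \<le> (nrm f + nrm h)\<^sup>2" by (simp add: power2_sum)
qed simp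

lemma L2_bounded_mult:
  assumes "u \<in> borel_measurable borel" "\<And>z. \<bar>u z\<bar> \<le> B" "f \<in> L2"
  shows "(\<lambda>z. u z *\<^sub>R f z) \<in> L2" "nrm (\<lambda>z. u z *\<^sub>R f z) \<le> B * nrm f"
proof -
  have B: "B \<ge> 0" using assms(2)[of 0] by linarith
  have *: "cmod (u z *\<^sub>R f z) \<le> cmod (of_real B * f z)" for z
    using assms(2)[of z] B by (simp add: norm_mult mult_right_mono)
  have m: "(\<lambda>z. u z *\<^sub>R f z) \<in> borel_measurable borel" using assms by (auto dest: L2_meas)
  show "(\<lambda>z. u z *\<^sub>R f z) \<in> L2" "nrm (\<lambda>z. u z *\<^sub>R f z) \<le> B * nrm f"
    using L2_mono[OF m L2_cmult[OF assms(3), of "of_real B"] *] nrm_cmult[of "of_real B" f] B by auto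
qed

lemma L2_indicator: "f \<in> L2 \<Longrightarrow> S \<in> sets borel \<Longrightarrow> (\<lambda>z. indicator S z *\<^sub>R f z) \<in> L2"
  by (rule L2_bounded_mult(1)[where B=1]) (auto simp: indicator_def)

lemma bergman_space_iff:
  assumes "open S"
  shows "f \<in> bergman_space S \<longleftrightarrow> f holomorphic_on S \<and> (\<lambda>z. indicator S z *\<^sub>R f z) \<in> L2"
proof -
  have "(\<lambda>z. indicator S z *\<^sub>R f z) \<in> borel_measurable borel" if "f holomorphic_on S"
    using borel_measurable_continuous_on_indicator[OF _ holomorphic_on_imp_continuous_on[OF that]] assms by simp
  moreover have "(\<lambda>z. (cmod (indicator S z *\<^sub>R f z))\<^sup>2) = (\<lambda>z. indicator S z *\<^sub>R (cmod (f z))\<^sup>2)"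
    by (auto simp: fun_eq_iff indicator_def)
  ultimately show ?thesis by (auto simp: bergman_space_def L2_def set_integrable_def)
qed

section \<open>A radial bump and its complex potential\<close>

definition sq :: "real \<Rightarrow> real" where "sq x = (max 0 x)\<^sup>2"

text \<open>At 0 the quotient of the glued function is dominated by that of \<open>f\<close>, which
  tends to \<open>f' 0 = 0\<close>.\<close>

lemma DERIV_glue_zero:
  fixes f f' :: "real \<Rightarrow> real"
  assumes "\<And>x. x \<ge> 0 \<Longrightarrow> DERIV f x :> f' x" "f 0 = 0" "f' 0 = 0"
  shows "DERIV (\<lambda>x. if x \<le> 0 then 0 else f x) x :> (if x \<le> 0 then 0 else f' x)"
proof -
  consider "x < 0" | "x = 0" | "x > 0" by linarith
  then show ?thesis
  proof cases
    case 1
    have "DERIV (\<lambda>x. if x \<le> 0 then 0 else f x) x :> 0"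
      by (rule has_field_derivative_transform_within_open[of "\<lambda>x. 0" _ _ "{..<0}"]) (use 1 in auto)
    with 1 show ?thesis by simp
  next
    case 2
    have "((\<lambda>h. (f (0 + h) - f 0) / h) \<longlongrightarrow> f' 0) (at 0)" using assms(1)[of 0] by (simp add: DERIV_def)
    then have l: "((\<lambda>h. f h / h) \<longlongrightarrow> 0) (at 0)" using assms by simp
    have "((\<lambda>h. (if h \<le> 0 then 0 else f h) / h) \<longlongrightarrow> 0) (at 0)"
      by (rule Lim_null_comparison[OF _ tendsto_norm_zero[OF l]]) (auto intro!: always_eventually simp: divide_le_0_iff)
    then show ?thesis using 2 by (simp add: DERIV_def cong: if_cong)
  next
    case 3
    have "DERIV (\<lambda>x. if x \<le> 0 then 0 else f x) x :> f' x"
      by (rule has_field_derivative_transform_within_open[of f _ _ "{0<..}"]) (use 3 assms(1) in auto)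
    with 3 show ?thesis by simp
  qed
qed

lemma DERIV_sq: "DERIV sq x :> 2 * max 0 x"
proof -
  have "DERIV (\<lambda>x. if x \<le> 0 then 0 else x\<^sup>2) x :> (if x \<le> 0 then 0 else 2 * x)"
    by (rule DERIV_glue_zero) (auto intro!: derivative_eq_intros)
  moreover have "(\<lambda>x. if x \<le> 0 then 0 else x\<^sup>2) = sq" by (auto simp: sq_def fun_eq_iff max_def)
  moreover have "(if x \<le> 0 then 0 else 2 * x) = 2 * max 0 x" by (simp add: max_def)
  ultimately show ?thesis by simp
qed

lemma sq_nonneg [simp]: "sq x \<ge> 0" by (simp add: sq_def)

text \<open>The bump \<open>\<psi>(\<zeta>) = 3 (1 - \<bar>\<zeta>\<bar>\<^sup>2 / r\<^sup>2)\<^sub>+\<^sup>2\<close> is \<open>\<partial>P/\<partial>\<zeta>\<close> for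
  \<open>P(\<zeta>) = \<zeta> k(\<bar>\<zeta>\<bar>\<^sup>2 / r\<^sup>2)\<close>, where \<open>k(t) = 3 - 3t + t\<^sup>2\<close> for \<open>t \<le> 1\<close> and
  \<open>k(t) = 1/t\<close> for \<open>t \<ge> 1\<close>; so \<open>P\<close> equals \<open>r\<^sup>2 / cnj \<zeta>\<close> outside the disc.\<close>
definition radial :: "real \<Rightarrow> real" where
  "radial t = 3 - 3 * t + t\<^sup>2 - (if t - 1 \<le> 0 then 0 else (t - 1) ^ 3 / (1 + (t - 1)))"

definition radial' :: "real \<Rightarrow> real" where
  "radial' t = - 3 + 2 * t - (if t - 1 \<le> 0 then 0 else (3 * (t - 1)\<^sup>2 * (1 + (t - 1)) - (t - 1) ^ 3) / (1 + (t - 1))\<^sup>2)"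

lemma DERIV_radial: "DERIV radial t :> radial' t"
proof -
  have g: "DERIV (\<lambda>x::real. if x \<le> 0 then 0 else x ^ 3 / (1 + x)) x :>
      (if x \<le> 0 then 0 else (3 * x\<^sup>2 * (1 + x) - x ^ 3) / (1 + x)\<^sup>2)" for x
    by (rule DERIV_glue_zero) (auto intro!: derivative_eq_intros simp: power2_eq_square)
  have "DERIV (\<lambda>t. t - 1) t :> (1::real)" by (auto intro!: derivative_eq_intros)
  from DERIV_chain2[OF g this]
  have "DERIV (\<lambda>t. if t - 1 \<le> 0 then 0 else (t - 1) ^ 3 / (1 + (t - 1))) t :>
      (if t - 1 \<le> 0 then 0 else (3 * (t - 1)\<^sup>2 * (1 + (t - 1)) - (t - 1) ^ 3) / (1 + (t - 1))\<^sup>2)"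
    by simp
  moreover have "DERIV (\<lambda>t. 3 - 3 * t + t\<^sup>2) t :> - 3 + 2 * t" by (auto intro!: derivative_eq_intros)
  ultimately have "DERIV (\<lambda>t. 3 - 3 * t + t\<^sup>2 - (if t - 1 \<le> 0 then 0 else (t - 1) ^ 3 / (1 + (t - 1)))) t :> radial' t"
    unfolding radial'_def by (rule DERIV_diff[rotated])
  then show ?thesis unfolding radial_def[abs_def] .
qed

lemma radial_ge_1: "t \<ge> 1 \<Longrightarrow> radial t = 1 / t"
  unfolding radial_def by (auto simp: field_simps power2_eq_square power3_eq_cube)

lemma radial'_ge_1: "t \<ge> 1 \<Longrightarrow> radial' t = - 1 / t\<^sup>2"
  unfolding radial'_def by (auto simp: field_simps power2_eq_square power3_eq_cube)

text \<open>The left side is the derivative of P with respect to its variable, at t the squared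
  modulus over r^2. It vanishes for t >= 1 because P is antiholomorphic there.\<close>

lemma radial_psi: "t \<ge> 0 \<Longrightarrow> radial t + t * radial' t = 3 * sq (1 - t)"
proof (cases "t \<ge> 1")
  case True
  then show ?thesis by (simp add: radial_ge_1 radial'_ge_1 sq_def power2_eq_square field_simps)
next
  case False
  then show ?thesis by (simp add: radial_def radial'_def sq_def power2_eq_square algebra_simps max_def)
qed

lemma continuous_radial': "continuous_on UNIV radial'"
proof -
  define F :: "real \<Rightarrow> real" where
    "F = (\<lambda>x. if x \<le> 0 then 0 else (3 * x\<^sup>2 * (1 + x) - x ^ 3) / (1 + x)\<^sup>2)"
  have "continuous_on ({..0} \<union> {0..}) F"
    unfolding F_def by (rule continuous_on_cases) (auto intro!: continuous_intros)
  moreover have "{..0} \<union> {0..} = (UNIV :: real set)" by auto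
  ultimately have F: "continuous_on UNIV F" by simp
  have "radial' = (\<lambda>t. - 3 + 2 * t - F (t - 1))" by (simp add: radial'_def F_def fun_eq_iff)
  moreover have "continuous_on UNIV (\<lambda>t. - 3 + 2 * t - F (t - 1))"
    by (auto intro!: continuous_intros continuous_on_compose2[OF F])
  ultimately show ?thesis by (simp only:)
qed

lemma radial_bounds: "t \<ge> 0 \<Longrightarrow> 0 \<le> radial t" "t \<ge> 0 \<Longrightarrow> radial t \<le> 3"
proof -
  have *: "3 - 3 * t + t\<^sup>2 = (t - 3/2)\<^sup>2 + 3/4" for t :: real by (simp add: power2_eq_square algebra_simps)
  show "0 \<le> radial t" if "t \<ge> 0"
  proof (cases "t \<ge> 1")
    case False
    then have "radial t = 3 - 3 * t + t\<^sup>2" by (simp add: radial_def)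
    then show ?thesis using *[of t] zero_le_power2[of "t - 3/2"] by linarith
  qed (simp add: radial_ge_1)
  show "radial t \<le> 3" if "t \<ge> 0"
  proof (cases "t \<ge> 1")
    case True
    then show ?thesis by (simp add: radial_ge_1 divide_le_eq)
  next
    case False
    then have "t * t \<le> 1 * t" using that by (intro mult_right_mono) auto
    then show ?thesis using False that by (simp add: radial_def power2_eq_square)
  qed
qed

definition bump :: "complex \<Rightarrow> real \<Rightarrow> complex \<Rightarrow> real" where
  "bump z r y = 3 * sq (1 - (cmod (y - z))\<^sup>2 / r\<^sup>2)"

definition bump_grad :: "complex \<Rightarrow> real \<Rightarrow> complex \<Rightarrow> complex" where
  "bump_grad z r y = (- 12 * max 0 (1 - (cmod (y - z))\<^sup>2 / r\<^sup>2) / r\<^sup>2) *\<^sub>R (y - z)"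

text \<open>Component of P in the direction \<open>e\<close>: the real part for
  \<open>e = 1\<close>, the imaginary part for \<open>e = \<i>\<close>.\<close>

definition pot :: "complex \<Rightarrow> complex \<Rightarrow> real \<Rightarrow> complex \<Rightarrow> real" where
  "pot e z r y = ((y - z) \<bullet> e) * radial ((cmod (y - z))\<^sup>2 / r\<^sup>2)"

definition pot_grad :: "complex \<Rightarrow> complex \<Rightarrow> real \<Rightarrow> complex \<Rightarrow> complex" where
  "pot_grad e z r y = radial ((cmod (y - z))\<^sup>2 / r\<^sup>2) *\<^sub>R e
     + (((y - z) \<bullet> e) * radial' ((cmod (y - z))\<^sup>2 / r\<^sup>2) * 2 / r\<^sup>2) *\<^sub>R (y - z)"

lemma C1_radius: "C1 (\<lambda>y. (cmod (y - z))\<^sup>2 / r\<^sup>2) (\<lambda>y. (2 / r\<^sup>2) *\<^sub>R (y - z))"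
proof -
  have "C1 (\<lambda>y. (1 / r\<^sup>2) * (cmod (y + - z))\<^sup>2) (\<lambda>y. (1 / r\<^sup>2) *\<^sub>R (2 *\<^sub>R (y + - z)))"
    by (rule C1_cmult[OF C1_shift[OF C1_norm_sq]])
  then show ?thesis by simp
qed

lemma C1_bump: "C1 (bump z r) (bump_grad z r)"
proof -
  have 1: "DERIV (\<lambda>x. 3 * sq (1 - x)) x :> - 6 * max 0 (1 - x)" for x
    by (auto intro!: derivative_eq_intros DERIV_chain2[OF DERIV_sq])
  have "C1 (\<lambda>y. 3 * sq (1 - (cmod (y - z))\<^sup>2 / r\<^sup>2))
     (\<lambda>y. (- 6 * max 0 (1 - (cmod (y - z))\<^sup>2 / r\<^sup>2)) *\<^sub>R ((2 / r\<^sup>2) *\<^sub>R (y - z)))"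
    by (rule C1_compose[OF C1_radius 1]) (auto intro!: continuous_intros)
  then show ?thesis unfolding bump_def[abs_def] bump_grad_def[abs_def] by simp
qed

lemma C1_pot: "C1 (pot e z r) (pot_grad e z r)"
proof -
  have "C1 (\<lambda>y. (y - z) \<bullet> e) (\<lambda>y. e)" using C1_shift[OF C1_inner[of e], of "- z"] by simp
  from C1_mult[OF this C1_compose[OF C1_radius DERIV_radial continuous_radial', of z r]]
  show ?thesis unfolding pot_def[abs_def] pot_grad_def[abs_def]
    by (simp add: algebra_simps)
qed

text \<open>Inside the disc the radial factor is at most 3; outside, P has modulus r^2 / |y - z|,
  which is at most r.\<close>

lemma pot_bound:
  assumes "norm e \<le> 1" "r > 0" shows "\<bar>pot e z r y\<bar> \<le> 3 * r"
proof -
  let ?n = "cmod (y - z)" and ?t = "(cmod (y - z))\<^sup>2 / r\<^sup>2"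
  have "\<bar>(y - z) \<bullet> e\<bar> \<le> ?n * 1"
    using Cauchy_Schwarz_ineq2[of "y - z" e] mult_left_mono[OF assms(1) norm_ge_zero[of "y - z"]] by linarith
  then have 1: "\<bar>pot e z r y\<bar> \<le> ?n * radial ?t"
    using radial_bounds(1)[of ?t] by (simp add: pot_def abs_mult mult_right_mono)
  show ?thesis
  proof (cases "?n \<ge> r")
    case True
    then have t: "?t \<ge> 1" using assms by (simp add: power_mono)
    have "?n * radial ?t = r\<^sup>2 / ?n" using True assms unfolding radial_ge_1[OF t] by (simp add: power2_eq_square)
    also have "\<dots> \<le> r" using True assms by (simp add: power2_eq_square divide_le_eq mult_left_mono)
    finally show ?thesis using 1 assms by linarith
  next
    case False
    then have "?n * radial ?t \<le> r * 3" using radial_bounds[of ?t] assms by (intro mult_mono) auto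
    then show ?thesis using 1 by linarith
  qed
qed

lemma bump_nonneg [simp]: "bump z r y \<ge> 0" by (simp add: bump_def)

lemma bump_eq_0: "r > 0 \<Longrightarrow> y \<notin> ball z r \<Longrightarrow> bump z r y = 0"
  by (auto simp: bump_def sq_def dist_norm norm_minus_commute max_def power_mono)

lemma bump_C1c: "r > 0 \<Longrightarrow> cball z r \<subseteq> S \<Longrightarrow> C1c S (bump z r) (bump_grad z r)"
  by (rule C1cI[OF C1_bump, of "cball z r"]) (auto simp: bump_eq_0)

text \<open>Real and imaginary part of twice the complex derivative of P, written with the partial
  derivatives of Re P and Im P. That derivative is the real bump, so the imaginary part
  vanishes.\<close>

lemma pot_grad_bump:
  shows "Re (pot_grad 1 z r y) + Im (pot_grad \<i> z r y) = 2 * bump z r y"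
    and "Im (pot_grad 1 z r y) = Re (pot_grad \<i> z r y)"
proof -
  define w where "w = y - z"
  let ?t = "(cmod w)\<^sup>2 / r\<^sup>2"
  have "Re (pot_grad 1 z r y) + Im (pot_grad \<i> z r y)
     = 2 * radial ?t + 2 * radial' ?t * (((Re w)\<^sup>2 + (Im w)\<^sup>2) / r\<^sup>2)"
    unfolding pot_grad_def w_def[symmetric]
    by (simp add: inner_complex_def power2_eq_square add_divide_distrib algebra_simps)
  also have "\<dots> = 2 * (radial ?t + ?t * radial' ?t)" by (simp add: cmod_power2 algebra_simps)
  also have "radial ?t + ?t * radial' ?t = 3 * sq (1 - ?t)" by (rule radial_psi) simp
  finally show "Re (pot_grad 1 z r y) + Im (pot_grad \<i> z r y) = 2 * bump z r y"
    by (simp add: bump_def w_def)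
  show "Im (pot_grad 1 z r y) = Re (pot_grad \<i> z r y)"
    by (simp add: pot_grad_def inner_complex_def)
qed

text \<open>By \<open>pot_grad_bump\<close>, \<open>pot_grad e\<close> minus twice the bump times
  \<open>e\<close> is, up to sign, the gradient of the other component turned by a right angle,
  which \<open>integral_curl_eq_0\<close> annihilates. So \<open>pot e\<close> weakly solves a
  Poisson equation.\<close>

lemma integral_pot_grad:
  assumes v: "C1c S v g" and e: "e = 1 \<or> e = \<i>" and r: "r > 0"
  shows "(\<integral>y. pot_grad e z r y \<bullet> g y \<partial>lborel) = 2 * (\<integral>y. bump z r y * (e \<bullet> g y) \<partial>lborel)"
proof -
  obtain K where K: "compact K" "\<And>z. z \<notin> K \<Longrightarrow> v z = 0" "\<And>z. z \<notin> K \<Longrightarrow> g z = 0"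
    using C1c_obtain[OF v] by metis
  have c: "continuous_on UNIV g" "continuous_on UNIV (pot_grad e' z r)" "continuous_on UNIV (bump z r)" for e'
    using C1_cont_grad C1cD[OF v] C1_pot C1_bump C1_cont by blast+
  have i1: "integrable lborel (\<lambda>y. bump z r y * (e \<bullet> g y))"
    by (rule continuous_compact_support_integrable[OF _ K(1)]) (use K(3) c in \<open>auto intro!: continuous_intros\<close>)
  have i2: "integrable lborel (\<lambda>y. Im (pot_grad e' z r y) * Re (g y) - Re (pot_grad e' z r y) * Im (g y))" for e'
    by (rule continuous_compact_support_integrable[OF _ K(1)]) (use K(3) c in \<open>auto intro!: continuous_intros\<close>)
  show ?thesis
  proof (cases "e = 1")
    case True
    have "pot_grad e z r y \<bullet> g y = 2 * (bump z r y * (e \<bullet> g y))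
        - (Im (pot_grad \<i> z r y) * Re (g y) - Re (pot_grad \<i> z r y) * Im (g y))" for y
    proof -
      have "2 * (bump z r y * Re (g y)) = Re (pot_grad 1 z r y) * Re (g y) + Im (pot_grad \<i> z r y) * Re (g y)"
        unfolding distrib_right[symmetric] pot_grad_bump(1) by simp
      then show ?thesis unfolding True inner_complex_def pot_grad_bump(2) by simp
    qed
    then show ?thesis using i1 i2[of \<i>] integral_curl_eq_0[OF C1_pot[of \<i> z r] v] by simp
  next
    case False
    have "pot_grad e z r y \<bullet> g y = 2 * (bump z r y * (e \<bullet> g y))
        + (Im (pot_grad 1 z r y) * Re (g y) - Re (pot_grad 1 z r y) * Im (g y))" for y
    proof -
      have "2 * (bump z r y * Im (g y)) = Re (pot_grad 1 z r y) * Im (g y) + Im (pot_grad \<i> z r y) * Im (g y)"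
        unfolding distrib_right[symmetric] pot_grad_bump(1) by simp
      then show ?thesis using False e unfolding inner_complex_def pot_grad_bump(2) by auto
    qed
    then show ?thesis using i1 i2[of 1] integral_curl_eq_0[OF C1_pot[of 1 z r] v] by simp
  qed
qed

text \<open>Divided by the squared radius, both potentials equal 1 / \<open>cnj (y - z)\<close>
  outside the larger disc, so their difference has compact support. \<open>u1\<close> and
  \<open>u2\<close> are its real and imaginary parts, and \<open>g1 - \<i> * g2\<close> is the
  conjugate of twice its complex derivative.\<close>

lemma bump_diff_is_derivative:
  assumes "r > 0" "s > 0"
  obtains u1 g1 u2 g2 where "C1c (cball z (max r s)) u1 g1" "C1c (cball z (max r s)) u2 g2"
    "\<And>y. g1 y - \<i> * g2 y = of_real (2 * (bump z r y / r\<^sup>2 - bump z s y / s\<^sup>2))"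
proof -
  let ?u = "\<lambda>e y. (1 / r\<^sup>2) * pot e z r y - (1 / s\<^sup>2) * pot e z s y"
  let ?g = "\<lambda>e y. (1 / r\<^sup>2) *\<^sub>R pot_grad e z r y - (1 / s\<^sup>2) *\<^sub>R pot_grad e z s y"
  have "C1c (cball z (max r s)) (?u e) (?g e)" for e
  proof (rule C1cI)
    show "C1 (?u e) (?g e)" by (intro C1_diff C1_cmult C1_pot)
    show "?u e y = 0" if "y \<notin> cball z (max r s)" for y
    proof -
      have n: "cmod (y - z) > r" "cmod (y - z) > s" using that by (auto simp: dist_norm norm_minus_commute)
      have *: "(1 / r\<^sup>2) * pot e z r y = ((y - z) \<bullet> e) / (cmod (y - z))\<^sup>2" if "r > 0" "cmod (y - z) > r" for r
      proof -
        have "(cmod (y - z))\<^sup>2 / r\<^sup>2 \<ge> 1" using that by (simp add: power_mono)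
        then show ?thesis using that by (simp add: pot_def radial_ge_1)
      qed
      show ?thesis using *[OF assms(1) n(1)] *[OF assms(2) n(2)] by simp
    qed
  qed auto
  moreover have "?g 1 y - \<i> * ?g \<i> y = of_real (2 * (bump z r y / r\<^sup>2 - bump z s y / s\<^sup>2))" for y
  proof -
    have q: "2 * bump z r y = Re (pot_grad 1 z r y) + Im (pot_grad \<i> z r y)" for r
      using pot_grad_bump(1) by simp
    have "2 * (bump z r y / r\<^sup>2 - bump z s y / s\<^sup>2) = (2 * bump z r y) / r\<^sup>2 - (2 * bump z s y) / s\<^sup>2" by simp
    then show ?thesis
      unfolding complex_eq_iff q using pot_grad_bump(2)[of z r y] pot_grad_bump(2)[of z s y]
      by (simp add: add_divide_distrib)
  qed
  ultimately show ?thesis using that by blast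
qed

definition bump_mass :: real where "bump_mass = (\<integral>y. bump 0 1 y \<partial>lborel)"

lemma integrable_bump: "r > 0 \<Longrightarrow> integrable lborel (bump z r)"
  by (rule continuous_compact_support_integrable[OF C1_cont[OF C1_bump], of "cball z r"]) (auto simp: bump_eq_0)

text \<open>The bumps of radii r and 1, each divided by its squared radius, differ by derivatives of
  compactly supported functions, whose integrals vanish. The scaling law thus comes without a change
  of variables.\<close>

lemma integral_bump: "r > 0 \<Longrightarrow> (\<integral>y. bump z r y \<partial>lborel) = r\<^sup>2 * bump_mass"
proof -
  assume r: "r > 0"
  obtain u1 g1 u2 g2 where g: "C1c (cball z (max r 1)) u1 g1" "C1c (cball z (max r 1)) u2 g2"
    "\<And>y. g1 y - \<i> * g2 y = of_real (2 * (bump z r y / r\<^sup>2 - bump z 1 y / 1\<^sup>2))"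
    using bump_diff_is_derivative[OF r zero_less_one, of z] by metis
  have "(\<integral>y. complex_of_real (2 * (bump z r y / r\<^sup>2 - bump z 1 y / 1\<^sup>2)) \<partial>lborel) = (\<integral>y. g1 y - \<i> * g2 y \<partial>lborel)"
    using g(3) by simp
  also have "\<dots> = 0"
    using C1c_integrable_grad[OF g(1)] C1c_integrable_grad[OF g(2)] integral_grad_eq_0[OF g(1)] integral_grad_eq_0[OF g(2)] by simp
  finally have "(\<integral>y. 2 * (bump z r y / r\<^sup>2 - bump z 1 y) \<partial>lborel) = 0"
    by (subst (asm) integral_complex_of_real) simp
  then have "(\<integral>y. bump z r y \<partial>lborel) / r\<^sup>2 = (\<integral>y. bump z 1 y \<partial>lborel)"
    using integrable_bump[OF r, of z] integrable_bump[of 1 z] by simp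
  moreover have "(\<integral>y. bump z 1 y \<partial>lborel) = bump_mass"
  proof -
    have "bump z 1 = (\<lambda>y. bump 0 1 (y + - z))" by (simp add: bump_def fun_eq_iff)
    then show ?thesis using lborel_integral_shift[of "bump 0 1" "- z"] by (simp only: bump_mass_def)
  qed
  ultimately show ?thesis using r by (simp add: field_simps)
qed

lemma bump_mass_pos: "bump_mass > 0"
proof -
  let ?B = "ball (0::complex) (1/2)"
  have "(\<integral>y. indicator ?B y * (1::real) \<partial>lborel) \<le> bump_mass"
    unfolding bump_mass_def
  proof (rule integral_mono)
    show "integrable lborel (\<lambda>y. indicator ?B y * (1::real))"
      using integrable_real_indicator[of ?B lborel] emeasure_bounded_finite[of ?B] by simp
    show "indicator ?B y * 1 \<le> bump 0 1 y" for y
    proof (cases "y \<in> ?B")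
      case True
      then have "(cmod y)\<^sup>2 \<le> (1/2)\<^sup>2" by (intro power_mono) auto
      then have "1 - (cmod y)\<^sup>2 \<ge> 3/4" by (simp add: power2_eq_square)
      then have "(max 0 (1 - (cmod y)\<^sup>2))\<^sup>2 \<ge> (3/4)\<^sup>2" by (intro power_mono) auto
      then show ?thesis using True by (simp add: bump_def sq_def power2_eq_square)
    qed simp
  qed (auto intro: integrable_bump)
  moreover have "(\<integral>y. indicator ?B y * (1::real) \<partial>lborel) > 0"
    using content_ball_pos[of "1/2" "0::complex"] by (simp add: measure_def)
  ultimately show ?thesis by linarith
qed

section \<open>Limits of almost holomorphic functions\<close>

lemma bump_L2: "r > 0 \<Longrightarrow> (\<lambda>y. of_real (bump z r y)) \<in> L2"
  by (rule L2_continuous[of _ "cball z r"])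
     (use C1_cont[OF C1_bump] in \<open>auto simp: bump_eq_0 intro!: continuous_intros\<close>)

lemma bump_commute: "bump z r y = bump y r z"
  by (simp add: bump_def norm_minus_commute)

lemma bump_translate: "bump (z + t) r y = bump z r (y - t)"
  by (simp add: bump_def algebra_simps)

lemma borel_measurable_sq [measurable]: "sq \<in> borel_measurable borel"
  unfolding sq_def[abs_def] by measurable

lemma bump_le_3: "r > 0 \<Longrightarrow> bump z r y \<le> 3"
  by (auto simp: bump_def sq_def max_def power_le_one)

definition mollify :: "real \<Rightarrow> (complex \<Rightarrow> complex) \<Rightarrow> complex \<Rightarrow> complex" where
  "mollify r f z = (\<integral>y. f y * of_real (bump z r y) \<partial>lborel)"

lemma borel_measurable_mollify:
  assumes f [measurable]: "f \<in> borel_measurable borel"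
  shows "mollify r f \<in> borel_measurable borel"
proof -
  have "(\<lambda>z. \<integral>y. (\<lambda>(z, y). f y * of_real (bump z r y)) (z, y) \<partial>lborel) \<in> borel_measurable borel"
    by (rule lborel.borel_measurable_lebesgue_integral)
       (simp add: bump_def split_beta')
  then show ?thesis by (simp add: mollify_def[abs_def])
qed

text \<open>Cauchy-Schwarz with weight \<open>bump z r\<close>, whose total mass is
  \<open>r\<^sup>2 * bump_mass\<close>.\<close>

lemma mollify_sq_le:
  assumes f: "f \<in> L2" and r: "r > 0"
  shows "(cmod (mollify r f z))\<^sup>2 \<le> r\<^sup>2 * bump_mass * (\<integral>y. (cmod (f y))\<^sup>2 * bump z r y \<partial>lborel)"
proof -
  let ?s = "\<lambda>y. sqrt (bump z r y)"
  have m: "?s \<in> borel_measurable borel"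
    by (intro borel_measurable_continuous_onI continuous_intros C1_cont[OF C1_bump])
  have s: "(\<lambda>y. of_real (?s y)) \<in> L2"
    unfolding L2_def using m integrable_bump[OF r, of z] by (auto intro!: borel_measurable_of_real)
  have b: "\<bar>?s y\<bar> \<le> sqrt 3" for y using bump_le_3[OF r, of z y] by simp
  have fs: "(\<lambda>y. ?s y *\<^sub>R f y) \<in> L2" by (rule L2_bounded_mult(1)[OF m b f])
  have "f y * of_real (bump z r y) = (?s y *\<^sub>R f y) * of_real (?s y)" for y
  proof -
    have "(of_real (bump z r y) :: complex) = of_real (?s y * ?s y)" by simp
    then show ?thesis by (simp only: of_real_mult) (simp add: scaleR_conv_of_real mult_ac)
  qed
  then have "cmod (mollify r f z) \<le> nrm (\<lambda>y. ?s y *\<^sub>R f y) * nrm (\<lambda>y. of_real (?s y))"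
    unfolding mollify_def using L2_Cauchy_Schwarz[OF fs s] by simp
  then have "(cmod (mollify r f z))\<^sup>2 \<le> (nrm (\<lambda>y. ?s y *\<^sub>R f y) * nrm (\<lambda>y. of_real (?s y)))\<^sup>2"
    by (intro power_mono) auto
  also have "\<dots> = (\<integral>y. (cmod (f y))\<^sup>2 * bump z r y \<partial>lborel) * (r\<^sup>2 * bump_mass)"
    by (simp add: power_mult_distrib nrm_sq integral_bump[OF r] mult.commute)
  finally show ?thesis by (simp add: mult.commute)
qed

text \<open>Young's inequality for convolution with a probability density: the weighted
  Cauchy-Schwarz bound is integrated in \<open>z\<close> by Fubini, using that the bump is symmetric
  in \<open>y\<close> and \<open>z\<close>.\<close>

lemma mollify_L2_bound:
  assumes f: "f \<in> L2" and r: "r > 0"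
  shows "(\<integral>\<^sup>+z. ennreal ((cmod (mollify r f z / of_real (r\<^sup>2 * bump_mass)))\<^sup>2) \<partial>lborel) \<le> ennreal ((nrm f)\<^sup>2)"
proof -
  let ?m = "r\<^sup>2 * bump_mass"
  have m: "?m > 0" using r bump_mass_pos by simp
  have [measurable]: "f \<in> borel_measurable borel" using f by (rule L2_meas)
  have i: "integrable lborel (\<lambda>y. (cmod (f y))\<^sup>2 * bump z r y)" for z
  proof (rule Bochner_Integration.integrable_bound[of _ "\<lambda>y. (cmod (f y))\<^sup>2 * 3"])
    show "integrable lborel (\<lambda>y. (cmod (f y))\<^sup>2 * 3)" using L2_int[OF f] by simp
    show "(\<lambda>y. (cmod (f y))\<^sup>2 * bump z r y) \<in> borel_measurable lborel" by (simp add: bump_def)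
    show "AE y in lborel. norm ((cmod (f y))\<^sup>2 * bump z r y) \<le> norm ((cmod (f y))\<^sup>2 * 3)"
      using bump_le_3[OF r] by (auto simp: abs_mult mult_left_mono)
  qed
  have pw: "(cmod (mollify r f z / of_real ?m))\<^sup>2 \<le> (\<integral>y. (cmod (f y))\<^sup>2 * bump z r y \<partial>lborel) / ?m" for z
  proof -
    have "(cmod (mollify r f z / of_real ?m))\<^sup>2 = (cmod (mollify r f z))\<^sup>2 / ?m\<^sup>2"
      by (simp only: norm_divide power_divide norm_of_real power2_abs)
    also have "\<dots> \<le> (?m * (\<integral>y. (cmod (f y))\<^sup>2 * bump z r y \<partial>lborel)) / ?m\<^sup>2"
      by (rule divide_right_mono[OF mollify_sq_le[OF f r]]) simp
    also have "\<dots> = (\<integral>y. (cmod (f y))\<^sup>2 * bump z r y \<partial>lborel) / ?m"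
      using m by (simp only: power2_eq_square[of ?m]) simp
    finally show ?thesis .
  qed
  have "(\<integral>\<^sup>+z. ennreal ((cmod (mollify r f z / of_real ?m))\<^sup>2) \<partial>lborel)
     \<le> (\<integral>\<^sup>+z. (\<integral>\<^sup>+y. ennreal ((cmod (f y))\<^sup>2 * bump z r y / ?m) \<partial>lborel) \<partial>lborel)"
  proof (rule nn_integral_mono)
    fix z
    have "ennreal ((\<integral>y. (cmod (f y))\<^sup>2 * bump z r y \<partial>lborel) / ?m) = (\<integral>\<^sup>+y. ennreal ((cmod (f y))\<^sup>2 * bump z r y / ?m) \<partial>lborel)"
      using i[of z] m by (subst nn_integral_eq_integral) auto
    then show "ennreal ((cmod (mollify r f z / of_real ?m))\<^sup>2) \<le> (\<integral>\<^sup>+y. ennreal ((cmod (f y))\<^sup>2 * bump z r y / ?m) \<partial>lborel)"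
      using ennreal_leI[OF pw[of z]] by simp
  qed
  also have "\<dots> = (\<integral>\<^sup>+y. (\<integral>\<^sup>+z. ennreal ((cmod (f y))\<^sup>2 * bump z r y / ?m) \<partial>lborel) \<partial>lborel)"
    by (rule lborel_pair.Fubini'[of "\<lambda>y z. ennreal ((cmod (f y))\<^sup>2 * bump z r y / ?m)"])
       (simp add: bump_def split_beta')
  also have "\<dots> = (\<integral>\<^sup>+y. ennreal ((cmod (f y))\<^sup>2) \<partial>lborel)"
  proof (rule nn_integral_cong)
    fix y
    have "(\<integral>\<^sup>+z. ennreal ((cmod (f y))\<^sup>2 * bump z r y / ?m) \<partial>lborel) = ennreal (\<integral>z. (cmod (f y))\<^sup>2 * bump y r z / ?m \<partial>lborel)"
    proof -
      have "integrable lborel (\<lambda>z. (cmod (f y))\<^sup>2 * bump y r z / ?m)"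
        using integrable_bump[OF r, of y] by simp
      moreover have "(cmod (f y))\<^sup>2 * bump y r z / ?m \<ge> 0" for z
        by (rule divide_nonneg_nonneg[OF mult_nonneg_nonneg less_imp_le[OF m]]) simp_all
      ultimately have "(\<integral>\<^sup>+z. ennreal ((cmod (f y))\<^sup>2 * bump y r z / ?m) \<partial>lborel) = ennreal (\<integral>z. (cmod (f y))\<^sup>2 * bump y r z / ?m \<partial>lborel)"
        by (intro nn_integral_eq_integral AE_I2)
      then show ?thesis unfolding bump_commute[of y r, abs_def] .
    qed
    also have "(\<integral>z. (cmod (f y))\<^sup>2 * bump y r z / ?m \<partial>lborel) = (cmod (f y))\<^sup>2"
    proof -
      have "(\<integral>z. (cmod (f y))\<^sup>2 * bump y r z / ?m \<partial>lborel) = (cmod (f y))\<^sup>2 * ?m / ?m"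
        by (simp add: integral_bump[OF r, of y])
      then show ?thesis using m by (metis less_irrefl nonzero_mult_div_cancel_right)
    qed
    finally show "(\<integral>\<^sup>+z. ennreal ((cmod (f y))\<^sup>2 * bump z r y / ?m) \<partial>lborel) = ennreal ((cmod (f y))\<^sup>2)" .
  qed
  also have "\<dots> = ennreal ((nrm f)\<^sup>2)"
    unfolding nrm_sq by (rule nn_integral_eq_integral) (auto intro: L2_int[OF f])
  finally show ?thesis .
qed

lemma mollify_approx:
  assumes f: "f \<in> L2" and S: "open S" "continuous_on S f" "z \<in> S"
  shows "(\<lambda>k. mollify (1 / real (Suc k)) f z / of_real ((1 / real (Suc k))\<^sup>2 * bump_mass)) \<longlonglongrightarrow> f z"
proof (rule LIMSEQ_I)
  fix e :: real assume e: "e > 0"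
  have "continuous (at z) f" using S continuous_on_eq_continuous_at by blast
  then obtain d where d: "d > 0" "\<And>y. dist y z < d \<Longrightarrow> dist (f y) (f z) < e / 2"
    using e unfolding continuous_at_eps_delta by (metis half_gt_zero)
  obtain N where N: "1 / real (Suc N) < d" using nat_approx_posE[OF d(1)] by blast
  show "\<exists>no. \<forall>k\<ge>no. norm (mollify (1 / real (Suc k)) f z / of_real ((1 / real (Suc k))\<^sup>2 * bump_mass) - f z) < e"
  proof (intro exI allI impI)
    fix k assume "k \<ge> N"
    let ?r = "1 / real (Suc k)"
    have r: "?r > 0" "?r < d"
    proof -
      have "?r \<le> 1 / real (Suc N)" using \<open>k \<ge> N\<close> by (intro divide_left_mono) auto
      with N show "?r < d" by linarith
    qed simp
    let ?m = "?r\<^sup>2 * bump_mass"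
    have m: "?m > 0" using r(1) bump_mass_pos by simp
    have i: "integrable lborel (\<lambda>y. f y * of_real (bump z ?r y))"
      by (rule L2_mult_integrable[OF f bump_L2[OF r(1)]])
    have ib: "integrable lborel (\<lambda>y. f z * complex_of_real (bump z ?r y))"
      using integrable_bump[OF r(1), of z] by simp
    have "mollify ?r f z - of_real ?m * f z = (\<integral>y. f y * of_real (bump z ?r y) - f z * of_real (bump z ?r y) \<partial>lborel)"
    proof -
      have "(\<integral>y. f z * complex_of_real (bump z ?r y) \<partial>lborel) = f z * of_real ?m"
        unfolding integral_bump[OF r(1), of z, symmetric] by simp
      then show ?thesis unfolding Bochner_Integration.integral_diff[OF i ib] mollify_def by (simp only: mult.commute)
    qed
    also have "norm \<dots> \<le> (\<integral>y. e / 2 * bump z ?r y \<partial>lborel)"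
    proof (rule Bochner_Integration.integral_norm_bound_integral)
      show "integrable lborel (\<lambda>y. f y * of_real (bump z ?r y) - f z * of_real (bump z ?r y))" using i ib by simp
      show "integrable lborel (\<lambda>y. e / 2 * bump z ?r y)" using integrable_bump[OF r(1)] by simp
      show "norm (f y * of_real (bump z ?r y) - f z * of_real (bump z ?r y)) \<le> e / 2 * bump z ?r y" for y
      proof (cases "y \<in> ball z ?r")
        case True
        then have "dist (f y) (f z) < e / 2" using d(2)[of y] r(2) by (simp add: dist_commute)
        then have "norm (f y - f z) * bump z ?r y \<le> e / 2 * bump z ?r y"
          by (intro mult_right_mono) (auto simp: dist_norm)
        then show ?thesis by (simp add: left_diff_distrib[symmetric] norm_mult del: of_nat_Suc)
      next
        case False
        then show ?thesis using bump_eq_0[OF r(1) False] by simp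
      qed
    qed
    also have "\<dots> = e / 2 * ?m" using integral_bump[OF r(1), of z] by simp
    finally have *: "norm (mollify ?r f z - of_real ?m * f z) \<le> e / 2 * ?m" .
    have "mollify ?r f z / of_real ?m - f z = (mollify ?r f z - of_real ?m * f z) / of_real ?m"
      using bump_mass_pos by (simp add: diff_divide_distrib del: of_nat_Suc)
    then have "norm (mollify ?r f z / of_real ?m - f z) = norm (mollify ?r f z - of_real ?m * f z) / ?m"
      by (simp only: norm_divide norm_of_real abs_of_pos[OF m])
    also have "\<dots> \<le> (e / 2 * ?m) / ?m" by (rule divide_right_mono[OF *]) (use m in linarith)
    also have "\<dots> = e / 2" using m by (metis less_irrefl nonzero_mult_div_cancel_right)
    finally show "norm (mollify ?r f z / of_real ?m - f z) < e" using e by linarith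
  qed
qed

text \<open>The setting for Weyl's lemma: an L2 Cauchy sequence whose weak derivative with respect
  to \<open>cnj z\<close> tends to 0. It is used for residuals of near-minimisers and for constant
  sequences of Bergman functions.\<close>

locale almost_holomorphic =
  fixes S :: "complex set" and R :: "nat \<Rightarrow> complex \<Rightarrow> complex"
  assumes open_S: "open S"
    and R_L2: "\<And>n. R n \<in> L2"
    and R_cont: "\<And>n. continuous_on S (R n)"
    and R_zero: "\<And>n z. z \<notin> S \<Longrightarrow> R n z = 0"
    and R_Cauchy: "\<And>e. e > 0 \<Longrightarrow> \<exists>N. \<forall>m\<ge>N. \<forall>n\<ge>N. nrm (\<lambda>z. R m z - R n z) < e"
    and R_weak: "\<And>u g. C1c S u g \<Longrightarrow> (\<lambda>n. \<integral>z. R n z * g z \<partial>lborel) \<longlonglongrightarrow> 0"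
begin

text \<open>Pairing with the L2 limit, available before a limit function has been
  constructed.\<close>

definition Lam :: "(complex \<Rightarrow> complex) \<Rightarrow> complex" where
  "Lam k = lim (\<lambda>n. \<integral>z. R n z * k z \<partial>lborel)"

lemma pairing_diff:
  assumes "k \<in> L2"
  shows "(\<integral>z. R m z * k z \<partial>lborel) - (\<integral>z. R n z * k z \<partial>lborel) = (\<integral>z. (R m z - R n z) * k z \<partial>lborel)"
  using L2_mult_integrable[OF R_L2 assms, of m] L2_mult_integrable[OF R_L2 assms, of n]
  by (simp add: left_diff_distrib)

lemma Lam_tendsto:
  assumes k: "k \<in> L2" shows "(\<lambda>n. \<integral>z. R n z * k z \<partial>lborel) \<longlonglongrightarrow> Lam k"
proof -
  have "Cauchy (\<lambda>n. \<integral>z. R n z * k z \<partial>lborel)"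
  proof (rule metric_CauchyI)
    fix e :: real assume e: "e > 0"
    have "e / (nrm k + 1) > 0" using e nrm_nonneg[of k] by (simp add: add_nonneg_pos)
    from R_Cauchy[OF this] obtain N where N: "\<forall>m\<ge>N. \<forall>n\<ge>N. nrm (\<lambda>z. R m z - R n z) < e / (nrm k + 1)" by blast
    show "\<exists>N. \<forall>m\<ge>N. \<forall>n\<ge>N. dist (\<integral>z. R m z * k z \<partial>lborel) (\<integral>z. R n z * k z \<partial>lborel) < e"
    proof (intro exI allI impI)
      fix m n assume mn: "m \<ge> N" "n \<ge> N"
      have "dist (\<integral>z. R m z * k z \<partial>lborel) (\<integral>z. R n z * k z \<partial>lborel) \<le> nrm (\<lambda>z. R m z - R n z) * nrm k"
        unfolding dist_norm pairing_diff[OF k] by (rule L2_Cauchy_Schwarz[OF L2_diff[OF R_L2 R_L2] k])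
      also have "\<dots> \<le> nrm (\<lambda>z. R m z - R n z) * (nrm k + 1)" by (intro mult_left_mono) auto
      also have "\<dots> < e" using N mn nrm_nonneg[of k] by (simp add: pos_less_divide_eq add_nonneg_pos)
      finally show "dist (\<integral>z. R m z * k z \<partial>lborel) (\<integral>z. R n z * k z \<partial>lborel) < e" .
    qed
  qed
  then have "convergent (\<lambda>n. \<integral>z. R n z * k z \<partial>lborel)" by (rule Cauchy_convergent)
  then show ?thesis unfolding Lam_def by (simp add: convergent_LIMSEQ_iff)
qed

lemma Lam_add: "k \<in> L2 \<Longrightarrow> h \<in> L2 \<Longrightarrow> Lam (\<lambda>z. k z + h z) = Lam k + Lam h"
proof -
  assume k: "k \<in> L2" and h: "h \<in> L2"
  have "(\<integral>z. R n z * (k z + h z) \<partial>lborel) = (\<integral>z. R n z * k z \<partial>lborel) + (\<integral>z. R n z * h z \<partial>lborel)" for n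
    using L2_mult_integrable[OF R_L2 k] L2_mult_integrable[OF R_L2 h] by (simp add: distrib_left)
  then show ?thesis
    using LIMSEQ_unique[OF Lam_tendsto[OF L2_add[OF k h]]] tendsto_add[OF Lam_tendsto[OF k] Lam_tendsto[OF h]] by simp
qed

lemma Lam_cmult: "k \<in> L2 \<Longrightarrow> Lam (\<lambda>z. a * k z) = a * Lam k"
proof -
  assume k: "k \<in> L2"
  have "(\<integral>z. R n z * (a * k z) \<partial>lborel) = a * (\<integral>z. R n z * k z \<partial>lborel)" for n
    by (simp add: mult.left_commute)
  then show ?thesis
    using LIMSEQ_unique[OF Lam_tendsto[OF L2_cmult[OF k]]] tendsto_mult_left[OF Lam_tendsto[OF k]] by simp
qed

lemma Lam_grad: "C1c S u g \<Longrightarrow> Lam g = 0"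
  using LIMSEQ_unique[OF Lam_tendsto[OF C1c_L2] R_weak] by blast

lemma Lam_bound: obtains B where "B > 0" "\<And>k. k \<in> L2 \<Longrightarrow> cmod (Lam k) \<le> B * nrm k"
proof -
  obtain N where N: "\<forall>m\<ge>N. \<forall>n\<ge>N. nrm (\<lambda>z. R m z - R n z) < 1" using R_Cauchy[of 1] by auto
  let ?B = "nrm (R N) + 1"
  have "cmod (Lam k) \<le> ?B * nrm k" if k: "k \<in> L2" for k
  proof (rule Lim_bounded[OF tendsto_norm[OF Lam_tendsto[OF k]]])
    show "\<forall>n\<ge>N. cmod (\<integral>z. R n z * k z \<partial>lborel) \<le> ?B * nrm k"
    proof (intro allI impI)
      fix n assume "n \<ge> N"
      have "nrm (\<lambda>z. R N z + (R n z - R N z)) \<le> nrm (R N) + nrm (\<lambda>z. R n z - R N z)"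
        by (rule nrm_triangle[OF R_L2 L2_diff[OF R_L2 R_L2]])
      then have "nrm (R n) \<le> ?B" using N \<open>n \<ge> N\<close> by force
      then have "nrm (R n) * nrm k \<le> ?B * nrm k" by (intro mult_right_mono) auto
      then show "cmod (\<integral>z. R n z * k z \<partial>lborel) \<le> ?B * nrm k"
        using L2_Cauchy_Schwarz[OF R_L2 k, of n] by linarith
    qed
  qed
  then show ?thesis by (intro that[of ?B]) (auto simp: add_nonneg_pos)
qed

lemma mollify_tendsto: "r > 0 \<Longrightarrow> (\<lambda>n. mollify r (R n) z) \<longlonglongrightarrow> Lam (\<lambda>y. of_real (bump z r y))"
  unfolding mollify_def by (rule Lam_tendsto[OF bump_L2])

text \<open>The core of Weyl's lemma: scaled bumps of different radii differ by derivatives of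
  functions with compact support in \<open>S\<close>, which \<open>Lam\<close> annihilates.\<close>

lemma Lam_bump_radius:
  assumes "r > 0" "s > 0" "cball z r \<subseteq> S" "cball z s \<subseteq> S"
  shows "Lam (\<lambda>y. of_real (bump z r y)) / of_real (r\<^sup>2) = Lam (\<lambda>y. of_real (bump z s y)) / of_real (s\<^sup>2)"
proof -
  obtain u1 g1 u2 g2 where g: "C1c (cball z (max r s)) u1 g1" "C1c (cball z (max r s)) u2 g2"
    "\<And>y. g1 y - \<i> * g2 y = of_real (2 * (bump z r y / r\<^sup>2 - bump z s y / s\<^sup>2))"
    using bump_diff_is_derivative[OF assms(1,2), of z] by metis
  have S: "cball z (max r s) \<subseteq> S" using assms by (simp add: max_def)
  have g': "C1c S u1 g1" "C1c S u2 g2" using C1c_mono[OF g(1) S] C1c_mono[OF g(2) S] by auto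
  let ?b = "\<lambda>r y. complex_of_real (bump z r y)"
  have eq: "(1 / of_real (r\<^sup>2)) * ?b r y = (1 / of_real (s\<^sup>2)) * ?b s y + (1/2 * g1 y + (- \<i> / 2) * g2 y)" for y
  proof -
    have h: "1/2 * g1 y + (- \<i> / 2) * g2 y = (g1 y - \<i> * g2 y) / 2" by (simp add: diff_divide_distrib)
    show ?thesis unfolding h g(3) by (simp add: diff_divide_distrib)
  qed
  have L: "?b r \<in> L2" "?b s \<in> L2" "g1 \<in> L2" "g2 \<in> L2" using bump_L2 assms C1c_L2 g' by auto
  have "(1 / of_real (r\<^sup>2)) * Lam (?b r) = Lam (\<lambda>y. (1 / of_real (r\<^sup>2)) * ?b r y)"
    by (rule Lam_cmult[OF L(1), symmetric])
  moreover have "(\<lambda>y. (1 / of_real (r\<^sup>2)) * ?b r y) = (\<lambda>y. (1 / of_real (s\<^sup>2)) * ?b s y + (1/2 * g1 y + (- \<i> / 2) * g2 y))"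
    by (rule ext) (rule eq)
  moreover have "Lam (\<lambda>y. (1 / of_real (s\<^sup>2)) * ?b s y + (1/2 * g1 y + (- \<i> / 2) * g2 y))
      = Lam (\<lambda>y. (1 / of_real (s\<^sup>2)) * ?b s y) + Lam (\<lambda>y. 1/2 * g1 y + (- \<i> / 2) * g2 y)"
    by (rule Lam_add[OF L2_cmult[OF L(2)] L2_add[OF L2_cmult[OF L(3)] L2_cmult[OF L(4)]]])
  moreover have "Lam (\<lambda>y. 1/2 * g1 y + (- \<i> / 2) * g2 y) = Lam (\<lambda>y. 1/2 * g1 y) + Lam (\<lambda>y. (- \<i> / 2) * g2 y)"
    by (rule Lam_add[OF L2_cmult[OF L(3)] L2_cmult[OF L(4)]])
  moreover have "Lam (\<lambda>y. 1/2 * g1 y) = 0" "Lam (\<lambda>y. (- \<i> / 2) * g2 y) = 0"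
    using Lam_cmult[OF L(3), of "1/2"] Lam_cmult[OF L(4), of "- \<i> / 2"] Lam_grad[OF g'(1)] Lam_grad[OF g'(2)] by simp_all
  moreover have "Lam (\<lambda>y. (1 / of_real (s\<^sup>2)) * ?b s y) = (1 / of_real (s\<^sup>2)) * Lam (?b s)"
    by (rule Lam_cmult[OF L(2)])
  ultimately have "(1 / of_real (r\<^sup>2)) * Lam (?b r) = (1 / of_real (s\<^sup>2)) * Lam (?b s)" by simp
  then show ?thesis by simp
qed

text \<open>Moving the centre by t changes the bump by -(cnj t * g + t * cnj g) / 2 up to o(|t|) in
  L2, where g is \<open>bump_grad z r\<close>. \<open>Lam\<close> annihilates g, so the antilinear
  part drops out and a complex derivative remains.\<close>

lemma Lam_bump_differentiable:
  assumes r: "r > 0" and S: "cball z r \<subseteq> S"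
  shows "\<exists>D. ((\<lambda>x. Lam (\<lambda>y. of_real (bump x r y))) has_field_derivative D) (at z)"
proof -
  let ?g = "bump_grad z r"
  let ?b = "\<lambda>x y. complex_of_real (bump x r y)"
  have c: "C1c S (bump z r) ?g" by (rule bump_C1c[OF r S])
  have gL: "?g \<in> L2" by (rule C1c_L2[OF c])
  obtain B where B: "B > 0" "\<And>k. k \<in> L2 \<Longrightarrow> cmod (Lam k) \<le> B * nrm k" using Lam_bound by blast
  \<comment> \<open>For shifts shorter than 1 the moved bumps live in \<open>?C\<close>, and the
    segments used in the Taylor estimate stay in \<open>?C2\<close>, where the gradient is uniformly
    continuous.\<close>
  let ?C = "cball z (r + 1)" and ?C2 = "cball z (r + 2)"
  let ?I = "\<lambda>y. indicator ?C y *\<^sub>R (1 :: complex)"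
  have IL: "?I \<in> L2"
  proof (rule L2_dominated)
    show "integrable lborel (indicator ?C :: complex \<Rightarrow> real)"
      using integrable_real_indicator[of ?C lborel] emeasure_bounded_finite[of ?C] by simp
  qed (auto simp: indicator_def)
  define M where "M = nrm ?I + 1"
  have M: "M > 0" "nrm ?I \<le> M" using nrm_nonneg[of ?I] by (auto simp: M_def intro: add_nonneg_pos)
  define D where "D = - (1/2) * Lam (\<lambda>y. cnj (?g y))"
  have uc: "uniformly_continuous_on ?C2 ?g"
    by (rule compact_uniformly_continuous[OF continuous_on_subset[OF C1_cont_grad[OF C1_bump]]]) auto
  have "((\<lambda>x. Lam (?b x)) has_derivative (\<lambda>h. D * h)) (at z within UNIV)"
    unfolding has_derivative_within_alt
  proof (intro conjI allI impI)
    show "bounded_linear (\<lambda>h. D * h)" by (rule bounded_linear_mult_right)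
    fix e :: real assume "e > 0"
    define e' where "e' = e / (B * M)"
    have e': "e' > 0" using \<open>e > 0\<close> B M by (simp add: e'_def)
    obtain d where d: "d > 0" "\<And>x y. x \<in> ?C2 \<Longrightarrow> y \<in> ?C2 \<Longrightarrow> dist x y < d \<Longrightarrow> dist (?g x) (?g y) < e'"
      using uc e' unfolding uniformly_continuous_on_def by metis
    show "\<exists>d>0. \<forall>x\<in>UNIV. norm (x - z) < d \<longrightarrow> norm (Lam (?b x) - Lam (?b z) - D * (x - z)) \<le> e * norm (x - z)"
    proof (intro exI[of _ "min d 1"] conjI ballI impI)
      show "min d 1 > 0" using d by simp
      fix x assume x: "norm (x - z) < min d 1"
      define t where "t = x - z"
      define q where "q = (\<lambda>y. ?b x y - ?b z y + (1/2) * (cnj t * ?g y + t * cnj (?g y)))"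
      have xt: "x = z + t" by (simp add: t_def)
      have re: "(1/2) * (cnj t * w + t * cnj w) = of_real (t \<bullet> w)" for w
        by (simp add: complex_eq_iff inner_complex_def)
      have qL: "q \<in> L2"
        unfolding q_def by (intro L2_add L2_diff bump_L2[OF r] L2_cmult L2_cnj gL)
      have qb: "cmod (q y) \<le> cmod (of_real (e' * norm t) * ?I y)" for y
      proof (cases "y \<in> ?C")
        case True
        have seg: "cball y (norm t) \<subseteq> ?C2"
        proof
          fix a assume "a \<in> cball y (norm t)"
          then show "a \<in> ?C2" using True x dist_triangle[of z a y] by (simp add: t_def)
        qed
        have "norm (bump z r (y - t) - bump z r y - (\<lambda>h. h \<bullet> ?g y) ((y - t) - y)) \<le> norm ((y - t) - y) * e'"
        proof (rule differentiable_bound_linearization[where S="cball y (norm t)" and f'="\<lambda>x h. h \<bullet> ?g x"])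
          show "y + s *\<^sub>R (y - t - y) \<in> cball y (norm t)" if "s \<in> {0..1}" for s
            using that by (auto simp: dist_norm intro: mult_left_le_one_le)
          show "(bump z r has_derivative (\<lambda>h. h \<bullet> ?g a)) (at a within cball y (norm t))" for a
            using C1_GDERIV[OF C1_bump[of z r], of a] by (simp add: gderiv_def has_derivative_at_withinI)
          show "onorm ((\<lambda>h. h \<bullet> ?g a) - (\<lambda>h. h \<bullet> ?g y)) \<le> e'" if "a \<in> cball y (norm t)" for a
          proof (rule onorm_le)
            fix h
            have "dist (?g a) (?g y) < e'"
            proof (rule d(2))
              show "a \<in> ?C2" using that seg by auto
              show "y \<in> ?C2" using True by auto
              show "dist a y < d" using that x by (simp add: t_def dist_commute)
            qed
            then have "\<bar>h \<bullet> (?g a - ?g y)\<bar> \<le> norm h * e'"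
              using Cauchy_Schwarz_ineq2[of h "?g a - ?g y"] mult_left_mono[of "norm (?g a - ?g y)" e' "norm h"]
              by (simp add: dist_norm)
            then show "norm (((\<lambda>h. h \<bullet> ?g a) - (\<lambda>h. h \<bullet> ?g y)) h) \<le> e' * norm h"
              by (simp add: inner_diff_right mult.commute)
          qed
        qed auto
        then have "\<bar>bump x r y - bump z r y + t \<bullet> ?g y\<bar> \<le> norm t * e'"
          by (simp add: xt bump_translate)
        moreover have "q y = of_real (bump x r y - bump z r y + t \<bullet> ?g y)"
          unfolding q_def re by simp
        ultimately show ?thesis using True e' by (simp add: norm_mult mult.commute del: of_real_add of_real_diff)
      next
        case False
        then have "y \<notin> ball z r" by auto
        have "y \<notin> ball x r"
        proof
          assume "y \<in> ball x r"
          then have "dist z y \<le> dist z x + r" using dist_triangle[of z y x] by simp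
          then show False using False x by (simp add: dist_norm norm_minus_commute)
        qed
        have "?g y = 0"
          by (rule C1_grad_eq_0[OF C1_bump, of "- cball z r"]) (use False in \<open>auto simp: bump_eq_0[OF r]\<close>)
        then show ?thesis using \<open>y \<notin> ball z r\<close> \<open>y \<notin> ball x r\<close> by (simp add: q_def bump_eq_0[OF r])
      qed
      have "nrm q \<le> nrm (\<lambda>y. of_real (e' * norm t) * ?I y)"
        by (rule L2_mono(2)[OF L2_meas[OF qL] L2_cmult[OF IL] qb])
      also have "\<dots> = e' * norm t * nrm ?I" using e' by (simp only: nrm_cmult norm_of_real) simp
      also have "\<dots> \<le> e' * norm t * M" using M e' by (intro mult_left_mono) auto
      finally have "nrm q \<le> e' * norm t * M" .
      then have lq: "cmod (Lam q) \<le> B * (e' * norm t * M)"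
        by (rule order_trans[OF B(2)[OF qL] mult_left_mono[OF _ less_imp_le[OF B(1)]]])
      have b_eq: "?b x = (\<lambda>y. (?b z y + q y) + ((- cnj t / 2) * ?g y + (- t / 2) * cnj (?g y)))"
        by (rule ext) (simp add: q_def algebra_simps)
      have eq: "Lam (?b x) = Lam (?b z) + Lam q + (- cnj t / 2 * Lam ?g + - t / 2 * Lam (\<lambda>y. cnj (?g y)))"
      proof -
        have "Lam (\<lambda>y. (?b z y + q y) + ((- cnj t / 2) * ?g y + (- t / 2) * cnj (?g y)))
            = Lam (\<lambda>y. ?b z y + q y) + Lam (\<lambda>y. (- cnj t / 2) * ?g y + (- t / 2) * cnj (?g y))"
          by (rule Lam_add[OF L2_add[OF bump_L2[OF r] qL] L2_add[OF L2_cmult[OF gL] L2_cmult[OF L2_cnj[OF gL]]]])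
        also have "Lam (\<lambda>y. ?b z y + q y) = Lam (?b z) + Lam q" by (rule Lam_add[OF bump_L2[OF r] qL])
        also have "Lam (\<lambda>y. (- cnj t / 2) * ?g y + (- t / 2) * cnj (?g y)) = Lam (\<lambda>y. (- cnj t / 2) * ?g y) + Lam (\<lambda>y. (- t / 2) * cnj (?g y))"
          by (rule Lam_add[OF L2_cmult[OF gL] L2_cmult[OF L2_cnj[OF gL]]])
        also have "Lam (\<lambda>y. (- cnj t / 2) * ?g y) = - cnj t / 2 * Lam ?g" by (rule Lam_cmult[OF gL])
        also have "Lam (\<lambda>y. (- t / 2) * cnj (?g y)) = - t / 2 * Lam (\<lambda>y. cnj (?g y))" by (rule Lam_cmult[OF L2_cnj[OF gL]])
        finally show ?thesis unfolding b_eq .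
      qed
      have "Lam (?b x) - Lam (?b z) - D * (x - z) = Lam q"
        unfolding eq Lam_grad[OF c] D_def t_def[symmetric] by simp
      moreover have "B * (e' * norm t * M) = e * norm (x - z)" using B M by (simp add: e'_def t_def)
      ultimately show "norm (Lam (?b x) - Lam (?b z) - D * (x - z)) \<le> e * norm (x - z)"
        using lq by simp
    qed
  qed
  then have "((\<lambda>x. Lam (?b x)) has_field_derivative D) (at z)" by (simp add: has_field_derivative_def)
  then show ?thesis by blast
qed

text \<open>On \<open>S\<close> any admissible radius gives the same value of \<open>limit\<close>,
  by \<open>Lam_bump_radius\<close>.\<close>

definition good_radius :: "complex \<Rightarrow> real" where
  "good_radius z = (SOME r. r > 0 \<and> cball z r \<subseteq> S)"

definition limit :: "complex \<Rightarrow> complex" where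
  "limit z = Lam (\<lambda>y. of_real (bump z (good_radius z) y)) / of_real ((good_radius z)\<^sup>2 * bump_mass)"

lemma limit_eq:
  assumes "r > 0" "cball z r \<subseteq> S"
  shows "limit z = Lam (\<lambda>y. of_real (bump z r y)) / of_real (r\<^sup>2 * bump_mass)"
proof -
  have "good_radius z > 0 \<and> cball z (good_radius z) \<subseteq> S"
    unfolding good_radius_def by (rule someI[of _ r]) (use assms in auto)
  from Lam_bump_radius[OF assms(1) _ assms(2), of "good_radius z"] this
  have "Lam (\<lambda>y. of_real (bump z (good_radius z) y)) / of_real ((good_radius z)\<^sup>2) = Lam (\<lambda>y. of_real (bump z r y)) / of_real (r\<^sup>2)"
    by simp
  then show ?thesis unfolding limit_def by (simp only: of_real_mult divide_divide_eq_left[symmetric])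
qed

lemma limit_holomorphic: "limit holomorphic_on S"
proof (rule holomorphic_onI)
  fix z assume "z \<in> S"
  then obtain e where e: "e > 0" "cball z e \<subseteq> S" using open_S open_contains_cball by blast
  \<comment> \<open>Half the radius serves all centres within \<open>e / 2\<close> of
    \<open>z\<close>, so near \<open>z\<close> the function \<open>limit\<close> is a fixed multiple
    of \<open>Lam\<close> on bumps of one radius.\<close>
  let ?r = "e / 2"
  have r: "?r > 0" using e by simp
  have sub: "cball x ?r \<subseteq> S" if "x \<in> ball z ?r" for x
  proof
    fix y assume "y \<in> cball x ?r"
    then have "dist z y \<le> e" using that dist_triangle[of z y x] by simp
    then show "y \<in> S" using e by auto
  qed
  obtain D where "((\<lambda>x. Lam (\<lambda>y. of_real (bump x ?r y))) has_field_derivative D) (at z)"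
    using Lam_bump_differentiable[OF r sub[of z]] r by auto
  then have "((\<lambda>x. Lam (\<lambda>y. of_real (bump x ?r y)) / of_real (?r\<^sup>2 * bump_mass)) has_field_derivative D / of_real (?r\<^sup>2 * bump_mass)) (at z)"
    by (rule DERIV_cdivide)
  then have "(limit has_field_derivative D / of_real (?r\<^sup>2 * bump_mass)) (at z)"
    by (rule has_field_derivative_transform_within_open[of _ _ _ "ball z ?r"])
       (use r limit_eq[OF r sub] in auto)
  then show "limit field_differentiable at z within S"
    using field_differentiable_at_within field_differentiable_def by blast
qed

text \<open>Fatou's lemma twice. At a fixed radius the mollified \<open>R j\<close> converge
  pointwise to \<open>?L k\<close>, so the mollified distance is at most \<open>e\<close>; as the
  radius shrinks, the mollified difference converges on \<open>S\<close> to
  \<open>R n - limit\<close>.\<close>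

lemma limit_close:
  assumes N: "\<And>m. m \<ge> N \<Longrightarrow> nrm (\<lambda>z. R n z - R m z) \<le> e" and e: "e \<ge> 0"
  shows "(\<lambda>z. R n z - indicator S z *\<^sub>R limit z) \<in> L2" "nrm (\<lambda>z. R n z - indicator S z *\<^sub>R limit z) \<le> e"
proof -
  let ?r = "\<lambda>k. 1 / real (Suc k)"
  let ?m = "\<lambda>k. ?r k ^ 2 * bump_mass"
  let ?L = "\<lambda>k z. Lam (\<lambda>y. of_real (bump z (?r k) y))"
  define H where "H = (\<lambda>k z. ennreal ((cmod ((mollify (?r k) (R n) z - ?L k z) / of_real (?m k)))\<^sup>2))"
  have r: "?r k > 0" for k by simp
  have m: "?m k > 0" for k using bump_mass_pos by simp
  have meas: "mollify (?r k) (R j) \<in> borel_measurable borel" for k j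
    by (rule borel_measurable_mollify[OF L2_meas[OF R_L2]])
  have measL: "?L k \<in> borel_measurable borel" for k
    by (rule borel_measurable_LIMSEQ_metric[where f="\<lambda>j. mollify (?r k) (R j)"])
       (use meas mollify_tendsto[OF r] in auto)
  have Hmeas: "H k \<in> borel_measurable lborel" for k
    unfolding H_def using meas[of k n] measL[of k] by measurable
  have Hint: "(\<integral>\<^sup>+z. H k z \<partial>lborel) \<le> ennreal (e\<^sup>2)" for k
  proof -
    define h where "h = (\<lambda>j z. ennreal ((cmod ((mollify (?r k) (R n) z - mollify (?r k) (R j) z) / of_real (?m k)))\<^sup>2))"
    have hmeas: "h j \<in> borel_measurable lborel" for j
      unfolding h_def using meas[of k n] meas[of k j] by measurable
    have "(\<lambda>j. h j z) \<longlonglongrightarrow> H k z" for z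
      unfolding h_def H_def
      by (intro tendsto_ennrealI tendsto_power tendsto_norm tendsto_divide tendsto_diff tendsto_const mollify_tendsto r)
         (use m[of k] in \<open>simp only: of_real_eq_0_iff; linarith\<close>)
    then have "H k z = liminf (\<lambda>j. h j z)" for z by (rule lim_imp_Liminf[OF trivial_limit_sequentially, symmetric])
    then have "(\<integral>\<^sup>+z. H k z \<partial>lborel) \<le> liminf (\<lambda>j. \<integral>\<^sup>+z. h j z \<partial>lborel)"
      using nn_integral_liminf[of h lborel] hmeas by simp
    also have "\<dots> \<le> ennreal (e\<^sup>2)"
    proof -
      have "(\<integral>\<^sup>+z. h j z \<partial>lborel) \<le> ennreal (e\<^sup>2)" if "j \<ge> N" for j
      proof -
        have "mollify (?r k) (R n) z - mollify (?r k) (R j) z = mollify (?r k) (\<lambda>y. R n y - R j y) z" for z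
          unfolding mollify_def by (rule pairing_diff[OF bump_L2[OF r]])
        then have "(\<integral>\<^sup>+z. h j z \<partial>lborel) \<le> ennreal ((nrm (\<lambda>y. R n y - R j y))\<^sup>2)"
          unfolding h_def using mollify_L2_bound[OF L2_diff[OF R_L2 R_L2] r, of k n j] by simp
        also have "\<dots> \<le> ennreal (e\<^sup>2)" using N[OF that] by (intro ennreal_leI power_mono) auto
        finally show ?thesis .
      qed
      then have ev: "\<forall>\<^sub>F j in sequentially. (\<integral>\<^sup>+z. h j z \<partial>lborel) \<le> ennreal (e\<^sup>2)"
        by (rule eventually_sequentiallyI)
      then have "liminf (\<lambda>j. \<integral>\<^sup>+z. h j z \<partial>lborel) \<le> liminf (\<lambda>j. ennreal (e\<^sup>2))"
        by (rule Liminf_mono)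
      then show ?thesis by (simp add: Liminf_const)
    qed
    finally show ?thesis .
  qed
  let ?G = "\<lambda>z. R n z - indicator S z *\<^sub>R limit z"
  have Gmeas: "?G \<in> borel_measurable borel"
    using borel_measurable_continuous_on_indicator[OF _ holomorphic_on_imp_continuous_on[OF limit_holomorphic]] open_S L2_meas[OF R_L2, of n] by auto
  have "ennreal ((cmod (?G z))\<^sup>2) \<le> liminf (\<lambda>k. H k z)" for z
  proof (cases "z \<in> S")
    case True
    then obtain d where d: "d > 0" "cball z d \<subseteq> S" using open_S open_contains_cball by blast
    obtain K where K: "?r K < d" using nat_approx_posE[OF d(1)] by blast
    \<comment> \<open>Once the disc of radius \<open>?r k\<close> fits into \<open>S\<close>, the
      quotient is equal to \<open>limit z\<close>, not merely close to it.\<close>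
    have lim: "?L k z / of_real (?m k) = limit z" if "k \<ge> K" for k
    proof (rule limit_eq[symmetric, OF r])
      have "?r k \<le> ?r K" using that by (intro divide_left_mono) auto
      then show "cball z (?r k) \<subseteq> S" using K d(2) by (meson less_eq_real_def order_trans subset_cball)
    qed
    have "(\<lambda>k. mollify (?r k) (R n) z / of_real (?m k) - limit z) \<longlonglongrightarrow> R n z - limit z"
      by (intro tendsto_diff tendsto_const mollify_approx[OF R_L2 open_S R_cont True])
    then have "(\<lambda>k. (mollify (?r k) (R n) z - ?L k z) / of_real (?m k)) \<longlonglongrightarrow> R n z - limit z"
    proof (rule Lim_transform_eventually)
      show "\<forall>\<^sub>F k in sequentially. mollify (?r k) (R n) z / of_real (?m k) - limit z = (mollify (?r k) (R n) z - ?L k z) / of_real (?m k)"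
        using lim by (intro eventually_sequentiallyI[of K]) (simp only: diff_divide_distrib)
    qed
    then have "(\<lambda>k. H k z) \<longlonglongrightarrow> ennreal ((cmod (R n z - limit z))\<^sup>2)"
      unfolding H_def by (intro tendsto_ennrealI tendsto_power tendsto_norm)
    then have "liminf (\<lambda>k. H k z) = ennreal ((cmod (R n z - limit z))\<^sup>2)"
      by (rule lim_imp_Liminf[OF trivial_limit_sequentially])
    then show ?thesis using True by simp
  next
    case False
    then show ?thesis by (simp add: R_zero)
  qed
  then have "(\<integral>\<^sup>+z. ennreal ((cmod (?G z))\<^sup>2) \<partial>lborel) \<le> (\<integral>\<^sup>+z. liminf (\<lambda>k. H k z) \<partial>lborel)"
    by (rule nn_integral_mono)
  also have "\<dots> \<le> liminf (\<lambda>k. \<integral>\<^sup>+z. H k z \<partial>lborel)" by (rule nn_integral_liminf[OF Hmeas])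
  also have "\<dots> \<le> liminf (\<lambda>k. ennreal (e\<^sup>2))" using Hint by (intro Liminf_mono always_eventually) auto
  also have "\<dots> = ennreal (e\<^sup>2)" by (simp add: Liminf_const)
  finally have b: "(\<integral>\<^sup>+z. ennreal ((cmod (?G z))\<^sup>2) \<partial>lborel) \<le> ennreal (e\<^sup>2)" .
  have m2: "(\<lambda>z. (cmod (?G z))\<^sup>2) \<in> borel_measurable lborel" using Gmeas by measurable
  have i: "integrable lborel (\<lambda>z. (cmod (?G z))\<^sup>2)"
    by (rule integrableI_bounded[OF m2]) (use b in \<open>auto simp: top_unique less_top[symmetric]\<close>)
  then show GL: "?G \<in> L2" using Gmeas by (simp add: L2_def)
  have "ennreal ((nrm ?G)\<^sup>2) \<le> ennreal (e\<^sup>2)"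
    using b unfolding nrm_sq by (subst nn_integral_eq_integral[symmetric, OF i]) auto
  then have "(nrm ?G)\<^sup>2 \<le> e\<^sup>2" using e by (simp add: ennreal_le_iff)
  then show "nrm ?G \<le> e" using e by (rule power2_le_imp_le)
qed

theorem limit_bergman: "limit \<in> bergman_space S"
proof -
  obtain N where N: "\<forall>m\<ge>N. \<forall>n\<ge>N. nrm (\<lambda>z. R m z - R n z) < 1" using R_Cauchy[of 1] by auto
  have "(\<lambda>z. R N z - indicator S z *\<^sub>R limit z) \<in> L2"
    by (rule limit_close(1)[of N N 1]) (use N in \<open>auto intro: less_imp_le\<close>)
  from L2_diff[OF R_L2[of N] this] show ?thesis
    unfolding bergman_space_iff[OF open_S] using limit_holomorphic by simp
qed

theorem limit_tendsto: "(\<lambda>n. nrm (\<lambda>z. R n z - indicator S z *\<^sub>R limit z)) \<longlonglongrightarrow> 0"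
proof (rule LIMSEQ_I)
  fix e :: real assume "e > 0"
  then obtain N where N: "\<forall>m\<ge>N. \<forall>n\<ge>N. nrm (\<lambda>z. R m z - R n z) < e / 2" using R_Cauchy[of "e / 2"] by auto
  have "nrm (\<lambda>z. R n z - indicator S z *\<^sub>R limit z) \<le> e / 2" if "n \<ge> N" for n
    by (rule limit_close(2)[of N n]) (use N that \<open>e > 0\<close> in \<open>auto intro: less_imp_le\<close>)
  then show "\<exists>N. \<forall>n\<ge>N. norm (nrm (\<lambda>z. R n z - indicator S z *\<^sub>R limit z) - 0) < e"
    using \<open>e > 0\<close> by (intro exI[of _ N]) force
qed

end

section \<open>Approximate Bergman projection of a bump\<close>

definition excess :: "real \<Rightarrow> real" where
  "excess y = (if y \<le> 0 then 0 else y\<^sup>2 / (1 + y))"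

definition excess' :: "real \<Rightarrow> real" where
  "excess' y = (if y \<le> 0 then 0 else (2 * y * (1 + y) - y\<^sup>2) / (1 + y)\<^sup>2)"

lemma DERIV_excess: "DERIV excess y :> excess' y"
  unfolding excess_def[abs_def] excess'_def
  by (rule DERIV_glue_zero) (auto intro!: derivative_eq_intros simp: power2_eq_square)

lemma continuous_excess': "continuous_on UNIV excess'"
proof -
  have "continuous_on ({..0} \<union> {0..}) excess'"
    unfolding excess'_def[abs_def] by (rule continuous_on_cases) (auto intro!: continuous_intros)
  moreover have "{..0} \<union> {0..} = (UNIV :: real set)" by auto
  ultimately show ?thesis by simp
qed

lemma excess'_bounds: "0 \<le> excess' y" "excess' y \<le> 1"
proof -
  show "0 \<le> excess' y" by (simp add: excess'_def power2_eq_square)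
  have "2 * y * (1 + y) - y\<^sup>2 \<le> (1 + y)\<^sup>2" by (simp add: power2_eq_square algebra_simps)
  then show "excess' y \<le> 1" by (simp add: excess'_def divide_le_eq_1)
qed

lemma excess_bounds: "y > 0 \<Longrightarrow> y - 1 \<le> excess y" "y > 0 \<Longrightarrow> excess y \<le> y"
  by (auto simp: excess_def power2_eq_square field_simps)

lemma excess_nonpos: "y \<le> 0 \<Longrightarrow> excess y = 0" "y \<le> 0 \<Longrightarrow> excess' y = 0"
  by (auto simp: excess_def excess'_def)

text \<open>\<open>excess\<close> is a C1 substitute for the positive part, with slope in [0, 1] and
  at most 1 below it. For m >= 0 the truncation is therefore the identity on [-m, m], 1-Lipschitz,
  and bounded by m + 1.\<close>

definition trunc :: "real \<Rightarrow> real \<Rightarrow> real" where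
  "trunc m x = x - excess (x - m) + excess (- x - m)"

definition trunc' :: "real \<Rightarrow> real \<Rightarrow> real" where
  "trunc' m x = 1 - excess' (x - m) - excess' (- x - m)"

lemma DERIV_trunc: "DERIV (trunc m) x :> trunc' m x"
proof -
  have "DERIV (\<lambda>x. excess (x - m)) x :> excess' (x - m) * 1"
    by (rule DERIV_chain2[OF DERIV_excess]) (auto intro!: derivative_eq_intros)
  moreover have "DERIV (\<lambda>x. excess (- x - m)) x :> excess' (- x - m) * (- 1)"
    by (rule DERIV_chain2[OF DERIV_excess]) (auto intro!: derivative_eq_intros)
  ultimately have "DERIV (\<lambda>x. x - excess (x - m) + excess (- x - m)) x :> 1 - excess' (x - m) * 1 + excess' (- x - m) * (- 1)"
    by (intro DERIV_add DERIV_diff DERIV_ident)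
  then show ?thesis by (simp add: trunc_def[abs_def] trunc'_def)
qed

lemma continuous_trunc': "continuous_on UNIV (trunc' m)"
  unfolding trunc'_def[abs_def]
  by (auto intro!: continuous_intros continuous_on_compose2[OF continuous_excess'])

lemma trunc_id: "\<bar>x\<bar> \<le> m \<Longrightarrow> trunc m x = x"
  by (simp add: trunc_def excess_nonpos)

lemma trunc'_bounds: "m \<ge> 0 \<Longrightarrow> \<bar>trunc' m x\<bar> \<le> 1"
  using excess'_bounds[of "x - m"] excess'_bounds[of "- x - m"]
  by (cases "x \<ge> 0") (auto simp: trunc'_def excess_nonpos)

lemma trunc_bound: "m \<ge> 0 \<Longrightarrow> \<bar>trunc m x\<bar> \<le> m + 1"
proof -
  assume m: "m \<ge> 0"
  consider "\<bar>x\<bar> \<le> m" | "x > m" | "- x > m" by linarith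
  then show ?thesis
  proof cases
    case 1 then show ?thesis by (simp add: trunc_id)
  next
    case 2
    then show ?thesis using excess_bounds[of "x - m"] m by (simp add: trunc_def excess_nonpos)
  next
    case 3
    then show ?thesis using excess_bounds[of "- x - m"] m by (simp add: trunc_def excess_nonpos)
  qed
qed

text \<open>The datum: minimising the norm of \<open>g - load e z r\<close> over gradients
  \<open>g\<close> corresponds to the Poisson equation whose right side is twice the derivative of
  the bump in direction \<open>e\<close>.\<close>

definition load :: "complex \<Rightarrow> complex \<Rightarrow> real \<Rightarrow> complex \<Rightarrow> complex" where
  "load e z r y = (2 * bump z r y) *\<^sub>R e"

lemma load_L2: "r > 0 \<Longrightarrow> load e z r \<in> L2"
  unfolding load_def[abs_def]
  using L2_cmult[OF bump_L2, of r "2 * e" z] by (simp add: scaleR_conv_of_real mult_ac)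

text \<open>Because \<open>pot\<close> solves the Poisson equation with this datum, completing the
  square turns the functional into the Dirichlet energy of P - v up to a constant. Under a single
  integral the difference of squares has compact support.\<close>

lemma energy_expand:
  assumes v: "C1c S v g" and e: "e = 1 \<or> e = \<i>" and r: "r > 0"
  shows "(nrm (\<lambda>y. g y - load e z r y))\<^sup>2 - (nrm (load e z r))\<^sup>2
      = (\<integral>y. (cmod (pot_grad e z r y - g y))\<^sup>2 - (cmod (pot_grad e z r y))\<^sup>2 \<partial>lborel)"
    "integrable lborel (\<lambda>y. (cmod (pot_grad e z r y - g y))\<^sup>2 - (cmod (pot_grad e z r y))\<^sup>2)"
proof -
  obtain K where K: "compact K" "\<And>z. z \<notin> K \<Longrightarrow> v z = 0" "\<And>z. z \<notin> K \<Longrightarrow> g z = 0"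
    using C1c_obtain[OF v] by metis
  have c: "continuous_on UNIV g" "continuous_on UNIV (pot_grad e z r)"
    using C1_cont_grad C1cD[OF v] C1_pot by blast+
  have gL: "g \<in> L2" by (rule C1c_L2[OF v])
  show int: "integrable lborel (\<lambda>y. (cmod (pot_grad e z r y - g y))\<^sup>2 - (cmod (pot_grad e z r y))\<^sup>2)"
    by (rule continuous_compact_support_integrable[OF _ K(1)]) (use K(3) c in \<open>auto intro!: continuous_intros\<close>)
  have i2: "integrable lborel (\<lambda>y. pot_grad e z r y \<bullet> g y)"
    by (rule continuous_compact_support_integrable[OF _ K(1)]) (use K(3) c in \<open>auto intro!: continuous_intros\<close>)
  have "(nrm (\<lambda>y. g y - load e z r y))\<^sup>2 = (nrm (\<lambda>y. load e z r y + (- 1) *\<^sub>R g y))\<^sup>2"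
    using nrm_minus_commute[of g "load e z r"] by simp
  also have "\<dots> = (nrm (load e z r))\<^sup>2 - 2 * (\<integral>y. load e z r y \<bullet> g y \<partial>lborel) + (nrm g)\<^sup>2"
    using nrm_sq_add[OF load_L2[OF r] gL, of e z "- 1"] by simp
  also have "(\<integral>y. load e z r y \<bullet> g y \<partial>lborel) = (\<integral>y. pot_grad e z r y \<bullet> g y \<partial>lborel)"
  proof -
    have "(\<integral>y. load e z r y \<bullet> g y \<partial>lborel) = (\<integral>y. 2 * (bump z r y * (e \<bullet> g y)) \<partial>lborel)"
      by (rule Bochner_Integration.integral_cong) (simp_all add: load_def)
    also have "\<dots> = 2 * (\<integral>y. bump z r y * (e \<bullet> g y) \<partial>lborel)" by simp
    finally show ?thesis using integral_pot_grad[OF v e r, of z] by linarith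
  qed
  finally have "(nrm (\<lambda>y. g y - load e z r y))\<^sup>2 - (nrm (load e z r))\<^sup>2
     = (\<integral>y. (cmod (g y))\<^sup>2 \<partial>lborel) - 2 * (\<integral>y. pot_grad e z r y \<bullet> g y \<partial>lborel)"
    by (simp add: nrm_sq)
  also have "\<dots> = (\<integral>y. (cmod (g y))\<^sup>2 - 2 * (pot_grad e z r y \<bullet> g y) \<partial>lborel)"
    using L2_int[OF gL] i2 by simp
  also have "(\<lambda>y. (cmod (g y))\<^sup>2 - 2 * (pot_grad e z r y \<bullet> g y)) = (\<lambda>y. (cmod (pot_grad e z r y - g y))\<^sup>2 - (cmod (pot_grad e z r y))\<^sup>2)"
    by (rule ext) (simp add: power2_norm_eq_inner inner_diff_left inner_diff_right inner_commute)
  finally show "(nrm (\<lambda>y. g y - load e z r y))\<^sup>2 - (nrm (load e z r))\<^sup>2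
      = (\<integral>y. (cmod (pot_grad e z r y - g y))\<^sup>2 - (cmod (pot_grad e z r y))\<^sup>2 \<partial>lborel)" .
qed

text \<open>A truncation of \<open>P - v\<close> keeps the boundary values of \<open>P\<close> and lowers the Dirichlet energy.
  This gives the uniform bound that the maximum principle gives for the exact minimiser.\<close>
lemma truncate_competitor:
  assumes v: "C1c S v g" and e: "e = 1 \<or> e = \<i>" and r: "r > 0"
  obtains v' g' where "C1c S v' g'" "\<And>y. \<bar>v' y\<bar> \<le> 6 * r + 1"
    "nrm (\<lambda>y. g' y - load e z r y) \<le> nrm (\<lambda>y. g y - load e z r y)"
proof -
  have ne: "norm e \<le> 1" using e by auto
  let ?P = "pot e z r" and ?G = "pot_grad e z r" and ?m = "3 * r"
  \<comment> \<open>P - \<open>v'\<close> is the truncation of P - \<open>v\<close> at height 3r.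
    Where \<open>v\<close> vanishes this is P itself, so \<open>v'\<close> vanishes too. The bound
    6r + 1 adds the sup 3r of P and the largest truncated value 3r + 1.\<close>
  define v' where "v' = (\<lambda>y. ?P y - trunc ?m (?P y - v y))"
  define g' where "g' = (\<lambda>y. ?G y - trunc' ?m (?P y - v y) *\<^sub>R (?G y - g y))"
  obtain K where K: "compact K" "K \<subseteq> S" "\<And>z. z \<notin> K \<Longrightarrow> v z = 0"
    using C1c_obtain[OF v] by metis
  have v': "C1c S v' g'"
  proof (rule C1cI[OF _ K(1,2)])
    show "C1 v' g'" unfolding v'_def g'_def
      by (intro C1_diff C1_pot C1_compose[OF C1_diff[OF C1_pot C1cD[OF v]] DERIV_trunc continuous_trunc'])
    show "v' y = 0" if "y \<notin> K" for y
      using K(3)[OF that] pot_bound[OF ne r] by (simp add: v'_def trunc_id)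
  qed
  have "\<bar>v' y\<bar> \<le> 6 * r + 1" for y
    using pot_bound[OF ne r, of z y] trunc_bound[of ?m "?P y - v y"] r unfolding v'_def by linarith
  moreover have "nrm (\<lambda>y. g' y - load e z r y) \<le> nrm (\<lambda>y. g y - load e z r y)"
  proof (rule power2_le_imp_le)
    have "(\<integral>y. (cmod (?G y - g' y))\<^sup>2 - (cmod (?G y))\<^sup>2 \<partial>lborel) \<le> (\<integral>y. (cmod (?G y - g y))\<^sup>2 - (cmod (?G y))\<^sup>2 \<partial>lborel)"
    proof (rule integral_mono[OF energy_expand(2)[OF v' e r] energy_expand(2)[OF v e r]])
      fix y
      have "?G y - g' y = trunc' ?m (?P y - v y) *\<^sub>R (?G y - g y)" by (simp add: g'_def)
      then have "cmod (?G y - g' y) = \<bar>trunc' ?m (?P y - v y)\<bar> * cmod (?G y - g y)" by simp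
      also have "\<dots> \<le> 1 * cmod (?G y - g y)" using trunc'_bounds[of ?m] r by (intro mult_right_mono) auto
      finally have "(cmod (?G y - g' y))\<^sup>2 \<le> (cmod (?G y - g y))\<^sup>2" by (intro power_mono) auto
      then show "(cmod (?G y - g' y))\<^sup>2 - (cmod (?G y))\<^sup>2 \<le> (cmod (?G y - g y))\<^sup>2 - (cmod (?G y))\<^sup>2" by simp
    qed
    then show "(nrm (\<lambda>y. g' y - load e z r y))\<^sup>2 \<le> (nrm (\<lambda>y. g y - load e z r y))\<^sup>2"
      using energy_expand(1)[OF v' e r, of z] energy_expand(1)[OF v e r, of z] by linarith
  qed simp
  ultimately show ?thesis using v' that by blast
qed

text \<open>The members come within 1/(n+1)^2 of the infimum of the squared distance. Perturbing by
  every multiple of a test function gives the approximate Euler-Lagrange inequality; the last bound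
  makes the gradients Cauchy.\<close>

lemma minimizing_sequence:
  assumes e: "e = 1 \<or> e = \<i>" and r: "r > 0"
  obtains v :: "nat \<Rightarrow> complex \<Rightarrow> real" and g where
    "\<And>n. C1c S (v n) (g n)" "\<And>n y. \<bar>v n y\<bar> \<le> 6 * r + 1"
    "\<And>n u h. C1c S u h \<Longrightarrow> \<bar>\<integral>y. (g n y - load e z r y) \<bullet> h y \<partial>lborel\<bar> \<le> 1 / real (Suc n) * nrm h"
    "\<And>m n. (nrm (\<lambda>y. g m y - g n y))\<^sup>2 \<le> 2 * ((1 / real (Suc m))\<^sup>2 + (1 / real (Suc n))\<^sup>2)"
proof -
  let ?b = "load e z r"
  let ?A = "{(nrm (\<lambda>y. g y - ?b y))\<^sup>2 |v g. C1c S v g}"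
  define I where "I = Inf ?A"
  have bdd: "bdd_below ?A" by (rule bdd_belowI[of _ 0]) auto
  have ne: "?A \<noteq> {}" using C1c_zero[of S] by blast
  have I_le: "I \<le> (nrm (\<lambda>y. g y - ?b y))\<^sup>2" if "C1c S v g" for v g
    unfolding I_def by (rule cInf_lower[OF _ bdd]) (use that in blast)
  have ex: "\<exists>v g. C1c S v g \<and> (\<forall>y. \<bar>v y\<bar> \<le> 6 * r + 1) \<and> (nrm (\<lambda>y. g y - ?b y))\<^sup>2 \<le> I + (1 / real (Suc n))\<^sup>2" for n
  proof -
    have "I < I + (1 / real (Suc n))\<^sup>2" by (simp del: of_nat_Suc)
    then have "\<exists>x\<in>?A. x < I + (1 / real (Suc n))\<^sup>2"
      unfolding I_def by (rule cInf_lessD[OF ne])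
    then obtain v g where v: "C1c S v g" "(nrm (\<lambda>y. g y - ?b y))\<^sup>2 < I + (1 / real (Suc n))\<^sup>2" by blast
    obtain v' g' where v': "C1c S v' g'" "\<And>y. \<bar>v' y\<bar> \<le> 6 * r + 1" "nrm (\<lambda>y. g' y - ?b y) \<le> nrm (\<lambda>y. g y - ?b y)"
      using truncate_competitor[OF v(1) e r, of z] by metis
    have "(nrm (\<lambda>y. g' y - ?b y))\<^sup>2 \<le> (nrm (\<lambda>y. g y - ?b y))\<^sup>2" using v'(3) by (intro power_mono) auto
    then have "(nrm (\<lambda>y. g' y - ?b y))\<^sup>2 \<le> I + (1 / real (Suc n))\<^sup>2" using v(2) by linarith
    with v' show ?thesis by blast
  qed
  obtain v g where vg: "\<And>n. C1c S (v n) (g n)" "\<And>n y. \<bar>v n y\<bar> \<le> 6 * r + 1"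
    "\<And>n. (nrm (\<lambda>y. g n y - ?b y))\<^sup>2 \<le> I + (1 / real (Suc n))\<^sup>2"
    using ex by metis
  have L: "(\<lambda>y. g n y - ?b y) \<in> L2" for n by (intro L2_diff C1c_L2[OF vg(1)] load_L2 r)
  have EL: "\<bar>\<integral>y. (g n y - ?b y) \<bullet> h y \<partial>lborel\<bar> \<le> 1 / real (Suc n) * nrm h" if h: "C1c S u h" for n u h
  proof -
    have hL: "h \<in> L2" by (rule C1c_L2[OF h])
    have "\<bar>\<integral>y. (g n y - ?b y) \<bullet> h y \<partial>lborel\<bar> \<le> 1 / real (Suc n) * sqrt ((nrm h)\<^sup>2)"
    proof (rule quadratic_bound)
      fix t
      have "I \<le> (nrm (\<lambda>y. (g n y + t *\<^sub>R h y) - ?b y))\<^sup>2"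
        by (rule I_le[OF C1c_add[OF vg(1) C1c_cmult[OF h]]])
      also have "(\<lambda>y. (g n y + t *\<^sub>R h y) - ?b y) = (\<lambda>y. (g n y - ?b y) + t *\<^sub>R h y)" by (rule ext) simp
      also have "(nrm (\<lambda>y. (g n y - ?b y) + t *\<^sub>R h y))\<^sup>2
          = (nrm (\<lambda>y. g n y - ?b y))\<^sup>2 + 2 * t * (\<integral>y. (g n y - ?b y) \<bullet> h y \<partial>lborel) + t\<^sup>2 * (nrm h)\<^sup>2"
        by (rule nrm_sq_add[OF L hL])
      finally show "- (1 / real (Suc n))\<^sup>2 \<le> t\<^sup>2 * (nrm h)\<^sup>2 + 2 * t * (\<integral>y. (g n y - ?b y) \<bullet> h y \<partial>lborel)"
        using vg(3)[of n] by linarith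
    qed auto
    then show ?thesis by simp
  qed
  have C: "(nrm (\<lambda>y. g m y - g n y))\<^sup>2 \<le> 2 * ((1 / real (Suc m))\<^sup>2 + (1 / real (Suc n))\<^sup>2)" for m n
  proof -
    define a where "a = (\<lambda>y. g m y - ?b y)"
    define c where "c = (\<lambda>y. g n y - ?b y)"
    have aL: "a \<in> L2" and cL: "c \<in> L2" using L by (auto simp: a_def c_def)
    have 1: "(nrm (\<lambda>y. a y + (- 1) *\<^sub>R c y))\<^sup>2 = (nrm a)\<^sup>2 + 2 * (- 1) * (\<integral>y. a y \<bullet> c y \<partial>lborel) + (- 1)\<^sup>2 * (nrm c)\<^sup>2"
      by (rule nrm_sq_add[OF aL cL])
    have 2: "(nrm (\<lambda>y. a y + 1 *\<^sub>R c y))\<^sup>2 = (nrm a)\<^sup>2 + 2 * 1 * (\<integral>y. a y \<bullet> c y \<partial>lborel) + 1\<^sup>2 * (nrm c)\<^sup>2"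
      by (rule nrm_sq_add[OF aL cL])
    \<comment> \<open>The midpoint is again a competitor, so the parallelogram law converts
      near-minimality into closeness.\<close>
    have mid: "C1c S (\<lambda>y. (1/2) * v m y + (1/2) * v n y) (\<lambda>y. (1/2) *\<^sub>R g m y + (1/2) *\<^sub>R g n y)"
      by (intro C1c_add C1c_cmult vg(1))
    have ac: "(\<lambda>y. a y + 1 *\<^sub>R c y) = (\<lambda>y. 2 * (((1/2) *\<^sub>R g m y + (1/2) *\<^sub>R g n y) - ?b y))"
      by (rule ext) (simp add: a_def c_def scaleR_conv_of_real algebra_simps)
    have "(nrm (\<lambda>y. a y + 1 *\<^sub>R c y))\<^sup>2 = 4 * (nrm (\<lambda>y. ((1/2) *\<^sub>R g m y + (1/2) *\<^sub>R g n y) - ?b y))\<^sup>2"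
      unfolding ac nrm_cmult by (simp add: power_mult_distrib)
    then have "4 * I \<le> (nrm (\<lambda>y. a y + 1 *\<^sub>R c y))\<^sup>2" using I_le[OF mid] by simp
    moreover have "(\<lambda>y. a y + (- 1) *\<^sub>R c y) = (\<lambda>y. g m y - g n y)" by (rule ext) (simp add: a_def c_def)
    moreover have "(nrm a)\<^sup>2 \<le> I + (1 / real (Suc m))\<^sup>2" "(nrm c)\<^sup>2 \<le> I + (1 / real (Suc n))\<^sup>2"
      unfolding a_def c_def by (rule vg(3))+
    ultimately show ?thesis using 1 2 by simp
  qed
  show ?thesis by (rule that[OF vg(1) vg(2) EL C])
qed

section \<open>Mean values and existence of the Bergman kernel\<close>

lemma holomorphic_almost_holomorphic:
  assumes S: "open S" and f: "f \<in> bergman_space S"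
  shows "almost_holomorphic S (\<lambda>n z. indicator S z *\<^sub>R f z)"
proof
  have h: "f holomorphic_on S" "(\<lambda>z. indicator S z *\<^sub>R f z) \<in> L2" using f bergman_space_iff[OF S] by auto
  show "open S" "(\<lambda>z. indicator S z *\<^sub>R f z) \<in> L2" by fact+
  show "continuous_on S (\<lambda>z. indicator S z *\<^sub>R f z)"
    by (rule continuous_on_eq[OF holomorphic_on_imp_continuous_on[OF h(1)]]) simp
  show "indicator S z *\<^sub>R f z = 0" if "z \<notin> S" for z using that by simp
  show "\<exists>N. \<forall>m\<ge>N. \<forall>n\<ge>N. nrm (\<lambda>z. indicator S z *\<^sub>R f z - indicator S z *\<^sub>R f z) < e" if "e > 0" for e
    using that by (simp add: nrm_def)
  show "(\<lambda>n. \<integral>z. indicator S z *\<^sub>R f z * g z \<partial>lborel) \<longlonglongrightarrow> 0" if "C1c S u g" for u g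
    using holomorphic_integral_grad_eq_0[OF h(1) S that] by simp
qed

text \<open>For the constant sequence \<open>f\<close> the weighted mean does not depend on the
  radius; letting the radius tend to 0 identifies it with \<open>f z\<close>.\<close>

lemma bergman_mean_value:
  assumes S: "open S" and f: "f \<in> bergman_space S" and r: "r > 0" "cball z r \<subseteq> S"
  shows "(\<integral>y. (indicator S y *\<^sub>R f y) * of_real (bump z r y) \<partial>lborel) = of_real (r\<^sup>2 * bump_mass) * f z"
proof -
  let ?f = "\<lambda>y. indicator S y *\<^sub>R f y"
  interpret almost_holomorphic S "\<lambda>n. ?f" by (rule holomorphic_almost_holomorphic[OF S f])
  have zS: "z \<in> S" using r by auto
  have Lam: "Lam k = (\<integral>y. ?f y * k y \<partial>lborel)" for k
    unfolding Lam_def by (rule limI) simp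
  have lim: "limit z = mollify s ?f z / of_real (s\<^sup>2 * bump_mass)" if "s > 0" "cball z s \<subseteq> S" for s
    using limit_eq[OF that] unfolding Lam mollify_def .
  obtain d where d: "d > 0" "cball z d \<subseteq> S" using zS S open_contains_cball by blast
  obtain K where K: "1 / real (Suc K) < d" using nat_approx_posE[OF d(1)] by blast
  have "(\<lambda>k. mollify (1 / real (Suc k)) ?f z / of_real ((1 / real (Suc k))\<^sup>2 * bump_mass)) \<longlonglongrightarrow> ?f z"
    by (rule mollify_approx[OF R_L2 S R_cont zS])
  moreover have "\<forall>\<^sub>F k in sequentially. mollify (1 / real (Suc k)) ?f z / of_real ((1 / real (Suc k))\<^sup>2 * bump_mass) = limit z"
  proof (rule eventually_sequentiallyI[of K])
    fix k assume "k \<ge> K"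
    then have "1 / real (Suc k) \<le> 1 / real (Suc K)" by (intro divide_left_mono) auto
    then have "cball z (1 / real (Suc k)) \<subseteq> S" using K d(2) by (meson less_eq_real_def order_trans subset_cball)
    from lim[OF _ this] show "mollify (1 / real (Suc k)) ?f z / of_real ((1 / real (Suc k))\<^sup>2 * bump_mass) = limit z"
      by simp
  qed
  ultimately have "(\<lambda>k. limit z) \<longlonglongrightarrow> ?f z" by (rule Lim_transform_eventually)
  then have "limit z = f z" using LIMSEQ_unique[OF tendsto_const] zS by fastforce
  then have *: "mollify r ?f z / of_real (r\<^sup>2 * bump_mass) = f z" using lim[OF r] by simp
  have "complex_of_real (r\<^sup>2 * bump_mass) \<noteq> 0" using r bump_mass_pos by simp
  from nonzero_divide_eq_eq[OF this, THEN iffD1, OF *] show ?thesis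
    unfolding mollify_def by (simp only: mult.commute)
qed

text \<open>The difference \<open>\<psi> - \<partial>(v\<^sub>1 + \<i>v\<^sub>2)\<close>, which converges to the Bergman projection of \<open>\<psi>\<close>.\<close>
definition residual :: "complex \<Rightarrow> real \<Rightarrow> (complex \<Rightarrow> complex) \<Rightarrow> (complex \<Rightarrow> complex) \<Rightarrow> complex \<Rightarrow> complex" where
  "residual z r g1 g2 y = of_real (bump z r y) - (1/2) * (cnj (g1 y) + \<i> * cnj (g2 y))"

lemma residual_L2: "r > 0 \<Longrightarrow> g1 \<in> L2 \<Longrightarrow> g2 \<in> L2 \<Longrightarrow> residual z r g1 g2 \<in> L2"
  unfolding residual_def[abs_def]
  by (intro L2_diff L2_cmult L2_add L2_cnj bump_L2)

text \<open>\<open>h\<close> is twice the derivative of \<open>u\<close> with respect to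
  \<open>cnj y\<close>. Up to curl integrals, which vanish, the pairing consists of the two
  Euler-Lagrange expressions, so near-minimality means near-holomorphy.\<close>

lemma residual_weak:
  assumes r: "r > 0" and v: "C1c S v1 g1" "C1c S v2 g2" and u: "C1c S u h"
  shows "(\<integral>y. residual z r g1 g2 y * h y \<partial>lborel)
     = - (1/2) * (of_real (\<integral>y. (g1 y - load 1 z r y) \<bullet> h y \<partial>lborel) + \<i> * of_real (\<integral>y. (g2 y - load \<i> z r y) \<bullet> h y \<partial>lborel))"
proof -
  have L: "g1 \<in> L2" "g2 \<in> L2" "h \<in> L2" using C1c_L2 v u by blast+
  let ?a = "\<lambda>y. (g1 y - load 1 z r y) \<bullet> h y" and ?b = "\<lambda>y. (g2 y - load \<i> z r y) \<bullet> h y"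
  let ?c = "\<lambda>g y. Im (g y) * Re (h y) - Re (g y) * Im (h y)"
  have i: "integrable lborel ?a" "integrable lborel ?b"
    by (intro L2_inner_integrable L2_diff L load_L2 r)+
  have ci: "integrable lborel (?c g)" if "g \<in> L2" for g
  proof -
    have "?c g = (\<lambda>y. - Im (cnj (g y) * h y))" by (rule ext) simp
    moreover have "integrable lborel (\<lambda>y. - Im (cnj (g y) * h y))"
      by (rule Bochner_Integration.integrable_minus[OF integrable_Im[OF L2_mult_integrable[OF L2_cnj[OF that] L(3)]]])
    ultimately show ?thesis by (simp only:)
  qed
  have c0: "(\<integral>y. ?c g1 y \<partial>lborel) = 0" "(\<integral>y. ?c g2 y \<partial>lborel) = 0"
    by (rule integral_curl_eq_0[OF C1cD[OF v(1)] u], rule integral_curl_eq_0[OF C1cD[OF v(2)] u])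
  have "residual z r g1 g2 y * h y = - (1/2) * (of_real (?a y) + \<i> * of_real (?b y)) + (1/2) * (\<i> * of_real (?c g1 y) - of_real (?c g2 y))" for y
    unfolding residual_def load_def
    by (simp add: complex_eq_iff inner_complex_def) (simp add: add_divide_distrib diff_divide_distrib algebra_simps)
  then have "(\<integral>y. residual z r g1 g2 y * h y \<partial>lborel) =
     (\<integral>y. - (1/2) * (of_real (?a y) + \<i> * of_real (?b y)) + (1/2) * (\<i> * of_real (?c g1 y) - of_real (?c g2 y)) \<partial>lborel)"
    by presburger
  also have "\<dots> = - (1/2) * (of_real (integral\<^sup>L lborel ?a) + \<i> * of_real (integral\<^sup>L lborel ?b))
      + (1/2) * (\<i> * of_real (\<integral>y. ?c g1 y \<partial>lborel) - of_real (\<integral>y. ?c g2 y \<partial>lborel))"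
    (is "(\<integral>y. - (1/2) * (?A y + \<i> * ?B y) + (1/2) * (\<i> * ?C y - ?D y) \<partial>lborel) = _")
  proof -
    have j: "integrable lborel ?A" "integrable lborel ?B" "integrable lborel ?C" "integrable lborel ?D"
      using i ci[OF L(1)] ci[OF L(2)] by (simp_all only: complex_of_real_integrable_eq)
    have "(\<integral>y. - (1/2) * (?A y + \<i> * ?B y) + (1/2) * (\<i> * ?C y - ?D y) \<partial>lborel)
       = - (1/2) * (integral\<^sup>L lborel ?A + \<i> * integral\<^sup>L lborel ?B) + (1/2) * (\<i> * integral\<^sup>L lborel ?C - integral\<^sup>L lborel ?D)"
      using j by simp
    then show ?thesis by (simp only: integral_complex_of_real)
  qed
  finally show ?thesis unfolding c0 by simp
qed

text \<open>Real and imaginary part of the complex potential are minimised separately, with data in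
  the directions 1 and \<i>. The residuals form an \<open>almost_holomorphic\<close> sequence, which
  supplies \<open>F\<close>.\<close>

lemma approximate_bergman_projection:
  assumes S: "open S" and r: "r > 0" "cball z r \<subseteq> S"
  obtains v1 g1 v2 g2 :: "nat \<Rightarrow> complex \<Rightarrow> _" and F where
    "\<And>n. C1c S (v1 n) (g1 n)" "\<And>n y. \<bar>v1 n y\<bar> \<le> 6 * r + 1"
    "\<And>n u h. C1c S u h \<Longrightarrow> \<bar>\<integral>y. (g1 n y - load 1 z r y) \<bullet> h y \<partial>lborel\<bar> \<le> 1 / real (Suc n) * nrm h"
    "\<And>n. C1c S (v2 n) (g2 n)" "\<And>n y. \<bar>v2 n y\<bar> \<le> 6 * r + 1"
    "\<And>n u h. C1c S u h \<Longrightarrow> \<bar>\<integral>y. (g2 n y - load \<i> z r y) \<bullet> h y \<partial>lborel\<bar> \<le> 1 / real (Suc n) * nrm h"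
    "F \<in> bergman_space S"
    "(\<lambda>n. nrm (\<lambda>y. residual z r (g1 n) (g2 n) y - indicator S y *\<^sub>R F y)) \<longlonglongrightarrow> 0"
proof -
  obtain v1 :: "nat \<Rightarrow> complex \<Rightarrow> real" and g1 where 1:
    "\<And>n. C1c S (v1 n) (g1 n)" "\<And>n y. \<bar>v1 n y\<bar> \<le> 6 * r + 1"
    "\<And>n u h. C1c S u h \<Longrightarrow> \<bar>\<integral>y. (g1 n y - load 1 z r y) \<bullet> h y \<partial>lborel\<bar> \<le> 1 / real (Suc n) * nrm h"
    "\<And>m n. (nrm (\<lambda>y. g1 m y - g1 n y))\<^sup>2 \<le> 2 * ((1 / real (Suc m))\<^sup>2 + (1 / real (Suc n))\<^sup>2)"
    by (rule minimizing_sequence[where e=1 and S=S and z=z, OF _ r(1)]) auto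
  obtain v2 :: "nat \<Rightarrow> complex \<Rightarrow> real" and g2 where 2:
    "\<And>n. C1c S (v2 n) (g2 n)" "\<And>n y. \<bar>v2 n y\<bar> \<le> 6 * r + 1"
    "\<And>n u h. C1c S u h \<Longrightarrow> \<bar>\<integral>y. (g2 n y - load \<i> z r y) \<bullet> h y \<partial>lborel\<bar> \<le> 1 / real (Suc n) * nrm h"
    "\<And>m n. (nrm (\<lambda>y. g2 m y - g2 n y))\<^sup>2 \<le> 2 * ((1 / real (Suc m))\<^sup>2 + (1 / real (Suc n))\<^sup>2)"
    by (rule minimizing_sequence[where e="\<i>" and S=S and z=z, OF _ r(1)]) auto
  define R where "R = (\<lambda>n. residual z r (g1 n) (g2 n))"
  have gL: "g1 n \<in> L2" "g2 n \<in> L2" for n using C1c_L2 1(1) 2(1) by blast+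
  interpret almost_holomorphic S R
  proof
    show "open S" by fact
    show "R n \<in> L2" for n unfolding R_def by (rule residual_L2[OF r(1) gL])
    have c: "continuous_on UNIV (g1 n)" "continuous_on UNIV (g2 n)" for n
      using C1_cont_grad C1cD 1(1) 2(1) by blast+
    show "continuous_on S (R n)" for n
      unfolding R_def residual_def[abs_def]
      by (intro continuous_intros continuous_on_subset[OF c(1)] continuous_on_subset[OF c(2)]
          continuous_on_subset[OF C1_cont[OF C1_bump]]) auto
    show "R n y = 0" if "y \<notin> S" for n y
    proof -
      have "g1 n y = 0" "g2 n y = 0" using C1c_obtain[OF 1(1)[of n]] C1c_obtain[OF 2(1)[of n]] that by (metis subsetD)+
      moreover have "y \<notin> ball z r" using r(2) that ball_subset_cball by blast
      then have "bump z r y = 0" by (rule bump_eq_0[OF r(1)])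
      ultimately show ?thesis by (simp add: R_def residual_def)
    qed
    show "\<exists>N. \<forall>m\<ge>N. \<forall>n\<ge>N. nrm (\<lambda>y. R m y - R n y) < e" if "e > 0" for e
    proof -
      have "e / 2 > 0" using that by simp
      then obtain N where N: "1 / real (Suc N) < e / 2" using nat_approx_posE by blast
      have "nrm (\<lambda>y. R m y - R n y) < e" if mn: "m \<ge> N" "n \<ge> N" for m n
      proof -
        have *: "nrm f \<le> 2 * (1 / real (Suc N))" if "(nrm f)\<^sup>2 \<le> 2 * ((1 / real (Suc m))\<^sup>2 + (1 / real (Suc n))\<^sup>2)" for f
        proof (rule power2_le_imp_le)
          have "1 / real (Suc m) \<le> 1 / real (Suc N)" "1 / real (Suc n) \<le> 1 / real (Suc N)"
            using mn by (auto intro!: divide_left_mono)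
          then have "(1 / real (Suc m))\<^sup>2 \<le> (1 / real (Suc N))\<^sup>2" "(1 / real (Suc n))\<^sup>2 \<le> (1 / real (Suc N))\<^sup>2"
            by (auto intro!: power_mono simp del: of_nat_Suc)
          moreover have "x \<le> 2 * 2 * c" if "x \<le> 2 * (p + q)" "p \<le> c" "q \<le> c" for x p q c :: real
            using that by simp
          ultimately show "(nrm f)\<^sup>2 \<le> (2 * (1 / real (Suc N)))\<^sup>2"
            using that unfolding power_mult_distrib power2_eq_square[of "2::real"] by blast
        qed (simp del: of_nat_Suc)
        let ?d1 = "\<lambda>y. g1 m y - g1 n y" and ?d2 = "\<lambda>y. g2 m y - g2 n y"
        have d: "?d1 \<in> L2" "?d2 \<in> L2" using gL by (auto intro: L2_diff)
        have eq: "(\<lambda>y. R m y - R n y) = (\<lambda>y. (- (1/2)) * (cnj (?d1 y) + \<i> * cnj (?d2 y)))"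
          by (rule ext) (simp add: R_def residual_def algebra_simps)
        have "nrm (\<lambda>y. R m y - R n y) = (1/2) * nrm (\<lambda>y. cnj (?d1 y) + \<i> * cnj (?d2 y))"
          unfolding eq nrm_cmult by simp
        also have "\<dots> \<le> (1/2) * (nrm (\<lambda>y. cnj (?d1 y)) + nrm (\<lambda>y. \<i> * cnj (?d2 y)))"
          by (intro mult_left_mono nrm_triangle L2_cmult L2_cnj d) simp
        also have "\<dots> = (1/2) * (nrm ?d1 + nrm ?d2)"
          unfolding nrm_cmult nrm_cnj by simp
        finally have "nrm (\<lambda>y. R m y - R n y) \<le> (1/2) * (nrm ?d1 + nrm ?d2)" .
        moreover have "x < e" if "x \<le> (1/2) * (a + b)" "a \<le> 2 * d" "b \<le> 2 * d" "d < e / 2" for x a b d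
          using that by simp
        ultimately show ?thesis using *[OF 1(4)] *[OF 2(4)] N by blast
      qed
      then show ?thesis by blast
    qed
    show "(\<lambda>n. \<integral>y. R n y * h y \<partial>lborel) \<longlonglongrightarrow> 0" if u: "C1c S u h" for u h
    proof (rule Lim_null_comparison)
      show "(\<lambda>n. nrm h * inverse (real (Suc n))) \<longlonglongrightarrow> 0"
        using tendsto_mult_right_zero[OF LIMSEQ_inverse_real_of_nat] by blast
      show "\<forall>\<^sub>F n in sequentially. norm (\<integral>y. R n y * h y \<partial>lborel) \<le> nrm h * inverse (real (Suc n))"
      proof (intro always_eventually allI)
        fix n
        let ?p = "\<integral>y. (g1 n y - load 1 z r y) \<bullet> h y \<partial>lborel" and ?q = "\<integral>y. (g2 n y - load \<i> z r y) \<bullet> h y \<partial>lborel"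
        have "norm (\<integral>y. R n y * h y \<partial>lborel) = 1/2 * norm (of_real ?p + \<i> * of_real ?q)"
          unfolding R_def residual_weak[OF r(1) 1(1) 2(1) u] norm_mult by simp
        also have "\<dots> \<le> 1/2 * (\<bar>?p\<bar> + \<bar>?q\<bar>)"
          using norm_triangle_ineq[of "of_real ?p" "\<i> * of_real ?q"] by (simp add: norm_mult)
        also have "\<dots> \<le> 1 / real (Suc n) * nrm h"
        proof -
          have "(1/2) * (a + b) \<le> d" if "a \<le> d" "b \<le> d" for a b d :: real
            using that by simp
          then show ?thesis using 1(3)[OF u, of n] 2(3)[OF u, of n] by blast
        qed
        finally show "norm (\<integral>y. R n y * h y \<partial>lborel) \<le> nrm h * inverse (real (Suc n))"
          by (simp add: field_simps)
      qed
    qed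
  qed
  obtain F where F: "F \<in> bergman_space S" "(\<lambda>n. nrm (\<lambda>y. R n y - indicator S y *\<^sub>R F y)) \<longlonglongrightarrow> 0"
    using limit_bergman limit_tendsto by blast
  show ?thesis
    by (rule that[OF 1(1,2,3) 2(1,2,3) F(1) F(2)[unfolded R_def]])
qed

text \<open>The gradient terms integrate to 0 against the holomorphic \<open>f\<close>; the bump
  leaves the mean value property.\<close>

lemma pairing_residual_bergman:
  assumes S: "open S" and r: "r > 0" "cball z r \<subseteq> S" and f: "f \<in> bergman_space S"
    and v: "C1c S v1 g1" "C1c S v2 g2"
  shows "(\<integral>y. (indicator S y *\<^sub>R f y) * cnj (residual z r g1 g2 y) \<partial>lborel) = of_real (r\<^sup>2 * bump_mass) * f z"
proof -
  let ?f = "\<lambda>y. indicator S y *\<^sub>R f y"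
  have h: "f holomorphic_on S" and fL: "?f \<in> L2" using f bergman_space_iff[OF S] by auto
  have L: "g1 \<in> L2" "g2 \<in> L2" using C1c_L2 v by blast+
  have 0: "(\<integral>y. ?f y * g1 y \<partial>lborel) = 0" "(\<integral>y. ?f y * g2 y \<partial>lborel) = 0"
    using holomorphic_integral_grad_eq_0[OF h S v(1)] holomorphic_integral_grad_eq_0[OF h S v(2)] by simp_all
  have "?f y * cnj (residual z r g1 g2 y) = ?f y * of_real (bump z r y) - (1/2) * (?f y * g1 y - \<i> * (?f y * g2 y))" for y
    by (simp add: residual_def scaleR_conv_of_real algebra_simps)
  then have "(\<integral>y. ?f y * cnj (residual z r g1 g2 y) \<partial>lborel) = (\<integral>y. ?f y * of_real (bump z r y) - (1/2) * (?f y * g1 y - \<i> * (?f y * g2 y)) \<partial>lborel)"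
    by presburger
  also have "\<dots> = (\<integral>y. ?f y * of_real (bump z r y) \<partial>lborel) - (1/2) * ((\<integral>y. ?f y * g1 y \<partial>lborel) - \<i> * (\<integral>y. ?f y * g2 y \<partial>lborel))"
    using L2_mult_integrable[OF fL bump_L2[OF r(1), of z]] L2_mult_integrable[OF fL L(1)] L2_mult_integrable[OF fL L(2)]
    by (simp only: Bochner_Integration.integral_diff Bochner_Integration.integrable_diff integrable_mult_right integral_mult_right_zero)
  also have "\<dots> = of_real (r\<^sup>2 * bump_mass) * f z" unfolding 0 bergman_mean_value[OF S f r] by simp
  finally show ?thesis .
qed

lemma pairing_tendsto:
  assumes "f \<in> L2" "\<And>n. R n \<in> L2" "F \<in> L2" "(\<lambda>n. nrm (\<lambda>y. R n y - F y)) \<longlonglongrightarrow> 0"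
  shows "(\<lambda>n. \<integral>y. f y * cnj (R n y) \<partial>lborel) \<longlonglongrightarrow> (\<integral>y. f y * cnj (F y) \<partial>lborel)"
proof -
  have "(\<lambda>n. (\<integral>y. f y * cnj (R n y) \<partial>lborel) - (\<integral>y. f y * cnj (F y) \<partial>lborel)) \<longlonglongrightarrow> 0"
  proof (rule Lim_null_comparison)
    show "(\<lambda>n. nrm f * nrm (\<lambda>y. R n y - F y)) \<longlonglongrightarrow> 0" by (rule tendsto_mult_right_zero[OF assms(4)])
    show "\<forall>\<^sub>F n in sequentially. norm ((\<integral>y. f y * cnj (R n y) \<partial>lborel) - (\<integral>y. f y * cnj (F y) \<partial>lborel)) \<le> nrm f * nrm (\<lambda>y. R n y - F y)"
    proof (intro always_eventually allI)
      fix n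
      have "(\<integral>y. f y * cnj (R n y) \<partial>lborel) - (\<integral>y. f y * cnj (F y) \<partial>lborel) = (\<integral>y. f y * cnj (R n y - F y) \<partial>lborel)"
        using L2_mult_integrable[OF assms(1) L2_cnj[OF assms(2)]] L2_mult_integrable[OF assms(1) L2_cnj[OF assms(3)]]
        by (simp add: right_diff_distrib)
      then show "norm ((\<integral>y. f y * cnj (R n y) \<partial>lborel) - (\<integral>y. f y * cnj (F y) \<partial>lborel)) \<le> nrm f * nrm (\<lambda>y. R n y - F y)"
        using L2_Cauchy_Schwarz[OF assms(1) L2_cnj[OF L2_diff[OF assms(2,3)]], of n] nrm_cnj[of "\<lambda>y. R n y - F y"] by simp
    qed
  qed
  then show ?thesis by (rule LIM_zero_cancel)
qed

text \<open>The kernel with pole \<open>w\<close> is the projection of a bump at \<open>w\<close>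
  divided by the mass of the bump; pairing with it returns the mean value \<open>f w\<close>. Hence
  the \<open>SOME\<close> in \<open>bergman_kernel\<close> has a witness.\<close>

lemma bergman_kernel_exists:
  assumes S: "open S" shows "is_bergman_kernel S (bergman_kernel S)"
proof -
  have ex: "\<exists>k. k \<in> bergman_space S \<and> (\<forall>f\<in>bergman_space S. f w = (LINT z:S|lborel. f z * cnj (k z)))" if w: "w \<in> S" for w
  proof -
    obtain r where r: "r > 0" "cball w r \<subseteq> S" using S w open_contains_cball by blast
    obtain v1 g1 v2 g2 :: "nat \<Rightarrow> complex \<Rightarrow> _" and F where v: "\<And>n. C1c S (v1 n) (g1 n)" "\<And>n. C1c S (v2 n) (g2 n)"
      and F: "F \<in> bergman_space S" "(\<lambda>n. nrm (\<lambda>y. residual w r (g1 n) (g2 n) y - indicator S y *\<^sub>R F y)) \<longlonglongrightarrow> 0"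
      by (rule approximate_bergman_projection[OF S r]) (rule that)
    let ?c = "complex_of_real (r\<^sup>2 * bump_mass)"
    have c: "?c \<noteq> 0" using r bump_mass_pos by simp
    have FL: "F holomorphic_on S" "(\<lambda>y. indicator S y *\<^sub>R F y) \<in> L2" using F(1) bergman_space_iff[OF S] by auto
    define k where "k = (\<lambda>y. (1 / ?c) * F y)"
    have kb: "k \<in> bergman_space S"
      unfolding bergman_space_iff[OF S] k_def
      using L2_cmult[OF FL(2), of "1 / ?c"] FL(1) by (auto intro!: holomorphic_intros simp: scaleR_conv_of_real mult_ac)
    have "f w = (LINT z:S|lborel. f z * cnj (k z))" if f: "f \<in> bergman_space S" for f
    proof -
      have fL: "(\<lambda>y. indicator S y *\<^sub>R f y) \<in> L2" using f bergman_space_iff[OF S] by auto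
      have "(\<lambda>n. \<integral>y. (indicator S y *\<^sub>R f y) * cnj (residual w r (g1 n) (g2 n) y) \<partial>lborel) \<longlonglongrightarrow> (\<integral>y. (indicator S y *\<^sub>R f y) * cnj (indicator S y *\<^sub>R F y) \<partial>lborel)"
        by (rule pairing_tendsto[OF fL residual_L2[OF r(1) C1c_L2[OF v(1)] C1c_L2[OF v(2)]] FL(2) F(2)])
      then have "?c * f w = (\<integral>y. (indicator S y *\<^sub>R f y) * cnj (indicator S y *\<^sub>R F y) \<partial>lborel)"
        unfolding pairing_residual_bergman[OF S r f v] using LIMSEQ_unique[OF tendsto_const] by blast
      then have "f w = (1 / ?c) * (\<integral>y. (indicator S y *\<^sub>R f y) * cnj (indicator S y *\<^sub>R F y) \<partial>lborel)"
        using c by (simp add: field_simps)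
      also have "\<dots> = (\<integral>y. (1 / ?c) * ((indicator S y *\<^sub>R f y) * cnj (indicator S y *\<^sub>R F y)) \<partial>lborel)"
        by (rule integral_mult_right_zero[symmetric])
      also have "\<dots> = (LINT z:S|lborel. f z * cnj (k z))"
        unfolding set_lebesgue_integral_def k_def
        by (rule Bochner_Integration.integral_cong) (auto simp: indicator_def)
      finally show ?thesis .
    qed
    with kb show ?thesis by blast
  qed
  define K where "K = (\<lambda>z w. (SOME k. k \<in> bergman_space S \<and> (\<forall>f\<in>bergman_space S. f w = (LINT z:S|lborel. f z * cnj (k z)))) z)"
  have "is_bergman_kernel S K"
    unfolding is_bergman_kernel_def K_def using someI_ex[OF ex] by blast
  then show ?thesis unfolding bergman_kernel_def by (rule someI[of "is_bergman_kernel S"])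
qed

section \<open>Logarithmic energy and capacity\<close>

text \<open>Schoenberg's space-filling curve: the wave is constant on thirds of a period, so that on the Cantor
  set it reads off ternary digits.\<close>
definition wave :: "real \<Rightarrow> real" where
  "wave t = max 0 (min 1 (1/2 - cos (pi * t)))"

definition schoenberg :: "nat \<Rightarrow> real \<Rightarrow> real" where
  "schoenberg i t = (\<Sum>k. (1/2) ^ Suc k * wave (3 ^ (2 * k + i) * t))"

lemma wave_bounds: "0 \<le> wave t" "wave t \<le> 1"
  by (auto simp: wave_def)

lemma continuous_wave: "continuous_on UNIV wave"
  unfolding wave_def[abs_def] by (intro continuous_intros)

lemma wave_periodic: "wave (2 * real n + t) = wave t"
proof -
  have "cos (pi * (2 * real n + t)) = cos (pi * t + real n * (2 * pi))" by (simp add: algebra_simps)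
  also have "\<dots> = cos (pi * t)"
  proof (induction n)
    case (Suc n)
    have "pi * t + real (Suc n) * (2 * pi) = (pi * t + real n * (2 * pi)) + 2 * pi" by (simp add: algebra_simps)
    then show ?case using Suc by (simp only: cos_periodic)
  qed simp
  finally show ?thesis by (simp add: wave_def)
qed

lemma wave_low:
  assumes "0 \<le> t" "t \<le> 1/3" shows "wave t = 0"
proof -
  have "cos (pi / 3) \<le> cos (pi * t)"
    using assms by (intro cos_monotone_0_pi_le) auto
  then show ?thesis by (simp add: wave_def cos_60)
qed

lemma wave_high:
  assumes "2/3 \<le> t" "t \<le> 1" shows "wave t = 1"
proof -
  have "cos (pi / 3) \<le> cos (pi * (1 - t))"
    using assms by (intro cos_monotone_0_pi_le) auto
  also have "cos (pi * (1 - t)) = - cos (pi * t)" by (simp add: right_diff_distrib cos_diff)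
  finally show ?thesis by (simp add: wave_def cos_60)
qed

lemma summable_half: "summable (\<lambda>k. (1/2::real) ^ Suc k)"
  by (rule summable_mult[of "\<lambda>k. (1/2::real) ^ k" "1/2", simplified power_Suc[symmetric]]) (simp add: summable_geometric)

lemma continuous_schoenberg: "continuous_on UNIV (schoenberg i)"
proof -
  have ul: "uniform_limit UNIV (\<lambda>n t. \<Sum>k<n. (1/2) ^ Suc k * wave (3 ^ (2 * k + i) * t)) (schoenberg i) sequentially"
    unfolding schoenberg_def[abs_def]
  proof (rule Weierstrass_m_test[where M="\<lambda>k. (1/2) ^ Suc k"])
    show "norm ((1/2) ^ Suc k * wave (3 ^ (2 * k + i) * t)) \<le> (1/2) ^ Suc k" for k t
      using wave_bounds[of "3 ^ (2 * k + i) * t"] by (simp add: abs_mult mult_left_le)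
  qed (rule summable_half)
  have ev: "\<forall>\<^sub>F n in sequentially. continuous_on UNIV (\<lambda>t. \<Sum>k<n. (1/2) ^ Suc k * wave (3 ^ (2 * k + i) * t))"
    by (intro always_eventually allI continuous_on_sum continuous_on_mult continuous_on_const
        continuous_on_compose2[OF continuous_wave]) (auto intro!: continuous_intros)
  show ?thesis by (rule uniform_limit_theorem[OF ev ul trivial_limit_sequentially])
qed

lemma schoenberg_bounds: "0 \<le> schoenberg i t" "schoenberg i t \<le> 1"
proof -
  have le: "(1/2) ^ Suc k * wave (3 ^ (2 * k + i) * t) \<le> (1/2) ^ Suc k" for k
    using wave_bounds[of "3 ^ (2 * k + i) * t"] by (simp add: mult_left_le)
  have s: "summable (\<lambda>k. (1/2) ^ Suc k * wave (3 ^ (2 * k + i) * t))"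
    by (rule summable_comparison_test'[OF summable_half, of 0])
       (use wave_bounds[of "3 ^ (2 * _ + i) * t"] in \<open>auto simp: abs_mult mult_left_le\<close>)
  show "0 \<le> schoenberg i t" unfolding schoenberg_def
    by (rule suminf_nonneg[OF s]) (use wave_bounds in simp)
  have "schoenberg i t \<le> (\<Sum>k. (1/2) ^ Suc k)" unfolding schoenberg_def
    by (rule suminf_le[OF le s summable_half])
  also have "\<dots> = 1" using power_half_series sums_unique by metis
  finally show "schoenberg i t \<le> 1" .
qed

definition cantor :: "(nat \<Rightarrow> bool) \<Rightarrow> real" where
  "cantor b = (\<Sum>k. 2 * of_bool (b k) * (1/3) ^ Suc k)"

lemma summable_cantor: "summable (\<lambda>k. 2 * of_bool (b k) * (1/3::real) ^ Suc k)"
proof (rule summable_comparison_test'[where N=0])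
  show "summable (\<lambda>k. 2 * (1/3::real) ^ Suc k)" by (simp add: summable_geometric)
qed auto

lemma cantor_bounds: "0 \<le> cantor b" "cantor b \<le> 1"
proof -
  show "0 \<le> cantor b" unfolding cantor_def by (rule suminf_nonneg[OF summable_cantor]) simp
  have "cantor b \<le> (\<Sum>k. 2/3 * (1/3) ^ k)" unfolding cantor_def
    by (rule suminf_le[OF _ summable_cantor]) (auto simp: summable_geometric)
  also have "\<dots> = 2/3 * (1 / (1 - 1/3))" by (subst suminf_mult) (auto simp: summable_geometric suminf_geometric)
  finally show "cantor b \<le> 1" by simp
qed

lemma cantor_shift: "3 * cantor b = 2 * of_bool (b 0) + cantor (\<lambda>k. b (Suc k))"
proof -
  have "cantor b = 2 * of_bool (b 0) * (1/3) ^ Suc 0 + (\<Sum>k. 2 * of_bool (b (Suc k)) * (1/3) ^ Suc (Suc k))"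
    unfolding cantor_def using suminf_split_head[OF summable_cantor[of b]] by simp
  also have "(\<Sum>k. 2 * of_bool (b (Suc k)) * (1/3::real) ^ Suc (Suc k)) = (\<Sum>k. (1/3) * (2 * of_bool (b (Suc k)) * (1/3) ^ Suc k))"
    by (simp add: mult_ac)
  also have "\<dots> = (1/3) * cantor (\<lambda>k. b (Suc k))"
    unfolding cantor_def by (rule suminf_mult[OF summable_cantor[of "\<lambda>k. b (Suc k)"]])
  finally show ?thesis by simp
qed

text \<open>The factor \<open>3 ^ m\<close> shifts the ternary digits. Those moved in front of the
  point form an even integer, as all digits are 0 or 2, and 2 is a period of
  \<open>wave\<close>.\<close>

lemma cantor_power: "\<exists>N::nat. 3 ^ m * cantor b = 2 * real N + cantor (\<lambda>k. b (k + m))"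
proof (induction m arbitrary: b)
  case 0
  show ?case by (intro exI[of _ 0]) simp
next
  case (Suc m)
  obtain N :: nat where N: "3 ^ m * cantor (\<lambda>k. b (Suc k)) = 2 * real N + cantor (\<lambda>k. b (Suc (k + m)))"
    using Suc[of "\<lambda>k. b (Suc k)"] by blast
  have "3 ^ Suc m * cantor b = 3 ^ m * (2 * of_bool (b 0) + cantor (\<lambda>k. b (Suc k)))"
    by (simp add: cantor_shift[symmetric])
  also have "\<dots> = 2 * real (3 ^ m * of_bool (b 0) + N) + cantor (\<lambda>k. b (k + Suc m))"
    using N by (simp add: distrib_left)
  finally show ?case by blast
qed

text \<open>The leading digit places a Cantor point in the first or the last third of [0, 1], where
  \<open>wave\<close> is 0 or 1.\<close>

lemma wave_cantor: "wave (3 ^ m * cantor b) = of_bool (b m)"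
proof -
  obtain N :: nat where N: "3 ^ m * cantor b = 2 * real N + cantor (\<lambda>k. b (k + m))" using cantor_power by blast
  let ?c = "cantor (\<lambda>k. b (k + m))" and ?d = "cantor (\<lambda>k. b (Suc k + m))"
  have c: "3 * ?c = 2 * of_bool (b m) + ?d" using cantor_shift[of "\<lambda>k. b (k + m)"] by simp
  have d: "0 \<le> ?d" "?d \<le> 1" by (rule cantor_bounds)+
  have "wave ?c = of_bool (b m)"
  proof (cases "b m")
    case True
    then show ?thesis using wave_high[of ?c] c d by simp
  next
    case False
    then show ?thesis using wave_low[of ?c] c d by simp
  qed
  then show ?thesis unfolding N wave_periodic .
qed

lemma binary_expansion:
  fixes x :: real assumes "0 \<le> x" "x \<le> 1"
  shows "\<exists>b. x = (\<Sum>k. (1/2) ^ Suc k * of_bool (b k))"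
proof -
  \<comment> \<open>Greedy binary expansion: \<open>y n\<close> is the remainder scaled by
    \<open>2 ^ n\<close>, and digit \<open>n\<close> is 1 when it reaches 1/2.\<close>
  define y where "y = rec_nat x (\<lambda>_ y. 2 * y - of_bool (y \<ge> 1/2))"
  define b where "b = (\<lambda>n. y n \<ge> 1/2)"
  have y0: "y 0 = x" and ys: "y (Suc n) = 2 * y n - of_bool (b n)" for n by (simp_all add: y_def b_def)
  have yb: "0 \<le> y n \<and> y n \<le> 1" for n
    by (induction n) (use assms y0 ys in \<open>auto simp: b_def\<close>)
  have part: "(\<Sum>k<n. (1/2) ^ Suc k * of_bool (b k)) = x - (1/2) ^ n * y n" for n
  proof (induction n)
    case 0 show ?case by (simp add: y0)
  next
    case (Suc n)
    then show ?case by (simp add: ys algebra_simps diff_divide_distrib)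
  qed
  have "(\<lambda>n. (1/2) ^ n * y n) \<longlonglongrightarrow> 0"
  proof (rule Lim_null_comparison)
    show "\<forall>\<^sub>F n in sequentially. norm ((1/2) ^ n * y n) \<le> (1/2) ^ n"
      using yb by (intro always_eventually) (auto simp: abs_mult mult_left_le)
    show "(\<lambda>n. (1/2::real) ^ n) \<longlonglongrightarrow> 0" by (rule LIMSEQ_realpow_zero) auto
  qed
  then have "(\<lambda>n. x - (1/2) ^ n * y n) \<longlonglongrightarrow> x - 0" by (intro tendsto_diff tendsto_const)
  then have "(\<lambda>k. (1/2) ^ Suc k * of_bool (b k)) sums x" unfolding sums_def part by simp
  then show ?thesis using sums_unique by blast
qed

text \<open>The two binary expansions are interleaved as ternary digits; \<open>schoenberg 0\<close>
  reads the even positions, \<open>schoenberg 1\<close> the odd ones.\<close>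

lemma schoenberg_surj:
  assumes "0 \<le> x" "x \<le> 1" "0 \<le> y" "y \<le> 1"
  shows "\<exists>t\<in>{0..1}. schoenberg 0 t = x \<and> schoenberg 1 t = y"
proof -
  obtain b c where b: "x = (\<Sum>k. (1/2) ^ Suc k * of_bool (b k))" and c: "y = (\<Sum>k. (1/2) ^ Suc k * of_bool (c k))"
    using binary_expansion assms by meson
  define d where "d = (\<lambda>k. if even k then b (k div 2) else c (k div 2))"
  have "schoenberg 0 (cantor d) = x" unfolding schoenberg_def wave_cantor b by (simp add: d_def)
  moreover have "schoenberg 1 (cantor d) = y" unfolding schoenberg_def wave_cantor c by (simp add: d_def)
  ultimately show ?thesis using cantor_bounds[of d] by auto
qed

text \<open>The curve fills a square containing \<open>E\<close> and stays in it on the whole line,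
  which later makes kernels composed with it bounded.\<close>

lemma continuous_curve_onto:
  assumes "bounded E"
  obtains H :: "real \<Rightarrow> complex" and M where "continuous_on UNIV H" "\<And>t. cmod (H t) \<le> M"
    "\<And>a. a \<in> E \<Longrightarrow> \<exists>t\<in>{0..1}. H t = a"
proof -
  obtain B where B: "B > 0" "\<And>z. z \<in> E \<Longrightarrow> cmod z \<le> B" using assms bounded_pos by blast
  define H where "H = (\<lambda>t. Complex (2 * B * schoenberg 0 t - B) (2 * B * schoenberg 1 t - B))"
  have c: "continuous_on UNIV H"
    unfolding H_def by (intro continuous_intros continuous_schoenberg)
  have "cmod (H t) \<le> 2 * B" for t
  proof -
    have "\<bar>2 * B * schoenberg i t - B\<bar> \<le> B" for i
    proof -
      have "2 * B * schoenberg i t \<le> 2 * B * 1" "0 \<le> 2 * B * schoenberg i t"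
        using schoenberg_bounds B(1) by (auto intro!: mult_left_mono)
      then show ?thesis by (simp add: abs_le_iff)
    qed
    then show ?thesis using cmod_le[of "H t"] unfolding H_def by (smt (verit) complex.sel)
  qed
  moreover have "\<exists>t\<in>{0..1}. H t = a" if "a \<in> E" for a
  proof -
    have "\<bar>Re a\<bar> \<le> B" "\<bar>Im a\<bar> \<le> B" using B(2)[OF that] abs_Re_le_cmod[of a] abs_Im_le_cmod[of a] by linarith+
    then obtain t where "t \<in> {0..1}" "schoenberg 0 t = (Re a + B) / (2 * B)" "schoenberg 1 t = (Im a + B) / (2 * B)"
      using schoenberg_surj[of "(Re a + B) / (2 * B)" "(Im a + B) / (2 * B)"] B(1) by (auto simp: divide_le_eq abs_le_iff)
    then show ?thesis using B(1) by (intro bexI[of _ t]) (auto simp: H_def complex_eq_iff)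
  qed
  ultimately show ?thesis using c that by blast
qed

section \<open>Mollified energies of discrete measures\<close>

definition log_kernel :: "real \<Rightarrow> complex \<Rightarrow> real" where
  "log_kernel s z = - (1/2) * ln ((cmod z)\<^sup>2 + s\<^sup>2)"

definition weights :: "complex set \<Rightarrow> complex set \<Rightarrow> (complex \<Rightarrow> real) \<Rightarrow> bool" where
  "weights E N w \<longleftrightarrow> finite N \<and> N \<subseteq> E \<and> (\<forall>a\<in>N. w a \<ge> 0) \<and> sum w N = 1"

text \<open>Diagonal terms are kept: for s > 0 the mollified kernel has the finite value -ln s at 0,
  so point masses have finite energy, unlike under \<open>log_energy\<close>.\<close>

definition discrete_energy :: "real \<Rightarrow> complex set \<Rightarrow> (complex \<Rightarrow> real) \<Rightarrow> real" where
  "discrete_energy s N w = (\<Sum>a\<in>N. \<Sum>b\<in>N. w a * w b * log_kernel s (a - b))"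

lemma log_kernel_mono: "0 < s \<Longrightarrow> s \<le> t \<Longrightarrow> log_kernel t z \<le> log_kernel s z"
  unfolding log_kernel_def by (simp add: add_nonneg_pos power_mono)

lemma continuous_log_kernel: "s > 0 \<Longrightarrow> continuous_on UNIV (log_kernel s)"
  unfolding log_kernel_def[abs_def]
  by (intro continuous_intros) (metis add_nonneg_pos less_irrefl zero_le_power2 zero_less_power)

lemma borel_measurable_log_kernel [measurable]: "log_kernel s \<in> borel_measurable borel"
  unfolding log_kernel_def[abs_def] by measurable

lemma log_kernel_bounded:
  assumes "s > 0" obtains C where "\<And>z. cmod z \<le> M \<Longrightarrow> \<bar>log_kernel s z\<bar> \<le> C"
proof -
  have "compact (log_kernel s ` cball 0 M)"
    by (rule compact_continuous_image[OF continuous_on_subset[OF continuous_log_kernel[OF assms]]]) auto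
  then obtain C where "\<And>x. x \<in> log_kernel s ` cball 0 M \<Longrightarrow> norm x \<le> C"
    using compact_imp_bounded bounded_iff by metis
  then show ?thesis using that[of C] by force
qed

text \<open>Compactness of discrete measures on \<open>E\<close>, transported to the line by a space-filling curve where
  Helly's theorem applies; the limit comes as a random variable by Skorohod's theorem.\<close>
lemma discrete_measures_limit:
  assumes E: "compact E" and w: "\<And>n. weights E (N n) (w n)"
  obtains P :: "real measure" and Z and r :: "nat \<Rightarrow> nat" and M where
    "prob_space P" "Z \<in> borel_measurable P" "strict_mono r" "\<And>x. cmod (Z x) \<le> M" "AE x in P. Z x \<in> E"
    "\<And>k. continuous_on UNIV k \<Longrightarrow>
       (\<lambda>n. \<Sum>a\<in>N (r n). \<Sum>b\<in>N (r n). w (r n) a * w (r n) b * k (a - b)) \<longlonglongrightarrow> (\<integral>x. (\<integral>y. (k (Z x - Z y) :: real) \<partial>P) \<partial>P)"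
proof -
  obtain H M where H: "continuous_on UNIV H" "\<And>t. cmod (H t) \<le> M" "\<And>a. a \<in> E \<Longrightarrow> \<exists>t\<in>{0..1::real}. H t = a"
    by (rule continuous_curve_onto[OF compact_imp_bounded[OF E]]) blast
  have HE: "closed (H -` E)" by (rule closed_vimage[OF compact_imp_closed[OF E] H(1)])
  \<comment> \<open>A right inverse of the curve on \<open>E\<close>, chosen without regularity: it
    is applied to point measures, for which every function is measurable.\<close>
  define \<tau> where "\<tau> = (\<lambda>a. SOME t. t \<in> {0..1} \<and> H t = a)"
  have \<tau>: "\<tau> a \<in> {0..1}" "H (\<tau> a) = a" if "a \<in> E" for a
    using someI_ex[of "\<lambda>t. t \<in> {0..1} \<and> H t = a"] H(3)[OF that] unfolding \<tau>_def by blast+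
  define p where "p = (\<lambda>n. point_measure (N n) (\<lambda>a. ennreal (w n a)))"
  define \<nu> where "\<nu> = (\<lambda>n. distr (p n) borel \<tau>)"
  have N: "finite (N n)" "N n \<subseteq> E" "\<And>a. a \<in> N n \<Longrightarrow> w n a \<ge> 0" "sum (w n) (N n) = 1" for n
    using w[of n] by (auto simp: weights_def)
  have \<tau>N: "H (\<tau> a) = a" if "a \<in> N n" for a n
    using \<tau>(2) N(2) that by blast
  have pp: "prob_space (p n)" for n
  proof (rule prob_spaceI)
    show "emeasure (p n) (space (p n)) = 1"
      using N(1,4)[of n] sum_ennreal[of "N n" "w n", OF N(3)]
      by (simp add: p_def space_point_measure emeasure_point_measure_finite)
  qed
  have tm: "\<tau> \<in> measurable (p n) borel" for n
    by (simp add: p_def)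
  have rd: "real_distribution (\<nu> n)" for n
    unfolding \<nu>_def by (rule prob_space.real_distribution_distr[OF pp tm])
  have int: "(\<integral>t. g t \<partial>\<nu> n) = (\<Sum>a\<in>N n. w n a * g (\<tau> a))" if "g \<in> borel_measurable borel" for g :: "real \<Rightarrow> real" and n
  proof -
    have "(\<integral>t. g t \<partial>\<nu> n) = (\<integral>a. g (\<tau> a) \<partial>p n)"
      unfolding \<nu>_def by (rule integral_distr[OF tm that])
    also have "\<dots> = (\<Sum>a\<in>N n. w n a * g (\<tau> a))"
      unfolding p_def by (subst lebesgue_integral_point_measure_finite) (auto simp: N)
    finally show ?thesis .
  qed
  have supp: "AE t in \<nu> n. t \<in> {0..1} \<and> H t \<in> E" for n
  proof -
    have "AE a in p n. \<tau> a \<in> {0..1} \<and> H (\<tau> a) \<in> E"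
    proof (intro AE_I2)
      fix a assume "a \<in> space (p n)"
      then have a: "a \<in> E" using N(2)[of n] by (auto simp: p_def space_point_measure)
      then have "H (\<tau> a) \<in> E" by (simp add: \<tau>(2))
      with \<tau>(1)[OF a] show "\<tau> a \<in> {0..1} \<and> H (\<tau> a) \<in> E" by blast
    qed
    moreover have "{t. t \<in> {0..1} \<and> H t \<in> E} \<in> sets borel"
    proof -
      have "{t. t \<in> {0..1} \<and> H t \<in> E} = {0..1} \<inter> H -` E" by auto
      then show ?thesis by (simp only: borel_closed[OF closed_Int[OF closed_atLeastAtMost HE]])
    qed
    ultimately show ?thesis unfolding \<nu>_def by (subst AE_distr_iff[OF tm]) auto
  qed
  \<comment> \<open>All parameter measures live on [0, 1], so no mass escapes.\<close>
  have "tight \<nu>"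
    unfolding tight_def
  proof (intro conjI allI impI rd)
    fix e :: real assume "e > 0"
    have "measure (\<nu> n) {-1<..1} = 1" for n
    proof -
      interpret real_distribution "\<nu> n" by (rule rd)
      have "AE t in \<nu> n. t \<in> {-1<..1}" using supp[of n] by eventually_elim auto
      then show ?thesis by (subst prob_eq_1) auto
    qed
    then show "\<exists>a b. a < b \<and> (\<forall>n. 1 - e < measure (\<nu> n) {a<..b})"
      using \<open>e > 0\<close> by (intro exI[of _ "-1"] exI[of _ 1]) auto
  qed
  then obtain r D where r: "strict_mono (r :: nat \<Rightarrow> nat)" and D: "real_distribution D" "weak_conv_m (\<nu> \<circ> id \<circ> r) D"
    using tight_imp_convergent_subsubsequence[of \<nu> id] strict_mono_id by blast
  have rd': "real_distribution ((\<nu> \<circ> id \<circ> r) n)" for n using rd by simp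
  obtain P :: "real measure" and Yn :: "nat \<Rightarrow> real \<Rightarrow> real" and Y :: "real \<Rightarrow> real" where
    sk: "prob_space P \<and> (\<forall>n. Yn n \<in> measurable P borel) \<and> (\<forall>n. distr P borel (Yn n) = (\<nu> \<circ> id \<circ> r) n) \<and>
      Y \<in> measurable P lborel \<and> distr P borel Y = D \<and> (\<forall>x\<in>space P. (\<lambda>n. Yn n x) \<longlonglongrightarrow> Y x)"
    using Skorohod[OF rd' D] by (elim exE) (rule that)
  have P: "prob_space P" and Yn [measurable]: "\<And>n. Yn n \<in> measurable P borel" and dYn: "\<And>n. distr P borel (Yn n) = \<nu> (r n)"
    and Y: "Y \<in> measurable P lborel" and lim: "\<And>x. x \<in> space P \<Longrightarrow> (\<lambda>n. Yn n x) \<longlonglongrightarrow> Y x"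
    using sk by simp_all
  have Y' [measurable]: "Y \<in> borel_measurable P" using Y by simp
  interpret P: prob_space P by (rule P)
  have Hm [measurable]: "H \<in> borel_measurable borel" using H(1) by (rule borel_measurable_continuous_onI)
  let ?Z = "\<lambda>x. H (Y x)"
  have Zlim: "(\<lambda>n. H (Yn n x)) \<longlonglongrightarrow> ?Z x" if "x \<in> space P" for x
    using continuous_on_tendsto_compose[OF H(1) lim[OF that]] by simp
  have "AE x in P. H (Yn n x) \<in> E" for n
  proof -
    have "AE t in distr P borel (Yn n). H t \<in> E" unfolding dYn using supp by eventually_elim auto
    moreover have "{t. H t \<in> E} \<in> sets borel"
      using borel_closed[OF HE] by (simp only: vimage_def)
    ultimately show ?thesis by (subst (asm) AE_distr_iff[OF Yn]) auto
  qed
  then have "AE x in P. \<forall>n. H (Yn n x) \<in> E" by (simp add: AE_all_countable)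
  then have ZE: "AE x in P. ?Z x \<in> E"
  proof (rule AE_mp, intro AE_I2 impI)
    fix x assume "x \<in> space P" "\<forall>n. H (Yn n x) \<in> E"
    then show "?Z x \<in> E" by (intro closed_sequentially[OF compact_imp_closed[OF E] _ Zlim]) auto
  qed
  have conv: "(\<lambda>n. \<Sum>a\<in>N (r n). \<Sum>b\<in>N (r n). w (r n) a * w (r n) b * k (a - b)) \<longlonglongrightarrow> (\<integral>x. (\<integral>y. k (?Z x - ?Z y) \<partial>P) \<partial>P)"
    if k: "continuous_on UNIV k" for k :: "complex \<Rightarrow> real"
  proof -
    have km [measurable]: "k \<in> borel_measurable borel" using k by (rule borel_measurable_continuous_onI)
    have "compact (k ` cball 0 (2 * M))"
      by (rule compact_continuous_image[OF continuous_on_subset[OF k]]) auto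
    then obtain C where C0: "\<And>x. x \<in> k ` cball 0 (2 * M) \<Longrightarrow> norm x \<le> C"
      using compact_imp_bounded bounded_iff by metis
    have C: "\<bar>k (H s - H t)\<bar> \<le> C" for s t
      unfolding real_norm_def[symmetric]
    proof (rule C0, rule imageI)
      show "H s - H t \<in> cball 0 (2 * M)" using norm_triangle_ineq4[of "H s" "H t"] H(2)[of s] H(2)[of t] by simp
    qed
    have inner: "(\<integral>y. k (H s - H (Yn n y)) \<partial>P) = (\<Sum>b\<in>N (r n). w (r n) b * k (H s - b))" for s n
    proof -
      have "(\<integral>y. k (H s - H (Yn n y)) \<partial>P) = (\<integral>t. k (H s - H t) \<partial>\<nu> (r n))"
        unfolding dYn[symmetric] by (rule integral_distr[symmetric]) auto
      also have "\<dots> = (\<Sum>b\<in>N (r n). w (r n) b * k (H s - H (\<tau> b)))" by (rule int) measurable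
      also have "\<dots> = (\<Sum>b\<in>N (r n). w (r n) b * k (H s - b))"
        by (intro sum.cong) (auto simp: \<tau>N)
      finally show ?thesis .
    qed
    have dbl: "(\<integral>x. (\<integral>y. k (H (Yn n x) - H (Yn n y)) \<partial>P) \<partial>P) = (\<Sum>a\<in>N (r n). \<Sum>b\<in>N (r n). w (r n) a * w (r n) b * k (a - b))" for n
    proof -
      have "(\<integral>x. (\<integral>y. k (H (Yn n x) - H (Yn n y)) \<partial>P) \<partial>P) = (\<integral>x. (\<lambda>s. \<Sum>b\<in>N (r n). w (r n) b * k (H s - b)) (Yn n x) \<partial>P)"
        unfolding inner ..
      also have "\<dots> = (\<integral>s. (\<Sum>b\<in>N (r n). w (r n) b * k (H s - b)) \<partial>\<nu> (r n))"
        unfolding dYn[symmetric] by (rule integral_distr[symmetric]) auto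
      also have "\<dots> = (\<Sum>a\<in>N (r n). w (r n) a * (\<Sum>b\<in>N (r n). w (r n) b * k (H (\<tau> a) - b)))" by (rule int) measurable
      also have "\<dots> = (\<Sum>a\<in>N (r n). \<Sum>b\<in>N (r n). w (r n) a * w (r n) b * k (a - b))"
        by (intro sum.cong) (auto simp: \<tau>N sum_distrib_left mult.assoc)
      finally show ?thesis .
    qed
    have kt: "(\<lambda>n. k (f n)) \<longlonglongrightarrow> k l" if "f \<longlonglongrightarrow> l" for f l
      using continuous_on_tendsto_compose[OF k that] by simp
    \<comment> \<open>Skorohod's variables converge pointwise on one probability space, so dominated
      convergence applies to the inner and to the outer integral, with the constant \<open>C\<close>
      as majorant.\<close>
    have "(\<lambda>n. (\<integral>x. (\<integral>y. k (H (Yn n x) - H (Yn n y)) \<partial>P) \<partial>P)) \<longlonglongrightarrow> (\<integral>x. (\<integral>y. k (?Z x - ?Z y) \<partial>P) \<partial>P)"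
    proof (rule integral_dominated_convergence[where w="\<lambda>x. C"])
      show "AE x in P. norm (\<integral>y. k (H (Yn n x) - H (Yn n y)) \<partial>P) \<le> C" for n
      proof (intro AE_I2)
        fix x
        have "norm (\<integral>y. k (H (Yn n x) - H (Yn n y)) \<partial>P) \<le> (\<integral>y. C \<partial>P)"
          by (rule Bochner_Integration.integral_norm_bound_integral) (auto intro!: C P.integrable_const_bound[where B=C])
        then show "norm (\<integral>y. k (H (Yn n x) - H (Yn n y)) \<partial>P) \<le> C" by (simp add: P.prob_space)
      qed
      show "AE x in P. (\<lambda>n. \<integral>y. k (H (Yn n x) - H (Yn n y)) \<partial>P) \<longlonglongrightarrow> (\<integral>y. k (?Z x - ?Z y) \<partial>P)"
      proof (intro AE_I2)
        fix x assume x: "x \<in> space P"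
        show "(\<lambda>n. \<integral>y. k (H (Yn n x) - H (Yn n y)) \<partial>P) \<longlonglongrightarrow> (\<integral>y. k (?Z x - ?Z y) \<partial>P)"
          by (rule integral_dominated_convergence[where w="\<lambda>x. C"])
             (auto intro!: AE_I2 C kt tendsto_diff Zlim x)
      qed
    qed (auto intro!: P.borel_measurable_lebesgue_integral)
    then show ?thesis unfolding dbl .
  qed
  have Zm: "?Z \<in> borel_measurable P" by measurable
  show ?thesis
    by (rule that[of P ?Z r M, OF P Zm r H(2) ZE conv])
qed

text \<open>Compares the negative part of the mollified kernel with the true one, up to an error
  that vanishes with s. A bound on the mollified energy thereby controls the positive part, to which
  Fatou's lemma applies.\<close>

lemma log_kernel_neg_part:
  "max 0 (- log_kernel s z) \<le> max 0 (ln (cmod z)) + s\<^sup>2 / 2"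
proof (cases "cmod z \<ge> 1")
  case True
  have "ln ((cmod z)\<^sup>2 + s\<^sup>2) \<le> ln ((cmod z)\<^sup>2 * (1 + s\<^sup>2))"
  proof (subst ln_le_cancel_iff)
    have "1 * s\<^sup>2 \<le> (cmod z)\<^sup>2 * s\<^sup>2" using True by (intro mult_right_mono) (auto intro: one_le_power)
    then show "(cmod z)\<^sup>2 + s\<^sup>2 \<le> (cmod z)\<^sup>2 * (1 + s\<^sup>2)" by (simp add: distrib_left)
    show "0 < (cmod z)\<^sup>2 + s\<^sup>2" using True by (intro add_pos_nonneg) auto
    show "0 < (cmod z)\<^sup>2 * (1 + s\<^sup>2)" using True by (intro mult_pos_pos add_pos_nonneg) auto
  qed
  also have "\<dots> = 2 * ln (cmod z) + ln (1 + s\<^sup>2)"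
  proof -
    have "1 + s\<^sup>2 > 0" by (intro add_pos_nonneg) auto
    then show ?thesis using True by (subst ln_mult) (auto simp: ln_realpow)
  qed
  also have "ln (1 + s\<^sup>2) \<le> s\<^sup>2" by (rule ln_add_one_self_le_self) simp
  finally show ?thesis using True by (simp add: log_kernel_def)
next
  case False
  have "ln ((cmod z)\<^sup>2 + s\<^sup>2) \<le> s\<^sup>2"
  proof (cases "(cmod z)\<^sup>2 + s\<^sup>2 > 0")
    case True
    have "ln ((cmod z)\<^sup>2 + s\<^sup>2) \<le> ln (1 + s\<^sup>2)"
      using False True by (subst ln_le_cancel_iff) (auto intro: add_pos_nonneg power_le_one)
    also have "\<dots> \<le> s\<^sup>2" by (rule ln_add_one_self_le_self) simp
    finally show ?thesis .
  next
    case False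
    moreover have "(cmod z)\<^sup>2 + s\<^sup>2 \<ge> 0" by simp
    ultimately have "(cmod z)\<^sup>2 + s\<^sup>2 = 0" by linarith
    then show ?thesis by simp
  qed
  then show ?thesis by (simp add: log_kernel_def)
qed

lemma log_kernel_tendsto:
  assumes "z \<noteq> 0"
  shows "(\<lambda>n. log_kernel (1 / real (Suc n)) z) \<longlonglongrightarrow> - ln (cmod z)"
proof -
  have "(\<lambda>n. (cmod z)\<^sup>2 + (inverse (real (Suc n)))\<^sup>2) \<longlonglongrightarrow> (cmod z)\<^sup>2 + 0\<^sup>2"
    by (intro tendsto_add tendsto_const tendsto_power LIMSEQ_inverse_real_of_nat)
  then have "(\<lambda>n. - (1/2) * ln ((cmod z)\<^sup>2 + (inverse (real (Suc n)))\<^sup>2)) \<longlonglongrightarrow> - (1/2) * ln ((cmod z)\<^sup>2 + 0\<^sup>2)"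
    using assms by (intro tendsto_mult tendsto_const tendsto_ln) auto
  then show ?thesis using assms by (simp add: log_kernel_def ln_realpow inverse_eq_divide)
qed

text \<open>On the diagonal the kernel is ln (n + 1), which grows to the value infinity prescribed
  by \<open>log_energy\<close>.\<close>

lemma log_kernel_zero_liminf:
  "liminf (\<lambda>n. ennreal (max 0 (log_kernel (1 / real (Suc n)) 0))) = \<infinity>"
proof -
  have "filterlim (\<lambda>n. ln (real (Suc n))) at_top sequentially"
    by (rule filterlim_compose[OF ln_at_top filterlim_compose[OF filterlim_real_sequentially filterlim_Suc]])
  moreover have "ln (real (Suc n)) = log_kernel (1 / real (Suc n)) 0" for n
    by (simp add: log_kernel_def ln_div ln_realpow power_divide)
  ultimately have "filterlim (\<lambda>n. log_kernel (1 / real (Suc n)) 0) at_top sequentially" by simp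
  then have "((\<lambda>n. ennreal (log_kernel (1 / real (Suc n)) 0)) \<longlongrightarrow> \<infinity>) sequentially"
    by (simp add: ennreal_tendsto_top_eq_at_top)
  moreover have "ennreal (max 0 x) = ennreal x" for x :: real by (simp add: max_def ennreal_neg)
  ultimately show ?thesis by (simp add: lim_imp_Liminf)
qed

text \<open>Two limits in this order: at fixed s the kernel is continuous and lies below all finer
  ones, so the bound \<open>L\<close> passes to the limit measure; then s tends to 0 by Fatou on the
  positive part, while the negative part stays bounded with the support.\<close>

lemma discrete_energy_limit:
  assumes E: "compact E" and w: "\<And>n. weights E (N n) (w n)"
    and L: "\<And>n. discrete_energy (1 / real (Suc n)) (N n) (w n) \<le> L"
  shows "robin_const E \<le> ereal L"
proof -
  obtain P :: "real measure" and Z and r :: "nat \<Rightarrow> nat" and M where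
    P: "prob_space P" and Zm [measurable]: "Z \<in> borel_measurable P" and r: "strict_mono r"
    and M: "\<And>x. cmod (Z x) \<le> M" and ZE: "AE x in P. Z x \<in> E"
    and conv: "\<And>k. continuous_on UNIV k \<Longrightarrow>
       (\<lambda>n. \<Sum>a\<in>N (r n). \<Sum>b\<in>N (r n). w (r n) a * w (r n) b * k (a - b)) \<longlonglongrightarrow> (\<integral>x. (\<integral>y. (k (Z x - Z y) :: real) \<partial>P) \<partial>P)"
    by (rule discrete_measures_limit[where N=N and w=w, OF E w]) (rule that)
  interpret P: prob_space P by (rule P)
  interpret PP: pair_prob_space P P ..
  have d: "Z x - Z y \<in> cball 0 (2 * M)" for x y
    using norm_triangle_ineq4[of "Z x" "Z y"] M[of x] M[of y] by simp
  define T where "T = P \<Otimes>\<^sub>M P"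
  interpret T: prob_space T unfolding T_def by (rule PP.prob_space_axioms)
  have Dm [measurable]: "(\<lambda>(x, y). Z x - Z y) \<in> borel_measurable T" unfolding T_def by measurable
  have bint: "integrable T (\<lambda>(x, y). f (Z x - Z y))" if "f \<in> borel_measurable borel" "\<And>z. cmod z \<le> 2 * M \<Longrightarrow> \<bar>f z\<bar> \<le> C" for f :: "complex \<Rightarrow> real" and C
  proof (rule T.integrable_const_bound[where B=C])
    show "AE p in T. norm (case p of (x, y) \<Rightarrow> f (Z x - Z y)) \<le> C"
      using that(2) d by (intro AE_I2) (auto simp: split_beta')
    show "(\<lambda>(x, y). f (Z x - Z y)) \<in> borel_measurable T"
      using measurable_compose[OF Dm that(1)] by (simp add: split_beta')
  qed
  let ?neg = "\<lambda>z::complex. max 0 (ln (cmod z))"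
  have negb: "\<bar>?neg z\<bar> \<le> max 0 (ln (2 * M))" if "cmod z \<le> 2 * M" for z
  proof (cases "z = 0")
    case False
    then have "0 < cmod z" "0 < 2 * M" using that zero_less_norm_iff[of z] by linarith+
    then have "ln (cmod z) \<le> ln (2 * M)" using that by (subst ln_le_cancel_iff)
    then show ?thesis by auto
  qed simp
  have negm: "?neg \<in> borel_measurable borel" by measurable
  define N0 where "N0 = (\<integral>p. (\<lambda>(x, y). ?neg (Z x - Z y)) p \<partial>T)"
  have kb: "\<exists>C. \<forall>z. cmod z \<le> 2 * M \<longrightarrow> \<bar>log_kernel s z\<bar> \<le> C" if "s > 0" for s
    using log_kernel_bounded[OF that, of "2 * M"] by metis
  have le_L: "(\<integral>p. (\<lambda>(x, y). log_kernel s (Z x - Z y)) p \<partial>T) \<le> L" if s: "s > 0" for s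
  proof -
    obtain C where C: "\<And>z. cmod z \<le> 2 * M \<Longrightarrow> \<bar>log_kernel s z\<bar> \<le> C" using kb[OF s] by blast
    have "(\<integral>p. (\<lambda>(x, y). log_kernel s (Z x - Z y)) p \<partial>T) = (\<integral>x. (\<integral>y. log_kernel s (Z x - Z y) \<partial>P) \<partial>P)"
      using PP.integral_fst'[OF bint[OF borel_measurable_log_kernel C, unfolded T_def]] by (simp add: T_def)
    also have "\<dots> \<le> L"
    proof (rule LIMSEQ_le_const2[OF conv[OF continuous_log_kernel[OF s]]])
      \<comment> \<open>From \<open>n0\<close> on the scale of the discrete energy is finer than
        \<open>s\<close>, because \<open>r n\<close> is at least \<open>n\<close>.\<close>
      obtain n0 where n0: "1 / real (Suc n0) < s" using nat_approx_posE[OF s] by blast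
      have "(\<Sum>a\<in>N (r n). \<Sum>b\<in>N (r n). w (r n) a * w (r n) b * log_kernel s (a - b)) \<le> L" if "n \<ge> n0" for n
      proof -
        have "n0 \<le> r n" using that seq_suble[OF r, of n] by linarith
        then have "1 / real (Suc (r n)) \<le> 1 / real (Suc n0)" by (intro divide_left_mono) auto
        then have k: "log_kernel s z \<le> log_kernel (1 / real (Suc (r n))) z" for z
          using n0 by (intro log_kernel_mono) auto
        have "(\<Sum>a\<in>N (r n). \<Sum>b\<in>N (r n). w (r n) a * w (r n) b * log_kernel s (a - b)) \<le> discrete_energy (1 / real (Suc (r n))) (N (r n)) (w (r n))"
          unfolding discrete_energy_def
          using w[of "r n"] by (intro sum_mono mult_left_mono k) (auto simp: weights_def)
        then show ?thesis using L[of "r n"] by linarith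
      qed
      then show "\<exists>N'. \<forall>n\<ge>N'. (\<Sum>a\<in>N (r n). \<Sum>b\<in>N (r n). w (r n) a * w (r n) b * log_kernel s (a - b)) \<le> L" by blast
    qed
    finally show ?thesis .
  qed
  have pos_le: "(\<integral>\<^sup>+p. (\<lambda>(x, y). ennreal (max 0 (log_kernel s (Z x - Z y)))) p \<partial>T) \<le> ennreal (L + N0 + s\<^sup>2 / 2)" if s: "s > 0" for s
  proof -
    obtain C where C: "\<And>z. cmod z \<le> 2 * M \<Longrightarrow> \<bar>log_kernel s z\<bar> \<le> C" using kb[OF s] by blast
    have i1: "integrable T (\<lambda>(x, y). log_kernel s (Z x - Z y))" by (rule bint[OF borel_measurable_log_kernel C])
    have i2: "integrable T (\<lambda>(x, y). ?neg (Z x - Z y))" by (rule bint[OF negm negb])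
    have ip: "integrable T (\<lambda>(x, y). max 0 (log_kernel s (Z x - Z y)))"
      by (rule bint[of _ "\<bar>C\<bar>"]) (use C in \<open>force+\<close>)
    have "(\<integral>p. (\<lambda>(x, y). max 0 (log_kernel s (Z x - Z y))) p \<partial>T)
        \<le> (\<integral>p. (\<lambda>(x, y). log_kernel s (Z x - Z y)) p + (\<lambda>(x, y). ?neg (Z x - Z y)) p + s\<^sup>2 / 2 \<partial>T)"
    proof (rule integral_mono[OF ip])
      show "integrable T (\<lambda>p. (\<lambda>(x, y). log_kernel s (Z x - Z y)) p + (\<lambda>(x, y). ?neg (Z x - Z y)) p + s\<^sup>2 / 2)"
        using i1 i2 by simp
      show "(\<lambda>(x, y). max 0 (log_kernel s (Z x - Z y))) p \<le> (\<lambda>(x, y). log_kernel s (Z x - Z y)) p + (\<lambda>(x, y). ?neg (Z x - Z y)) p + s\<^sup>2 / 2" for p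
      proof (cases p)
        case (Pair x y)
        have "max 0 (log_kernel s (Z x - Z y)) = log_kernel s (Z x - Z y) + max 0 (- log_kernel s (Z x - Z y))" by (simp add: max_def)
        then show ?thesis using log_kernel_neg_part[of s "Z x - Z y"] Pair by simp
      qed
    qed
    also have "\<dots> = (\<integral>p. (\<lambda>(x, y). log_kernel s (Z x - Z y)) p \<partial>T) + N0 + s\<^sup>2 / 2"
      unfolding N0_def using i1 i2 by (simp add: T.prob_space)
    also have "\<dots> \<le> L + N0 + s\<^sup>2 / 2" using le_L[OF s] by simp
    finally have "(\<integral>p. (\<lambda>(x, y). max 0 (log_kernel s (Z x - Z y))) p \<partial>T) \<le> L + N0 + s\<^sup>2 / 2" .
    moreover have "(\<integral>\<^sup>+p. (\<lambda>(x, y). ennreal (max 0 (log_kernel s (Z x - Z y)))) p \<partial>T) = ennreal (\<integral>p. (\<lambda>(x, y). max 0 (log_kernel s (Z x - Z y))) p \<partial>T)"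
      using nn_integral_eq_integral[OF ip] by (simp add: split_beta')
    ultimately show ?thesis by (simp add: ennreal_leI)
  qed
  let ?pos = "\<lambda>z w :: complex. if z = w then \<infinity> else ennreal (max 0 (- ln (cmod (z - w))))"
  let ?ng = "\<lambda>z w :: complex. ennreal (if z = w then 0 else max 0 (ln (cmod (z - w))))"
  let ?K = "\<lambda>n (x, y). ennreal (max 0 (log_kernel (1 / real (Suc n)) (Z x - Z y)))"
  have Km: "?K n \<in> borel_measurable T" for n
    using measurable_compose[OF Dm borel_measurable_log_kernel, of "1 / real (Suc n)"] by (simp add: split_beta')
  have pos_lim: "?pos (Z x) (Z y) \<le> liminf (\<lambda>n. ?K n (x, y))" for x y
  proof (cases "Z x = Z y")
    case True
    then show ?thesis using log_kernel_zero_liminf by simp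
  next
    case False
    then have "Z x - Z y \<noteq> 0" by simp
    from tendsto_ennrealI[OF tendsto_max[OF tendsto_const log_kernel_tendsto[OF this]]]
    have "(\<lambda>n. ?K n (x, y)) \<longlonglongrightarrow> ennreal (max 0 (- ln (cmod (Z x - Z y))))"
      by (simp only: prod.case)
    then show ?thesis using False by (simp add: lim_imp_Liminf)
  qed
  have "(\<integral>\<^sup>+p. (\<lambda>(x, y). ?pos (Z x) (Z y)) p \<partial>T) \<le> (\<integral>\<^sup>+p. liminf (\<lambda>n. ?K n p) \<partial>T)"
    by (rule nn_integral_mono) (use pos_lim in \<open>auto simp: split_beta'\<close>)
  also have "\<dots> \<le> liminf (\<lambda>n. \<integral>\<^sup>+p. ?K n p \<partial>T)" by (rule nn_integral_liminf[OF Km])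
  also have "\<dots> \<le> liminf (\<lambda>n. ennreal (L + N0 + (1 / real (Suc n))\<^sup>2 / 2))"
    by (intro Liminf_mono always_eventually allI pos_le) simp
  also have "\<dots> = ennreal (L + N0)"
  proof -
    have "(\<lambda>n. L + N0 + (inverse (real (Suc n)))\<^sup>2 / 2) \<longlonglongrightarrow> L + N0 + 0\<^sup>2 / 2"
      by (intro tendsto_add tendsto_const tendsto_divide tendsto_power LIMSEQ_inverse_real_of_nat) auto
    then have "(\<lambda>n. ennreal (L + N0 + (1 / real (Suc n))\<^sup>2 / 2)) \<longlonglongrightarrow> ennreal (L + N0)"
      by (intro tendsto_ennrealI) (simp add: inverse_eq_divide)
    then show ?thesis by (simp add: lim_imp_Liminf)
  qed
  finally have posT: "(\<integral>\<^sup>+p. (\<lambda>(x, y). ?pos (Z x) (Z y)) p \<partial>T) \<le> ennreal (L + N0)" .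
  \<comment> \<open>\<open>ennreal\<close> sends negative reals to 0, so subtracting
    \<open>N0\<close> from \<open>ennreal (L + N0)\<close> returns \<open>L\<close> only once this
    sign is known.\<close>
  have LN: "L + N0 \<ge> 0"
  proof (rule LIMSEQ_le_const)
    show "(\<lambda>n. L + N0 + (inverse (real (Suc n)))\<^sup>2 / 2) \<longlonglongrightarrow> L + N0"
      using tendsto_add[OF tendsto_const[of "L + N0"] tendsto_divide[OF tendsto_power[OF LIMSEQ_inverse_real_of_nat, of 2] tendsto_const[of 2]]] by simp
    show "\<exists>n0. \<forall>n\<ge>n0. 0 \<le> L + N0 + (inverse (real (Suc n)))\<^sup>2 / 2"
    proof (intro exI allI impI)
      fix n
      let ?s = "inverse (real (Suc n))"
      have s: "?s > 0" by simp
      obtain C where C: "\<And>z. cmod z \<le> 2 * M \<Longrightarrow> \<bar>log_kernel ?s z\<bar> \<le> C" using kb[OF s] by blast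
      have i1: "integrable T (\<lambda>(x, y). log_kernel ?s (Z x - Z y))" by (rule bint[OF borel_measurable_log_kernel C])
      have i2: "integrable T (\<lambda>(x, y). ?neg (Z x - Z y))" by (rule bint[OF negm negb])
      have "0 \<le> (\<integral>p. (\<lambda>(x, y). log_kernel ?s (Z x - Z y)) p + (\<lambda>(x, y). ?neg (Z x - Z y)) p + ?s\<^sup>2 / 2 \<partial>T)"
      proof (rule Bochner_Integration.integral_nonneg)
        show "0 \<le> (\<lambda>(x, y). log_kernel ?s (Z x - Z y)) p + (\<lambda>(x, y). ?neg (Z x - Z y)) p + ?s\<^sup>2 / 2" for p
          using log_kernel_neg_part[of ?s "Z (fst p) - Z (snd p)"] by (simp add: split_beta')
      qed
      also have "\<dots> = (\<integral>p. (\<lambda>(x, y). log_kernel ?s (Z x - Z y)) p \<partial>T) + N0 + ?s\<^sup>2 / 2"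
        unfolding N0_def using i1 i2 by (simp add: T.prob_space)
      finally show "0 \<le> L + N0 + ?s\<^sup>2 / 2" using le_L[OF s] by linarith
    qed
  qed
  define \<mu> where "\<mu> = distr P borel Z"
  have mu: "sets \<mu> = sets borel \<and> emeasure \<mu> UNIV = 1 \<and> emeasure \<mu> (- E) = 0"
  proof (intro conjI)
    show "sets \<mu> = sets borel" by (simp add: \<mu>_def)
    show "emeasure \<mu> UNIV = 1" unfolding \<mu>_def using emeasure_distr[OF Zm, of UNIV] P.emeasure_space_1 by simp
    have "- E \<in> sets borel" using E by (simp add: compact_imp_closed)
    then have "emeasure \<mu> (- E) = emeasure P (Z -` (- E) \<inter> space P)" unfolding \<mu>_def by (rule emeasure_distr[OF Zm])
    also have "\<dots> = 0"
    proof -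
      have "Z -` (- E) \<inter> space P \<in> sets P" using E by (intro measurable_sets[OF Zm]) (simp add: compact_imp_closed)
      moreover have "{x \<in> space P. \<not> Z x \<in> E} = Z -` (- E) \<inter> space P" by auto
      ultimately show ?thesis using ZE by (simp add: AE_iff_measurable[of "Z -` (- E) \<inter> space P"])
    qed
    finally show "emeasure \<mu> (- E) = 0" .
  qed
  have dbl: "(\<integral>\<^sup>+z. (\<integral>\<^sup>+w. f z w \<partial>\<mu>) \<partial>\<mu>) = (\<integral>\<^sup>+p. (\<lambda>(x, y). f (Z x) (Z y)) p \<partial>T)"
    if f [measurable]: "case_prod f \<in> borel_measurable (borel \<Otimes>\<^sub>M borel)" for f :: "complex \<Rightarrow> complex \<Rightarrow> ennreal"
  proof -
    have fm: "f z \<in> borel_measurable borel" for z using measurable_Pair2[OF f, of z] by simp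
    have in1: "(\<integral>\<^sup>+w. f z w \<partial>\<mu>) = (\<integral>\<^sup>+y. f z (Z y) \<partial>P)" for z
      unfolding \<mu>_def by (rule nn_integral_distr[OF Zm]) (simp add: fm)
    have "(\<integral>\<^sup>+z. (\<integral>\<^sup>+y. f z (Z y) \<partial>P) \<partial>\<mu>) = (\<integral>\<^sup>+x. (\<integral>\<^sup>+y. f (Z x) (Z y) \<partial>P) \<partial>P)"
      unfolding \<mu>_def by (rule nn_integral_distr[OF Zm]) measurable
    also have "\<dots> = (\<integral>\<^sup>+p. (\<lambda>(x, y). f (Z x) (Z y)) p \<partial>T)"
      unfolding T_def by (subst P.nn_integral_fst[symmetric]) auto
    finally show ?thesis unfolding in1 .
  qed
  have posm: "case_prod ?pos \<in> borel_measurable (borel \<Otimes>\<^sub>M borel)"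
    by measurable
  have ngm: "case_prod ?ng \<in> borel_measurable (borel \<Otimes>\<^sub>M borel)"
    by measurable
  have ngN: "(\<integral>\<^sup>+z. (\<integral>\<^sup>+w. ?ng z w \<partial>\<mu>) \<partial>\<mu>) = ennreal N0"
  proof -
    have "?ng z w = ennreal (?neg (z - w))" for z w by simp
    then have "(\<integral>\<^sup>+p. (\<lambda>(x, y). ?ng (Z x) (Z y)) p \<partial>T) = (\<integral>\<^sup>+p. ennreal ((\<lambda>(x, y). ?neg (Z x - Z y)) p) \<partial>T)"
      by (simp add: split_beta')
    also have "\<dots> = ennreal N0" unfolding N0_def
      by (rule nn_integral_eq_integral[OF bint[OF negm negb]]) (auto simp: split_beta')
    finally show ?thesis unfolding dbl[OF ngm] .
  qed
  have N00: "N0 \<ge> 0" unfolding N0_def by (rule Bochner_Integration.integral_nonneg) (auto simp: split_beta')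
  have "log_energy \<mu> \<le> ereal L"
  proof -
    have "log_energy \<mu> = enn2ereal (\<integral>\<^sup>+z. (\<integral>\<^sup>+w. ?pos z w \<partial>\<mu>) \<partial>\<mu>) - enn2ereal (ennreal N0)"
      unfolding log_energy_def ngN ..
    also have "\<dots> \<le> enn2ereal (ennreal (L + N0)) - enn2ereal (ennreal N0)"
      unfolding dbl[OF posm] by (intro ereal_minus_mono) (use posT in \<open>auto simp: less_eq_ennreal.rep_eq\<close>)
    also have "\<dots> = ereal L" using LN N00 by (simp add: enn2ereal_ennreal)
    finally show ?thesis .
  qed
  then show ?thesis unfolding robin_const_def using mu by (intro INF_lower2[of \<mu>]) auto
qed

text \<open>Violating measures at the scales 1/(n+1) would force the Robin constant down to
  \<open>L\<close>. One scale therefore serves all finitely supported measures on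
  \<open>E\<close>.\<close>

lemma discrete_energy_lower_bound:
  assumes "compact E" "robin_const E > ereal L"
  obtains s where "s > 0" "\<And>N w. weights E N w \<Longrightarrow> discrete_energy s N w > L"
proof -
  have "\<exists>n. \<forall>N w. weights E N w \<longrightarrow> discrete_energy (1 / real (Suc n)) N w > L"
  proof (rule ccontr)
    assume "\<nexists>n. \<forall>N w. weights E N w \<longrightarrow> discrete_energy (1 / real (Suc n)) N w > L"
    then have "\<forall>n. \<exists>N w. weights E N w \<and> discrete_energy (1 / real (Suc n)) N w \<le> L"
      by (meson not_le_imp_less)
    then obtain N w where "\<And>n. weights E (N n) (w n)" "\<And>n. discrete_energy (1 / real (Suc n)) (N n) (w n) \<le> L"
      by metis
    from discrete_energy_limit[OF assms(1) this] show False using assms(2) by (simp add: not_le)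
  qed
  then show ?thesis using that by (metis of_nat_0_less_iff zero_less_Suc zero_less_divide_1_iff)
qed

text \<open>Frostman's inequality in approximate form: moving a fraction t of the mass of a
  near-minimiser to the node \<open>a\<close> lowers the energy by less than t^2, and the
  first-order term compares the potential at \<open>a\<close> with the energy. The slack is the
  1/2.\<close>

lemma near_equilibrium_weights:
  fixes k :: "complex \<Rightarrow> complex \<Rightarrow> real"
  assumes N: "finite N" "N \<noteq> {}" and sym: "\<And>a b. k a b = k b a"
    and L: "\<And>w. (\<forall>a\<in>N. w a \<ge> 0) \<Longrightarrow> sum w N = 1 \<Longrightarrow> (\<Sum>a\<in>N. \<Sum>b\<in>N. w a * w b * k a b) > L"
  obtains w where "\<forall>a\<in>N. w a \<ge> 0" "sum w N = 1" "\<And>a. a \<in> N \<Longrightarrow> (\<Sum>b\<in>N. w b * k a b) \<ge> L - 1/2"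
proof -
  define B where "B = (\<lambda>f g. \<Sum>a\<in>N. \<Sum>b\<in>N. f a * g b * k a b)"
  define W where "W = {w. (\<forall>a\<in>N. w a \<ge> (0::real)) \<and> sum w N = 1}"
  define I where "I = Inf ((\<lambda>w. B w w) ` W)"
  define K where "K = (\<Sum>a\<in>N. \<Sum>b\<in>N. \<bar>k a b\<bar>)"
  have K0: "K \<ge> 0" unfolding K_def by (intro sum_nonneg) auto
  have kK: "\<bar>k a b\<bar> \<le> K" if "a \<in> N" "b \<in> N" for a b
  proof -
    have "\<bar>k a b\<bar> \<le> (\<Sum>b\<in>N. \<bar>k a b\<bar>)" by (rule member_le_sum) (use that N in auto)
    also have "\<dots> \<le> K" unfolding K_def
      by (rule member_le_sum[of a N "\<lambda>a. \<Sum>b\<in>N. \<bar>k a b\<bar>"]) (use that N in \<open>auto intro: sum_nonneg\<close>)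
    finally show ?thesis .
  qed
  obtain a0 where a0: "a0 \<in> N" using N by blast
  have "(\<lambda>a. of_bool (a = a0)) \<in> W" using a0 N by (auto simp: W_def of_bool_def)
  then have ne: "(\<lambda>w. B w w) ` W \<noteq> {}" by blast
  have bdd: "bdd_below ((\<lambda>w. B w w) ` W)"
    by (rule bdd_belowI[of _ L]) (use L in \<open>force simp: B_def W_def\<close>)
  have I_le: "I \<le> B w w" if "w \<in> W" for w
    unfolding I_def by (rule cInf_lower[OF _ bdd]) (use that in blast)
  \<comment> \<open>\<open>K\<close> bounds the kernel, the energy and the potentials at the nodes.
    After division by t the second-order terms are at most \<open>t * (1 + 4 * K)\<close>, which
    this choice makes equal to 1.\<close>
  define t where "t = 1 / (1 + 4 * K)"
  have t: "0 < t" "t \<le> 1" "t * (1 + 4 * K) = 1" using K0 by (auto simp: t_def)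
  have "I < I + t\<^sup>2" using t by simp
  then have "\<exists>x\<in>(\<lambda>w. B w w) ` W. x < I + t\<^sup>2" unfolding I_def by (rule cInf_lessD[OF ne])
  then obtain w where w: "w \<in> W" "B w w < I + t\<^sup>2" by blast
  have wN: "\<And>a. a \<in> N \<Longrightarrow> w a \<ge> 0" "sum w N = 1" using w(1) by (auto simp: W_def)
  have avg: "\<bar>\<Sum>b\<in>N. w b * f b\<bar> \<le> K" if "\<And>b. b \<in> N \<Longrightarrow> \<bar>f b\<bar> \<le> K" for f
  proof -
    have "\<bar>\<Sum>b\<in>N. w b * f b\<bar> \<le> (\<Sum>b\<in>N. \<bar>w b * f b\<bar>)" by (rule sum_abs)
    also have "\<dots> \<le> (\<Sum>b\<in>N. w b * K)" using that wN by (intro sum_mono) (auto simp: abs_mult intro: mult_left_mono)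
    also have "\<dots> = K" using wN by (simp add: sum_distrib_right[symmetric])
    finally show ?thesis .
  qed
  have Bww: "B w w = (\<Sum>a\<in>N. w a * (\<Sum>b\<in>N. w b * k a b))"
    by (simp add: B_def sum_distrib_left mult.assoc)
  have "(\<Sum>b\<in>N. w b * k a b) \<ge> L - 1/2" if a: "a \<in> N" for a
  proof -
    define p where "p = (\<Sum>b\<in>N. w b * k a b)"
    define w' where "w' = (\<lambda>x. (1 - t) * w x + t * of_bool (x = a))"
    have "w' \<in> W"
    proof -
      have "sum w' N = (1 - t) * sum w N + t * (\<Sum>x\<in>N. of_bool (x = a))"
        by (simp add: w'_def sum.distrib sum_distrib_left)
      also have "(\<Sum>x\<in>N. of_bool (x = a) :: real) = 1" using a N by (simp add: of_bool_def)
      finally show ?thesis using t wN by (auto simp: W_def w'_def)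
    qed
    have s1: "(\<Sum>x\<in>N. of_bool (x = a) * f x) = f a" for f :: "complex \<Rightarrow> real"
      using a N by (simp add: of_bool_def if_distrib[of "\<lambda>u. u * f _"] cong: if_cong)
    have inner: "(\<Sum>y\<in>N. w' y * k x y) = (1 - t) * (\<Sum>y\<in>N. w y * k x y) + t * k x a" for x
    proof -
      have "(\<Sum>y\<in>N. w' y * k x y) = (\<Sum>y\<in>N. (1 - t) * (w y * k x y) + t * (of_bool (y = a) * k x y))"
        by (rule sum.cong) (auto simp: w'_def algebra_simps)
      then show ?thesis by (simp only: sum.distrib sum_distrib_left[symmetric] s1)
    qed
    have "B w' w' = (\<Sum>x\<in>N. w' x * (\<Sum>y\<in>N. w' y * k x y))"
      by (simp add: B_def sum_distrib_left mult.assoc)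
    also have "\<dots> = (\<Sum>x\<in>N. (1 - t) * (w x * ((1 - t) * (\<Sum>y\<in>N. w y * k x y) + t * k x a))
        + t * (of_bool (x = a) * ((1 - t) * (\<Sum>y\<in>N. w y * k x y) + t * k x a)))"
      unfolding inner by (rule sum.cong) (auto simp: w'_def algebra_simps)
    also have "\<dots> = (1 - t) * (\<Sum>x\<in>N. w x * ((1 - t) * (\<Sum>y\<in>N. w y * k x y) + t * k x a))
        + t * ((1 - t) * p + t * k a a)"
      by (simp only: sum.distrib sum_distrib_left[symmetric] s1 p_def)
    also have "(\<Sum>x\<in>N. w x * ((1 - t) * (\<Sum>y\<in>N. w y * k x y) + t * k x a)) = (1 - t) * B w w + t * p"
    proof -
      have "(\<Sum>x\<in>N. w x * ((1 - t) * (\<Sum>y\<in>N. w y * k x y) + t * k x a))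
         = (\<Sum>x\<in>N. (1 - t) * (w x * (\<Sum>y\<in>N. w y * k x y)) + t * (w x * k a x))"
        by (rule sum.cong) (auto simp: algebra_simps sym[of _ a])
      then show ?thesis by (simp only: sum.distrib sum_distrib_left[symmetric] Bww p_def)
    qed
    finally have Bw': "B w' w' = (1 - t) * ((1 - t) * B w w + t * p) + t * ((1 - t) * p + t * k a a)" .
    have "B w w < B w' w' + t\<^sup>2" using w(2) I_le[OF \<open>w' \<in> W\<close>] by linarith
    then have "0 < t * (2 * (p - B w w) + t * (1 + B w w - 2 * p + k a a))"
      unfolding Bw' by (simp add: algebra_simps power2_eq_square)
    then have "0 < 2 * (p - B w w) + t * (1 + B w w - 2 * p + k a a)" using t by (simp add: zero_less_mult_iff)
    moreover have "t * (1 + B w w - 2 * p + k a a) \<le> t * (1 + 4 * K)"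
    proof (intro mult_left_mono)
      have "\<bar>p\<bar> \<le> K" unfolding p_def by (rule avg) (use kK a in auto)
      moreover have "\<bar>B w w\<bar> \<le> K" unfolding Bww by (rule avg) (use avg kK in auto)
      moreover have "\<bar>k a a\<bar> \<le> K" by (rule kK[OF a a])
      ultimately show "1 + B w w - 2 * p + k a a \<le> 1 + 4 * K" by linarith
    qed (use t in auto)
    moreover have "2 * p \<ge> 2 * b - 1" if "0 < 2 * (p - b) + x" "x \<le> 1" for p b x :: real
      using that by simp
    ultimately have "2 * p \<ge> 2 * B w w - 1" unfolding t(3) by blast
    moreover have "B w w > L" unfolding B_def by (rule L) (use wN in auto)
    ultimately have "2 * p \<ge> 2 * L - 1" by linarith
    then show ?thesis unfolding p_def by simp
  qed
  with wN that show ?thesis by blast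
qed

section \<open>Cutoff functions from logarithmic potentials\<close>

definition step :: "real \<Rightarrow> real" where
  "step x = 2 * sq x - 4 * sq (x - 1/2) + 2 * sq (x - 1)"

definition step' :: "real \<Rightarrow> real" where
  "step' x = 4 * max 0 x - 8 * max 0 (x - 1/2) + 4 * max 0 (x - 1)"

lemma DERIV_step: "DERIV step x :> step' x"
proof -
  have *: "DERIV (\<lambda>x. sq (x - c)) x :> 2 * max 0 (x - c)" for c
  proof -
    have "DERIV (\<lambda>x. sq (x - c)) x :> 2 * max 0 (x - c) * 1"
      by (rule DERIV_chain2[OF DERIV_sq]) (auto intro!: derivative_eq_intros)
    then show ?thesis by simp
  qed
  have "DERIV (\<lambda>x. 2 * sq x - 4 * sq (x - 1/2) + 2 * sq (x - 1)) x :> 2 * (2 * max 0 x) - 4 * (2 * max 0 (x - 1/2)) + 2 * (2 * max 0 (x - 1))"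
    by (intro DERIV_add DERIV_diff DERIV_cmult DERIV_sq *)
  then show ?thesis by (simp add: step_def[abs_def] step'_def)
qed

lemma continuous_step': "continuous_on UNIV step'"
  unfolding step'_def[abs_def] by (intro continuous_intros)

lemma step_low: "x \<le> 0 \<Longrightarrow> step x = 0" and step'_low: "x \<le> 0 \<Longrightarrow> step' x = 0"
  by (auto simp: step_def step'_def sq_def)

lemma step_high: "x \<ge> 1 \<Longrightarrow> step x = 1" and step'_high: "x \<ge> 1 \<Longrightarrow> step' x = 0"
  by (auto simp: step_def step'_def sq_def power2_eq_square algebra_simps)

text \<open>The derivative is a tent over [0, 1] with peak 2 at 1/2, so \<open>step\<close> is a
  quadratic spline rising from 0 to 1.\<close>

lemma step'_bounds: "0 \<le> step' x" "step' x \<le> 2"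
  unfolding step'_def by (auto simp: max_def)

lemma step_bounds: "0 \<le> step x" "step x \<le> 1"
proof -
  have mono: "step x \<le> step y" if "x \<le> y" for x y
    by (rule DERIV_nonneg_imp_nondecreasing[OF that]) (use DERIV_step step'_bounds in blast)
  show "0 \<le> step x"
    using mono[of "min x 0" x] step_low[of "min x 0"] by simp
  show "step x \<le> 1"
    using mono[of x "max x 1"] step_high[of "max x 1"] by simp
qed

text \<open>The field \<open>(z - b) / (\<bar>z - b\<bar>\<^sup>2 + s\<^sup>2)\<close> is \<open>- \<nabla>\<close> of the mollified logarithmic kernel; it has
  positive divergence.\<close>
definition log_field :: "real \<Rightarrow> complex \<Rightarrow> complex \<Rightarrow> complex" where
  "log_field s b z = (1 / ((cmod (z - b))\<^sup>2 + s\<^sup>2)) *\<^sub>R (z - b)"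

lemma denom_pos: "s > 0 \<Longrightarrow> (cmod z)\<^sup>2 + s\<^sup>2 > 0"
  by (intro add_nonneg_pos) auto

lemma C1_dist_sq: "C1 (\<lambda>z. (cmod (z - b))\<^sup>2) (\<lambda>z. 2 *\<^sub>R (z - b))"
  using C1_shift[OF C1_norm_sq, of "- b"] by simp

lemma continuous_log_field: "s > 0 \<Longrightarrow> continuous_on UNIV (log_field s b)"
  unfolding log_field_def[abs_def]
  by (intro continuous_intros) (use denom_pos[of s] in \<open>metis less_irrefl\<close>)

lemma C1_log_kernel:
  assumes s: "s > 0" shows "C1 (\<lambda>z. log_kernel s (z - b)) (\<lambda>z. - log_field s b z)"
  unfolding C1_def
proof
  show "\<forall>z. GDERIV (\<lambda>z. log_kernel s (z - b)) z :> - log_field s b z"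
  proof
    fix z
    have "DERIV (\<lambda>x. ln (x + s\<^sup>2)) ((cmod (z - b))\<^sup>2) :> 1 / ((cmod (z - b))\<^sup>2 + s\<^sup>2)"
      using denom_pos[OF s, of "z - b"] by (auto intro!: derivative_eq_intros)
    from GDERIV_DERIV_compose[OF C1_GDERIV[OF C1_dist_sq] DERIV_cmult[OF this, of "- (1/2)"]]
    moreover have "(- (1/2) * (1 / D)) *\<^sub>R (2 *\<^sub>R (z - b)) = - ((1 / D) *\<^sub>R (z - b))" for D :: real
      by simp
    ultimately show "GDERIV (\<lambda>z. log_kernel s (z - b)) z :> - log_field s b z"
      unfolding log_kernel_def log_field_def by (simp only:)
  qed
  show "continuous_on UNIV (\<lambda>z. - log_field s b z)" by (intro continuous_intros continuous_log_field s)
qed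

text \<open>Integration by parts, one component of the field at a time, leaves minus the integral of
  \<open>u\<close> times the divergence, which is 2 s^2 / (|z - b|^2 + s^2)^2.\<close>

lemma integral_grad_log_field_nonpos:
  assumes u: "C1c S u g" and u0: "\<And>z. u z \<ge> 0" and s: "s > 0"
  shows "(\<integral>z. g z \<bullet> log_field s b z \<partial>lborel) \<le> 0"
proof -
  let ?q = "\<lambda>z. 1 / ((cmod (z - b))\<^sup>2 + s\<^sup>2)"
  let ?gq = "\<lambda>z. (- (2 / ((cmod (z - b))\<^sup>2 + s\<^sup>2)\<^sup>2)) *\<^sub>R (z - b)"
  have q: "C1 ?q ?gq"
    unfolding C1_def
  proof
    show "\<forall>z. GDERIV ?q z :> ?gq z"
    proof
      fix z
      have "DERIV (\<lambda>x. 1 / (x + s\<^sup>2)) ((cmod (z - b))\<^sup>2) :> - (1 / ((cmod (z - b))\<^sup>2 + s\<^sup>2)\<^sup>2)"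
        using denom_pos[OF s, of "z - b"] by (auto intro!: derivative_eq_intros simp: power2_eq_square)
      from GDERIV_DERIV_compose[OF C1_GDERIV[OF C1_dist_sq] this] show "GDERIV ?q z :> ?gq z" by simp
    qed
    show "continuous_on UNIV ?gq"
      by (intro continuous_intros) (use denom_pos[OF s] in \<open>metis less_irrefl power_not_zero\<close>)
  qed
  let ?F = "\<lambda>e z. ((z - b) \<bullet> e) * ?q z"
  let ?gF = "\<lambda>e z. ((z - b) \<bullet> e) *\<^sub>R ?gq z + ?q z *\<^sub>R e"
  have i: "C1 (\<lambda>z. (z - b) \<bullet> e) (\<lambda>z. e)" for e
    using C1_shift[OF C1_inner[of e], of "- b"] by simp
  have F: "C1 (?F e) (?gF e)" for e by (rule C1_mult[OF i q])
  have uF: "C1c S (\<lambda>z. ?F e z * u z) (\<lambda>z. ?F e z *\<^sub>R g z + u z *\<^sub>R ?gF e z)" for e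
    by (rule C1c_mult[OF u F])
  have int: "integrable lborel (\<lambda>z. e \<bullet> (?F e z *\<^sub>R g z + u z *\<^sub>R ?gF e z))" for e
  proof -
    have "(\<lambda>z. e \<bullet> (?F e z *\<^sub>R g z + u z *\<^sub>R ?gF e z)) = (\<lambda>z. (?F e z *\<^sub>R g z + u z *\<^sub>R ?gF e z) \<bullet> e)"
      by (rule ext) (rule inner_commute)
    then show ?thesis using integrable_inner_left[OF C1c_integrable_grad[OF uF[of e]]] by simp
  qed
  have zero: "(\<integral>z. e \<bullet> (?F e z *\<^sub>R g z + u z *\<^sub>R ?gF e z) \<partial>lborel) = 0" if "norm e \<le> 1" for e
    by (rule integral_inner_grad_eq_0[OF uF that])
  have pw: "1 \<bullet> (?F 1 z *\<^sub>R g z + u z *\<^sub>R ?gF 1 z) + \<i> \<bullet> (?F \<i> z *\<^sub>R g z + u z *\<^sub>R ?gF \<i> z)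
      = g z \<bullet> log_field s b z + u z * (2 * s\<^sup>2 / ((cmod (z - b))\<^sup>2 + s\<^sup>2)\<^sup>2)" for z
  proof -
    define y where "y = z - b"
    define D where "D = (cmod y)\<^sup>2 + s\<^sup>2"
    have D: "D > 0" unfolding D_def by (rule denom_pos[OF s])
    have yy: "(Re y)\<^sup>2 + (Im y)\<^sup>2 = D - s\<^sup>2" by (simp add: D_def cmod_power2)
    have div: "2 / D - 2 * ((Re y)\<^sup>2 + (Im y)\<^sup>2) / D\<^sup>2 = 2 * s\<^sup>2 / D\<^sup>2"
      unfolding yy using D by (simp add: field_simps power2_eq_square)
    have "1 \<bullet> (?F 1 z *\<^sub>R g z + u z *\<^sub>R ?gF 1 z) + \<i> \<bullet> (?F \<i> z *\<^sub>R g z + u z *\<^sub>R ?gF \<i> z)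
       = g z \<bullet> log_field s b z + u z * (2 / D - 2 * ((Re y)\<^sup>2 + (Im y)\<^sup>2) / D\<^sup>2)"
      unfolding log_field_def y_def[symmetric] D_def[symmetric]
      by (simp add: inner_complex_def algebra_simps power2_eq_square add_divide_distrib)
    then show ?thesis unfolding div by (simp add: D_def y_def)
  qed
  let ?X = "\<lambda>e z. e \<bullet> (?F e z *\<^sub>R g z + u z *\<^sub>R ?gF e z)"
  let ?Y = "\<lambda>z. u z * (2 * s\<^sup>2 / ((cmod (z - b))\<^sup>2 + s\<^sup>2)\<^sup>2)"
  have iY: "integrable lborel ?Y"
  proof -
    have "integrable lborel (\<lambda>z. (2 * s\<^sup>2 / ((cmod (z - b))\<^sup>2 + s\<^sup>2)\<^sup>2) * u z)"
    proof (rule C1c_integrable[OF u])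
      show "continuous_on UNIV (\<lambda>z. 2 * s\<^sup>2 / ((cmod (z - b))\<^sup>2 + s\<^sup>2)\<^sup>2)"
        by (intro continuous_intros) (use denom_pos[OF s] in \<open>metis less_irrefl power_not_zero\<close>)
    qed
    then show ?thesis by (simp add: mult.commute)
  qed
  have eq: "g z \<bullet> log_field s b z = (?X 1 z + ?X \<i> z) - ?Y z" for z
    using pw[of z] by linarith
  have "(\<integral>z. g z \<bullet> log_field s b z \<partial>lborel) = (\<integral>z. (?X 1 z + ?X \<i> z) - ?Y z \<partial>lborel)"
    by (rule Bochner_Integration.integral_cong[OF refl eq])
  also have "\<dots> = ((\<integral>z. ?X 1 z \<partial>lborel) + (\<integral>z. ?X \<i> z \<partial>lborel)) - (\<integral>z. ?Y z \<partial>lborel)"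
    by (simp only: Bochner_Integration.integral_diff[OF Bochner_Integration.integrable_add[OF int int] iY]
        Bochner_Integration.integral_add[OF int int])
  also have "\<dots> = - (\<integral>z. ?Y z \<partial>lborel)" using zero[of 1] zero[of "\<i>"] by simp
  also have "\<dots> \<le> 0"
    using Bochner_Integration.integral_nonneg[of lborel ?Y] u0 by simp
  finally show ?thesis .
qed

text \<open>The mass of the divergence of \<open>log_field\<close> is bounded uniformly in \<open>s\<close>, by testing against a
  radial cutoff that equals 1 on a large disc.\<close>
lemma integral_grad_log_field_ge:
  assumes u: "C1c UNIV u g" and u1: "\<And>z. u z \<le> 1" and s: "s > 0"
  shows "- (\<integral>z. g z \<bullet> log_field s b z \<partial>lborel) \<le> 16 * pi"
proof -
  obtain K where K: "compact K" "\<And>z. z \<notin> K \<Longrightarrow> u z = 0" using C1c_obtain[OF u] by metis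
  obtain R where R: "R > 0" "K \<subseteq> cball b R"
    using bounded_subset_ballD[OF compact_imp_bounded[OF K(1)], of b] ball_subset_cball by blast
  let ?x = "\<lambda>z. (cmod (z - b))\<^sup>2 / R\<^sup>2 - 1"
  \<comment> \<open>Equal to 1 on the disc of radius \<open>R\<close>, which contains the support of
    \<open>u\<close>, and 0 outside radius 2R. Hence \<kappa> is at least \<open>u\<close>, and
    positivity of the divergence compares the two integrals.\<close>
  define \<kappa> where "\<kappa> = (\<lambda>z. 1 - step (?x z))"
  define k where "k = (\<lambda>z. 0 - step' (?x z) *\<^sub>R ((2 / R\<^sup>2) *\<^sub>R (z - b) - 0))"
  have far: "?x z \<ge> 1" if "z \<notin> cball b (2 * R)" for z
  proof -
    have "(2 * R)\<^sup>2 \<le> (cmod (z - b))\<^sup>2" using that R by (intro power_mono) (auto simp: dist_norm norm_minus_commute)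
    then have "4 \<le> (cmod (z - b))\<^sup>2 / R\<^sup>2" using R by (simp add: pos_le_divide_eq power_mult_distrib)
    then show ?thesis by simp
  qed
  have \<kappa>: "C1c UNIV \<kappa> k"
  proof (rule C1cI[of _ _ "cball b (2 * R)"])
    show "C1 \<kappa> k" unfolding \<kappa>_def k_def
      by (rule C1_diff[OF C1_const C1_compose[OF C1_diff[OF C1_radius C1_const] DERIV_step continuous_step']])
    show "\<kappa> z = 0" if "z \<notin> cball b (2 * R)" for z
      using step_high[OF far[OF that]] by (simp add: \<kappa>_def)
  qed auto
  have ge: "u z \<le> \<kappa> z" for z
  proof (cases "z \<in> K")
    case True
    then have "cmod (z - b) \<le> R" using R by (auto simp: dist_norm norm_minus_commute)
    then have "(cmod (z - b))\<^sup>2 \<le> R\<^sup>2" using R by (intro power_mono) auto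
    then have "?x z \<le> 0" using R by (simp add: divide_le_eq)
    then show ?thesis using u1[of z] by (simp add: \<kappa>_def step_low)
  next
    case False
    then show ?thesis using K(2)[OF False] step_bounds[of "?x z"] by (simp add: \<kappa>_def)
  qed
  have fi: "integrable lborel (\<lambda>z. h z \<bullet> log_field s b z)" if v: "C1c UNIV v h" for v h
  proof -
    obtain K' where "compact K'" "\<And>z. z \<notin> K' \<Longrightarrow> h z = 0" using C1c_obtain[OF v] by metis
    then show ?thesis
      using C1_cont_grad[OF C1cD[OF v]] continuous_log_field[OF s]
      by (intro continuous_compact_support_integrable[of _ K'] continuous_intros) auto
  qed
  have "(\<integral>z. (k z - g z) \<bullet> log_field s b z \<partial>lborel) \<le> 0"
    by (rule integral_grad_log_field_nonpos[OF C1c_diff[OF \<kappa> u] _ s]) (use ge in simp)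
  then have 1: "(\<integral>z. k z \<bullet> log_field s b z \<partial>lborel) \<le> (\<integral>z. g z \<bullet> log_field s b z \<partial>lborel)"
    using fi[OF \<kappa>] fi[OF u] by (simp add: inner_diff_left)
  \<comment> \<open>The slope is at most 2 and the radial factor at most 1, so the integrand is at
    most 4 / R^2; times the area 4 pi R^2 this gives 16 pi, independent of \<open>R\<close> and
    \<open>s\<close>.\<close>
  have "(\<integral>z. - (k z \<bullet> log_field s b z) \<partial>lborel) \<le> (\<integral>z. indicator (cball b (2 * R)) z * (4 / R\<^sup>2) \<partial>lborel)"
  proof (rule integral_mono)
    show "integrable lborel (\<lambda>z. - (k z \<bullet> log_field s b z))" using fi[OF \<kappa>] by simp
    show "integrable lborel (\<lambda>z. indicator (cball b (2 * R)) z * (4 / R\<^sup>2))"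
      using integrable_real_indicator[of "cball b (2 * R)" lborel] emeasure_bounded_finite[of "cball b (2 * R)"]
      by (intro integrable_mult_left) auto
    fix z
    define \<rho> where "\<rho> = (cmod (z - b))\<^sup>2"
    have \<rho>: "\<rho> \<ge> 0" "\<rho> + s\<^sup>2 > 0" using denom_pos[OF s, of "z - b"] by (auto simp: \<rho>_def)
    have "- (k z \<bullet> log_field s b z) = step' (?x z) * (2 / R\<^sup>2) * (\<rho> / (\<rho> + s\<^sup>2))"
      by (simp add: k_def log_field_def \<rho>_def power2_norm_eq_inner)
    also have "\<dots> \<le> indicator (cball b (2 * R)) z * (4 / R\<^sup>2)"
    proof (cases "z \<in> cball b (2 * R)")
      case True
      have "step' (?x z) * (2 / R\<^sup>2) * (\<rho> / (\<rho> + s\<^sup>2)) \<le> 2 * (2 / R\<^sup>2) * 1"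
        using step'_bounds[of "?x z"] \<rho> by (intro mult_mono) (auto simp: divide_le_eq_1)
      with True show ?thesis by simp
    next
      case False
      then show ?thesis using step'_high[OF far[OF False]] by simp
    qed
    finally show "- (k z \<bullet> log_field s b z) \<le> indicator (cball b (2 * R)) z * (4 / R\<^sup>2)" .
  qed
  also have "(\<integral>z. indicator (cball b (2 * R)) z * (4 / R\<^sup>2) \<partial>lborel) = measure lborel (cball b (2 * R)) * (4 / R\<^sup>2)"
    by simp
  also have "measure lborel (cball b (2 * R)) = pi * (2 * R)\<^sup>2"
    using content_cball[of "2 * R" b] R by (simp add: measure_def unit_ball_vol_2)
  also have "pi * (2 * R)\<^sup>2 * (4 / R\<^sup>2) = 16 * pi" using R by (simp add: power_mult_distrib)
  finally show ?thesis using 1 fi[OF \<kappa>] by simp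
qed

text \<open>The potential of a near-equilibrium measure is rescaled so that the level -ln d becomes
  0 and L - 1 becomes 1, then cut off by \<open>step\<close>. The squared norm is at most 2 / (L - 1
  + ln d) times a flux of at most 16 pi.\<close>

lemma capacity_cutoff:
  assumes E: "compact E" and L: "robin_const E > ereal L" and d: "d > 0" and pos: "L - 1 + ln d > 0"
  obtains u g U where "C1c UNIV u g" "\<And>z. 0 \<le> u z" "\<And>z. u z \<le> 1" "open U" "E \<subseteq> U" "\<And>z. z \<in> U \<Longrightarrow> u z = 1"
    "\<And>z. \<forall>a\<in>E. d \<le> dist z a \<Longrightarrow> u z = 0"
    "(nrm g)\<^sup>2 \<le> 32 * pi / (L - 1 + ln d)"
proof (cases "E = {}")
  case True
  have n0: "(nrm (\<lambda>z. 0))\<^sup>2 \<le> 32 * pi / (L - 1 + ln d)" using pos by (simp add: nrm_sq)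
  show ?thesis by (rule that[OF C1c_zero _ _ open_empty _ _ _ n0]) (use True in auto)
next
  case False
  let ?l = "L - 1 + ln d"
  obtain s where s: "s > 0" and en: "\<And>N w. weights E N w \<Longrightarrow> discrete_energy s N w > L"
    by (rule discrete_energy_lower_bound[OF E L]) (rule that)
  \<comment> \<open>The mesh is tied to the scale \<open>s\<close>: the potential will be
    1/(2s)-Lipschitz, so points within \<open>s\<close> of a node lose at most 1/2.\<close>
  have "E \<subseteq> (\<Union>x\<in>E. ball x (s / 2))" using s by auto
  then obtain N where N: "N \<subseteq> E" "finite N" "E \<subseteq> (\<Union>x\<in>N. ball x (s / 2))"
    by (rule compactE_image[OF E open_ball])
  have Nne: "N \<noteq> {}" using N(3) False by auto
  obtain w where w: "\<forall>a\<in>N. w a \<ge> 0" "sum w N = 1" and pw: "\<And>a. a \<in> N \<Longrightarrow> (\<Sum>b\<in>N. w b * log_kernel s (a - b)) \<ge> L - 1/2"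
  proof (rule near_equilibrium_weights[OF N(2) Nne, of "\<lambda>a b. log_kernel s (a - b)" L])
    show "log_kernel s (a - b) = log_kernel s (b - a)" for a b by (simp add: log_kernel_def norm_minus_commute)
    show "(\<Sum>a\<in>N. \<Sum>b\<in>N. w a * w b * log_kernel s (a - b)) > L" if "\<forall>a\<in>N. w a \<ge> 0" "sum w N = 1" for w
      using en[of N w] that N by (simp add: weights_def discrete_energy_def)
  qed (use that in blast)
  have wsum: "(\<Sum>b\<in>N. w b * c) = c" for c
    using sum_distrib_right[of w N c] w(2) by simp
  define p where "p = (\<lambda>z. \<Sum>b\<in>N. w b * log_kernel s (z - b))"
  define h where "h = (\<lambda>z. \<Sum>b\<in>N. w b *\<^sub>R (- log_field s b z))"
  have p: "C1 p h"
  proof -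
    have "C1 (\<lambda>z. \<Sum>b\<in>M. w b * log_kernel s (z - b)) (\<lambda>z. \<Sum>b\<in>M. w b *\<^sub>R (- log_field s b z))" if "finite M" for M
      using that
    proof (induction M)
      case empty
      show ?case using C1_const[of 0] by simp
    next
      case (insert b M)
      show ?case using C1_add[OF C1_cmult[OF C1_log_kernel[OF s, of b], of "w b"] insert(3)] insert by simp
    qed
    then show ?thesis using N(2) by (simp add: p_def h_def)
  qed
  have hb: "norm (h z) \<le> 1 / (2 * s)" for z
  proof -
    have lf: "norm (log_field s b z) \<le> 1 / (2 * s)" for b
    proof -
      have "2 * cmod (z - b) * s \<le> (cmod (z - b))\<^sup>2 + s\<^sup>2" by (rule sum_squares_bound)
      then show ?thesis using s denom_pos[OF s, of "z - b"]
        by (simp add: log_field_def divide_simps abs_of_pos)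
    qed
    have "norm (h z) \<le> (\<Sum>b\<in>N. w b * norm (log_field s b z))"
      unfolding h_def by (rule order_trans[OF norm_sum]) (use w in \<open>auto intro!: sum_mono\<close>)
    also have "\<dots> \<le> (\<Sum>b\<in>N. w b * (1 / (2 * s)))" using w lf by (intro sum_mono mult_left_mono) auto
    also have "\<dots> = 1 / (2 * s)" by (rule wsum)
    finally show ?thesis .
  qed
  define x where "x = (\<lambda>z. (1 / ?l) * (p z - (- ln d)))"
  define u where "u = (\<lambda>z. step (x z))"
  define g where "g = (\<lambda>z. step' (x z) *\<^sub>R ((1 / ?l) *\<^sub>R (h z - 0)))"
  have C1u: "C1 u g" unfolding u_def g_def x_def
    by (rule C1_compose[OF C1_cmult[OF C1_diff[OF p C1_const]] DERIV_step continuous_step'])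
  have far: "u z = 0" if "\<forall>a\<in>E. d \<le> dist z a" for z
  proof -
    have "p z \<le> (\<Sum>b\<in>N. w b * (- ln d))"
      unfolding p_def
    proof (intro sum_mono mult_left_mono)
      fix b assume "b \<in> N"
      then have "d \<le> cmod (z - b)" using that N by (auto simp: dist_norm)
      then have "d\<^sup>2 \<le> (cmod (z - b))\<^sup>2" using d by (intro power_mono) auto
      then have "d\<^sup>2 \<le> (cmod (z - b))\<^sup>2 + s\<^sup>2" using zero_le_power2[of s] by linarith
      then have "ln (d\<^sup>2) \<le> ln ((cmod (z - b))\<^sup>2 + s\<^sup>2)" using d denom_pos[OF s] by (subst ln_le_cancel_iff) auto
      then show "log_kernel s (z - b) \<le> - ln d" using d by (simp add: log_kernel_def ln_realpow)
    qed (use w in auto)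
    also have "\<dots> = - ln d" by (rule wsum)
    finally have "x z \<le> 0" using pos by (simp add: x_def divide_le_0_iff)
    then show ?thesis by (simp add: u_def step_low)
  qed
  define U where "U = (\<Union>a\<in>E. ball a (s / 2))"
  have U: "open U" "E \<subseteq> U" using s by (auto simp: U_def)
  \<comment> \<open>From \<open>z\<close> to \<open>E\<close> and from there to a node the distance
    is less than \<open>s / 2\<close> each, so the potential stays above L - 1/2 - 1/2.\<close>
  have uU: "u z = 1" if z: "z \<in> U" for z
  proof -
    obtain a where a: "a \<in> E" "dist a z < s / 2" using z by (auto simp: U_def)
    obtain b where b: "b \<in> N" "dist b a < s / 2" using N(3) a(1) by auto
    have "cmod (z - b) < s" using a(2) b(2) dist_triangle[of b z a] by (simp add: dist_norm norm_minus_commute)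
    then have "1 / (2 * s) * cmod (z - b) \<le> 1 / (2 * s) * s" using s by (intro mult_left_mono) auto
    with C1_Lipschitz[OF p hb, of z b] have "\<bar>p z - p b\<bar> \<le> 1 / (2 * s) * s" by (rule order_trans)
    then have "2 * \<bar>p z - p b\<bar> \<le> 1" using s by simp
    moreover have "2 * p b \<ge> 2 * L - 1" using pw[OF b(1)] unfolding p_def by simp
    moreover have "L - 1 \<le> x" if "2 * \<bar>x - y\<bar> \<le> 1" "2 * L - 1 \<le> 2 * y" for x y
      using that by (simp add: abs_if split: if_splits)
    ultimately have "p z \<ge> L - 1" by blast
    then have "x z \<ge> 1" using pos by (simp add: x_def pos_le_divide_eq)
    then show ?thesis by (simp add: u_def step_high)
  qed
  obtain R where R: "E \<subseteq> cball 0 R" using bounded_subset_ballD[OF compact_imp_bounded[OF E], of 0] ball_subset_cball by blast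
  have u: "C1c UNIV u g"
  proof (rule C1cI[OF C1u, of "cball 0 (R + d)"])
    fix z :: complex assume z: "z \<notin> cball 0 (R + d)"
    show "u z = 0"
    proof (rule far, rule ballI)
      fix a assume "a \<in> E"
      then show "d \<le> dist z a" using R z dist_triangle[of 0 z a] by (force simp: dist_commute)
    qed
  qed auto
  have u01: "0 \<le> u z" "u z \<le> 1" for z :: complex by (auto simp: u_def step_bounds)
  have gL: "g \<in> L2" by (rule C1c_L2[OF u])
  obtain Ku where Ku: "compact Ku" "\<And>z. z \<notin> Ku \<Longrightarrow> g z = 0" using C1c_obtain[OF u] by metis
  have gc: "continuous_on UNIV g" by (rule C1_cont_grad[OF C1u])
  have fi: "integrable lborel (\<lambda>z. g z \<bullet> log_field s b z)" for b
    by (rule continuous_compact_support_integrable[OF _ Ku(1)])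
       (use Ku(2) gc continuous_log_field[OF s] in \<open>auto intro!: continuous_intros\<close>)
  have gh: "g z \<bullet> h z = (\<Sum>b\<in>N. w b * (- (g z \<bullet> log_field s b z)))" for z
    by (simp add: h_def inner_sum_right)
  have ih: "integrable lborel (\<lambda>z. g z \<bullet> h z)"
    unfolding gh using fi by (intro Bochner_Integration.integrable_sum integrable_mult_right Bochner_Integration.integrable_minus)
  have "(nrm g)\<^sup>2 \<le> (\<integral>z. (2 / ?l) * (g z \<bullet> h z) \<partial>lborel)"
    unfolding nrm_sq
  proof (rule integral_mono[OF L2_int[OF gL]])
    show "integrable lborel (\<lambda>z. (2 / ?l) * (g z \<bullet> h z))" using ih by simp
    fix z
    let ?t = "step' (x z)"
    \<comment> \<open>\<open>g\<close> is \<open>step'\<close> over \<open>?l\<close> times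
      \<open>h\<close>. One factor \<open>step'\<close> is replaced by its bound 2 and the other
      stays in \<open>g\<close>, which makes the bound linear in \<open>g\<close>.\<close>
    have "(cmod (g z))\<^sup>2 = ?t * (?t * ((cmod (h z))\<^sup>2 / ?l\<^sup>2))"
      unfolding g_def by (simp add: power_mult_distrib power_divide power2_eq_square)
    also have "\<dots> \<le> 2 * (?t * ((cmod (h z))\<^sup>2 / ?l\<^sup>2))"
      using step'_bounds[of "x z"] by (intro mult_right_mono mult_nonneg_nonneg divide_nonneg_nonneg) auto
    also have "\<dots> = (2 / ?l) * (g z \<bullet> h z)"
      unfolding g_def by (simp add: power2_norm_eq_inner power2_eq_square[of ?l])
    finally show "(cmod (g z))\<^sup>2 \<le> (2 / ?l) * (g z \<bullet> h z)" .
  qed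
  also have "\<dots> = (2 / ?l) * (\<integral>z. g z \<bullet> h z \<partial>lborel)" by simp
  also have "(\<integral>z. g z \<bullet> h z \<partial>lborel) = (\<Sum>b\<in>N. w b * (- (\<integral>z. g z \<bullet> log_field s b z \<partial>lborel)))"
    unfolding gh using fi by (subst Bochner_Integration.integral_sum) auto
  also have "\<dots> \<le> (\<Sum>b\<in>N. w b * (16 * pi))"
    using w(1) by (intro sum_mono mult_left_mono integral_grad_log_field_ge[OF u u01(2) s]) auto
  also have "\<dots> = 16 * pi" by (rule wsum)
  finally have "(nrm g)\<^sup>2 \<le> (2 / ?l) * (16 * pi)" using pos by (simp add: mult_left_mono divide_right_mono)
  then have fin: "(nrm g)\<^sup>2 \<le> 32 * pi / ?l" by simp
  show ?thesis by (rule that[OF u u01 U uU far fin])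
qed

section \<open>Comparison of the Bergman kernels\<close>

text \<open>Caccioppoli's inequality, from testing the Euler-Lagrange inequality against \<open>u\<^sup>2 v\<close>.\<close>
lemma localized_gradient_bound:
  assumes v: "C1c S v g" and vM: "\<And>y. \<bar>v y\<bar> \<le> M"
    and EL: "\<And>\<phi> h. C1c S \<phi> h \<Longrightarrow> \<bar>\<integral>y. (g y - load e z r y) \<bullet> h y \<partial>lborel\<bar> \<le> \<eta> * nrm h" and \<eta>: "\<eta> > 0"
    and u: "C1c UNIV u k" and u01: "\<And>y. 0 \<le> u y" "\<And>y. u y \<le> 1" and uz: "\<And>y. y \<in> ball z r \<Longrightarrow> u y = 0" and r: "r > 0"
  shows "nrm (\<lambda>y. u y *\<^sub>R g y + v y *\<^sub>R k y) \<le> 3 * (M * nrm k) + 2 * \<eta>"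
proof -
  have gL: "g \<in> L2" and kL: "k \<in> L2" using C1c_L2 v u by blast+
  have um: "u \<in> borel_measurable borel" and vm: "v \<in> borel_measurable borel"
    using C1_cont[OF C1cD[OF u]] C1_cont[OF C1cD[OF v]] by (auto intro: borel_measurable_continuous_onI)
  have M0: "M \<ge> 0" using vM[of 0] by linarith
  have u1: "\<bar>u y\<bar> \<le> 1" for y using u01[of y] by simp
  define p where "p = (\<lambda>y. u y *\<^sub>R g y)"
  define q where "q = (\<lambda>y. v y *\<^sub>R k y)"
  have pL: "p \<in> L2" unfolding p_def by (rule L2_bounded_mult(1)[OF um u1 gL])
  have qL: "q \<in> L2" "nrm q \<le> M * nrm k" unfolding q_def by (rule L2_bounded_mult[OF vm vM kL])+
  \<comment> \<open>The gradient of \<open>u * u * v\<close>. It equals u p + 2 u q, where p + q is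
    the gradient of \<open>u * v\<close>.\<close>
  define h where "h = (\<lambda>y. (u y * u y) *\<^sub>R g y + v y *\<^sub>R (u y *\<^sub>R k y + u y *\<^sub>R k y))"
  have h: "C1c S (\<lambda>y. (u y * u y) * v y) h"
    unfolding h_def by (rule C1c_mult[OF v C1_mult[OF C1cD[OF u] C1cD[OF u]]])
  have hpq: "h = (\<lambda>y. u y *\<^sub>R p y + u y *\<^sub>R (2 *\<^sub>R q y))"
    by (rule ext) (simp add: h_def p_def q_def scaleR_conv_of_real algebra_simps)
  have "(\<lambda>y. u y *\<^sub>R p y) \<in> L2" "nrm (\<lambda>y. u y *\<^sub>R p y) \<le> 1 * nrm p" by (rule L2_bounded_mult[OF um u1 pL])+
  moreover have "(\<lambda>y. u y *\<^sub>R (2 *\<^sub>R q y)) \<in> L2" "nrm (\<lambda>y. u y *\<^sub>R (2 *\<^sub>R q y)) \<le> 1 * nrm (\<lambda>y. 2 *\<^sub>R q y)"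
    by (rule L2_bounded_mult[OF um u1 L2_scaleR[OF qL(1)]])+
  moreover have "nrm (\<lambda>y. 2 *\<^sub>R q y) = 2 * nrm q" using nrm_cmult[of 2 q] by (simp add: scaleR_conv_of_real)
  ultimately have hn: "nrm h \<le> nrm p + 2 * nrm q"
    unfolding hpq using nrm_triangle[of "\<lambda>y. u y *\<^sub>R p y" "\<lambda>y. u y *\<^sub>R (2 *\<^sub>R q y)"] by auto
  have pw: "(g y - load e z r y) \<bullet> h y = (cmod (p y))\<^sup>2 + 2 * (p y \<bullet> q y)" for y
  proof -
    \<comment> \<open>The test function vanishes on the disc that carries the load, so only the
      homogeneous equation is felt.\<close>
    have "load e z r y \<bullet> h y = 0"
      by (cases "y \<in> ball z r") (use uz bump_eq_0[OF r] in \<open>auto simp: load_def h_def\<close>)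
    moreover have "g y \<bullet> h y = (cmod (p y))\<^sup>2 + 2 * (p y \<bullet> q y)"
      unfolding hpq power2_norm_eq_inner by (simp add: p_def inner_add_right)
    ultimately show ?thesis by (simp add: inner_diff_left)
  qed
  have "(nrm p)\<^sup>2 + 2 * (\<integral>y. p y \<bullet> q y \<partial>lborel) = (\<integral>y. (g y - load e z r y) \<bullet> h y \<partial>lborel)"
    unfolding pw nrm_sq using L2_int[OF pL] L2_inner_integrable[OF pL qL(1)] by simp
  then have "(nrm p)\<^sup>2 \<le> \<eta> * nrm h + 2 * (nrm p * nrm q)"
    using EL[OF h] L2_inner_Cauchy_Schwarz[OF pL qL(1)] by linarith
  also have "\<dots> \<le> \<eta> * (nrm p + 2 * nrm q) + 2 * (nrm p * nrm q)"
    using hn \<eta> by (intro add_right_mono mult_left_mono) auto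
  finally have X: "(nrm p)\<^sup>2 \<le> \<eta> * (nrm p + 2 * nrm q) + 2 * (nrm p * nrm q)" .
  \<comment> \<open>Solves the quadratic inequality \<open>X\<close> for
    \<open>nrm p\<close>.\<close>
  have "nrm p \<le> 2 * nrm q + 2 * \<eta>"
  proof (rule ccontr)
    assume "\<not> ?thesis"
    then have c: "nrm p - 2 * nrm q - \<eta> > \<eta>" "nrm p > 2 * nrm q" using \<eta> by auto
    have "nrm p * \<eta> \<le> nrm p * (nrm p - 2 * nrm q - \<eta>)" using c by (intro mult_left_mono) auto
    moreover have "2 * nrm q * \<eta> < nrm p * \<eta>" using c \<eta> by simp
    ultimately show False using X by (simp add: power2_eq_square algebra_simps)
  qed
  moreover have "nrm (\<lambda>y. p y + q y) \<le> nrm p + nrm q" by (rule nrm_triangle[OF pL qL(1)])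
  ultimately have "nrm (\<lambda>y. p y + q y) \<le> 3 * nrm q + 2 * \<eta>" by linarith
  also have "\<dots> \<le> 3 * (M * nrm k) + 2 * \<eta>" using qL(2) by simp
  finally show ?thesis by (simp add: p_def q_def)
qed

text \<open>\<open>E\<close> is only closed, but what matters is its part inside the supports of
  \<open>v1 n\<close> and \<open>v2 n\<close>, which is compact. The cutoff changes with
  \<open>n\<close>, its gradient bound does not. The factor 2 in the radius leaves room for the bump
  and for the cutoff to vanish on it.\<close>

lemma orthogonal_pointwise_bound:
  assumes S: "open S" and E: "closed E" and h: "h holomorphic_on (S - E)" "h \<in> L2"
    and orth: "\<And>F. F \<in> bergman_space S \<Longrightarrow> (\<integral>y. h y * cnj (indicator S y *\<^sub>R F y) \<partial>lborel) = 0"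
    and r: "r > 0" and z: "ball z (2 * r) \<subseteq> S - E"
    and cap: "\<And>K. compact K \<Longrightarrow> K \<subseteq> E \<Longrightarrow> robin_const K > ereal L" and L: "L - 1 + ln r > 0"
  shows "r\<^sup>2 * bump_mass * cmod (h z) \<le> nrm h * (3 * ((6 * r + 1) * sqrt (32 * pi / (L - 1 + ln r))))"
proof -
  let ?D = "S - E" and ?M = "6 * r + 1" and ?Y = "sqrt (32 * pi / (L - 1 + ln r))"
  have D: "open ?D" using S E by (rule open_Diff)
  have zD: "cball z r \<subseteq> ?D"
  proof -
    have "cball z r \<subseteq> ball z (2 * r)" using r by auto
    then show ?thesis using z by blast
  qed
  then have zS: "cball z r \<subseteq> S" by blast
  obtain v1 g1 v2 g2 :: "nat \<Rightarrow> complex \<Rightarrow> _" and F where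
    1: "\<And>n. C1c S (v1 n) (g1 n)" "\<And>n y. \<bar>v1 n y\<bar> \<le> ?M"
      "\<And>n u h. C1c S u h \<Longrightarrow> \<bar>\<integral>y. (g1 n y - load 1 z r y) \<bullet> h y \<partial>lborel\<bar> \<le> 1 / real (Suc n) * nrm h"
    and 2: "\<And>n. C1c S (v2 n) (g2 n)" "\<And>n y. \<bar>v2 n y\<bar> \<le> ?M"
      "\<And>n u h. C1c S u h \<Longrightarrow> \<bar>\<integral>y. (g2 n y - load \<i> z r y) \<bullet> h y \<partial>lborel\<bar> \<le> 1 / real (Suc n) * nrm h"
    and F: "F \<in> bergman_space S" "(\<lambda>n. nrm (\<lambda>y. residual z r (g1 n) (g2 n) y - indicator S y *\<^sub>R F y)) \<longlonglongrightarrow> 0"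
    by (rule approximate_bergman_projection[OF S r zS]) (rule that)
  have gL: "g1 n \<in> L2" "g2 n \<in> L2" for n using C1c_L2 1(1) 2(1) by blast+
  let ?R = "\<lambda>n. residual z r (g1 n) (g2 n)" and ?F = "\<lambda>y. indicator S y *\<^sub>R F y"
  have FL: "?F \<in> L2" using F(1) bergman_space_iff[OF S] by auto
  have hb: "h \<in> bergman_space ?D"
    unfolding bergman_space_iff[OF D] using h D by (auto intro: L2_indicator)
  have bound: "r\<^sup>2 * bump_mass * cmod (h z) \<le> nrm h * (nrm (\<lambda>y. ?R n y - ?F y) + (3 * (?M * ?Y) + 2 * (1 / real (Suc n))))" for n
  proof -
    let ?\<eta> = "1 / real (Suc n)"
    obtain K1 where K1: "compact K1" "K1 \<subseteq> S" "\<And>y. y \<notin> K1 \<Longrightarrow> v1 n y = 0" using C1c_obtain[OF 1(1)[of n]] by metis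
    obtain K2 where K2: "compact K2" "K2 \<subseteq> S" "\<And>y. y \<notin> K2 \<Longrightarrow> v2 n y = 0" using C1c_obtain[OF 2(1)[of n]] by metis
    define K where "K = E \<inter> (K1 \<union> K2)"
    have K: "compact K" "K \<subseteq> E" unfolding K_def using E K1(1) K2(1) by (auto intro!: closed_Int_compact)
    obtain u k U where u: "C1c UNIV u k" "\<And>y. 0 \<le> u y" "\<And>y. u y \<le> 1" "open U" "K \<subseteq> U" "\<And>y. y \<in> U \<Longrightarrow> u y = 1"
      "\<And>y. \<forall>a\<in>K. r \<le> dist y a \<Longrightarrow> u y = 0" "(nrm k)\<^sup>2 \<le> 32 * pi / (L - 1 + ln r)"
      by (rule capacity_cutoff[OF K(1) cap[OF K] r L]) (rule that)
    have nk: "nrm k \<le> ?Y" using real_sqrt_le_mono[OF u(8)] by simp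
    have uz: "u y = 0" if y: "y \<in> ball z r" for y
    proof (rule u(7), rule ballI)
      fix a assume "a \<in> K"
      then have "a \<notin> ball z (2 * r)" using z K(2) by blast
      then show "r \<le> dist y a" using y dist_triangle[of z a y] by simp
    qed
    have part: "cmod (\<integral>y. h y * g y \<partial>lborel) \<le> nrm h * (3 * (?M * ?Y) + 2 * ?\<eta>)"
      if v: "C1c S v g" "\<And>y. \<bar>v y\<bar> \<le> ?M" and Kv: "compact Kv" "Kv \<subseteq> S" "\<And>y. y \<notin> Kv \<Longrightarrow> v y = 0" "E \<inter> Kv \<subseteq> K"
        and EL: "\<And>\<phi> h. C1c S \<phi> h \<Longrightarrow> \<bar>\<integral>y. (g y - load e z r y) \<bullet> h y \<partial>lborel\<bar> \<le> ?\<eta> * nrm h"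
      for v g e Kv
    proof -
      have gL: "g \<in> L2" by (rule C1c_L2[OF v(1)])
      define G where "G = (\<lambda>y. (1 - u y) *\<^sub>R g y + v y *\<^sub>R (0 - k y))"
      \<comment> \<open>On \<open>Kv\<close> the set \<open>E\<close> is covered by
        \<open>U\<close>, where \<open>1 - u\<close> vanishes; so the support lies in the compact
        set \<open>Kv - U\<close>, which misses \<open>E\<close>.\<close>
      have G: "C1c ?D (\<lambda>y. (1 - u y) * v y) G"
      proof (rule C1cI[of _ _ "Kv - U"])
        show "C1 (\<lambda>y. (1 - u y) * v y) G"
          unfolding G_def by (rule C1_mult[OF C1_diff[OF C1_const C1cD[OF u(1)]] C1cD[OF v(1)]])
        show "compact (Kv - U)" using Kv(1) u(4) by (rule compact_diff)
        show "Kv - U \<subseteq> ?D" using Kv(2,4) u(5) by blast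
        show "(1 - u y) * v y = 0" if "y \<notin> Kv - U" for y using that Kv(3) u(6) by fastforce
      qed
      have GL: "G \<in> L2" by (rule C1c_L2[OF G])
      have "(\<integral>y. indicator ?D y *\<^sub>R (h y * G y) \<partial>lborel) = 0"
        by (rule holomorphic_integral_grad_eq_0[OF h(1) D G])
      moreover have "indicator ?D y *\<^sub>R (h y * G y) = h y * G y" for y
      proof (cases "y \<in> ?D")
        case False
        obtain K' where "K' \<subseteq> ?D" "\<And>y. y \<notin> K' \<Longrightarrow> G y = 0" using C1c_obtain[OF G] by metis
        then have "G y = 0" using False by blast
        then show ?thesis by simp
      qed simp
      ultimately have zero: "(\<integral>y. h y * G y \<partial>lborel) = 0" by simp
      \<comment> \<open>The gradient of \<open>u * v\<close>, the only part of the gradient of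
        \<open>v\<close> that \<open>h\<close> sees.\<close>
      let ?w = "\<lambda>y. u y *\<^sub>R g y + v y *\<^sub>R k y"
      have w: "?w \<in> L2" "?w = (\<lambda>y. g y - G y)"
      proof -
        show "?w = (\<lambda>y. g y - G y)" by (rule ext) (simp add: G_def algebra_simps)
        then show "?w \<in> L2" using L2_diff[OF gL GL] by simp
      qed
      have "(\<lambda>y. h y * ?w y) = (\<lambda>y. h y * g y - h y * G y)"
        by (rule ext) (simp only: fun_cong[OF w(2)] right_diff_distrib)
      then have "(\<integral>y. h y * ?w y \<partial>lborel) = (\<integral>y. h y * g y \<partial>lborel) - (\<integral>y. h y * G y \<partial>lborel)"
        using L2_mult_integrable[OF h(2) gL] L2_mult_integrable[OF h(2) GL] by simp
      then have "(\<integral>y. h y * g y \<partial>lborel) = (\<integral>y. h y * ?w y \<partial>lborel)" using zero by simp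
      also have "cmod \<dots> \<le> nrm h * nrm ?w" by (rule L2_Cauchy_Schwarz[OF h(2) w(1)])
      also have "\<dots> \<le> nrm h * (3 * (?M * nrm k) + 2 * ?\<eta>)"
        by (intro mult_left_mono localized_gradient_bound[OF v(1) v(2) EL _ u(1,2,3) uz r]) auto
      also have "\<dots> \<le> nrm h * (3 * (?M * ?Y) + 2 * ?\<eta>)"
        using nk r by (intro mult_left_mono add_right_mono) auto
      finally show ?thesis .
    qed
    have p1: "cmod (\<integral>y. h y * g1 n y \<partial>lborel) \<le> nrm h * (3 * (?M * ?Y) + 2 * ?\<eta>)"
      by (rule part[OF 1(1) 1(2) K1 _ 1(3)]) (auto simp: K_def)
    have p2: "cmod (\<integral>y. h y * g2 n y \<partial>lborel) \<le> nrm h * (3 * (?M * ?Y) + 2 * ?\<eta>)"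
      by (rule part[OF 2(1) 2(2) K2 _ 2(3)]) (auto simp: K_def)
    have RL: "?R n \<in> L2" by (rule residual_L2[OF r gL])
    have res: "cmod (\<integral>y. h y * cnj (?R n y) \<partial>lborel) \<le> nrm h * nrm (\<lambda>y. ?R n y - ?F y)"
    proof -
      have "(\<integral>y. h y * cnj (?R n y - ?F y) \<partial>lborel) = (\<integral>y. h y * cnj (?R n y) \<partial>lborel) - (\<integral>y. h y * cnj (?F y) \<partial>lborel)"
        using L2_mult_integrable[OF h(2) L2_cnj[OF RL]] L2_mult_integrable[OF h(2) L2_cnj[OF FL]]
        by (simp add: right_diff_distrib)
      then show ?thesis
        using L2_Cauchy_Schwarz[OF h(2) L2_cnj[OF L2_diff[OF RL FL]]] orth[OF F(1)] nrm_cnj[of "\<lambda>y. ?R n y - ?F y"] by simp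
    qed
    have "of_real (r\<^sup>2 * bump_mass) * h z = (\<integral>y. (indicator ?D y *\<^sub>R h y) * of_real (bump z r y) \<partial>lborel)"
      by (rule bergman_mean_value[OF D hb r zD, symmetric])
    \<comment> \<open>The bump is real, so it equals the conjugate residual plus the conjugate
      derivative term \<open>(g1 - \<i> * g2) / 2\<close>.\<close>
    also have "\<dots> = (\<integral>y. h y * cnj (?R n y) + (1/2) * (h y * g1 n y - \<i> * (h y * g2 n y)) \<partial>lborel)"
    proof (rule Bochner_Integration.integral_cong[OF refl])
      fix y
      have "(indicator ?D y *\<^sub>R h y) * of_real (bump z r y) = h y * of_real (bump z r y)"
      proof (cases "y \<in> ball z r")
        case True
        then have "y \<in> ?D" using zD ball_subset_cball by blast
        then show ?thesis by simp
      next
        case False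
        then show ?thesis by (simp add: bump_eq_0[OF r])
      qed
      then show "(indicator ?D y *\<^sub>R h y) * of_real (bump z r y) = h y * cnj (?R n y) + (1/2) * (h y * g1 n y - \<i> * (h y * g2 n y))"
        by (simp add: residual_def algebra_simps)
    qed
    also have "\<dots> = (\<integral>y. h y * cnj (?R n y) \<partial>lborel) + (1/2) * ((\<integral>y. h y * g1 n y \<partial>lborel) - \<i> * (\<integral>y. h y * g2 n y \<partial>lborel))"
      using L2_mult_integrable[OF h(2) L2_cnj[OF RL]] L2_mult_integrable[OF h(2) gL(1)[of n]] L2_mult_integrable[OF h(2) gL(2)[of n]]
      by (simp only: Bochner_Integration.integral_add Bochner_Integration.integral_diff Bochner_Integration.integrable_diff integrable_mult_right integral_mult_right_zero)
    finally have eq: "of_real (r\<^sup>2 * bump_mass) * h z = (\<integral>y. h y * cnj (?R n y) \<partial>lborel)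
        + (1/2) * ((\<integral>y. h y * g1 n y \<partial>lborel) - \<i> * (\<integral>y. h y * g2 n y \<partial>lborel))" .
    have "r\<^sup>2 * bump_mass * cmod (h z) = cmod (of_real (r\<^sup>2 * bump_mass) * h z)"
      using bump_mass_pos by (simp only: norm_mult norm_of_real abs_mult abs_power2 abs_of_pos)
    also have "\<dots> \<le> a + b" if "cmod (\<integral>y. h y * cnj (?R n y) \<partial>lborel) \<le> a" "cmod (\<integral>y. h y * g1 n y \<partial>lborel) \<le> b" "cmod (\<integral>y. h y * g2 n y \<partial>lborel) \<le> b" for a b
    proof -
      have "cmod ((1/2) * (x - \<i> * y)) \<le> b" if "cmod x \<le> b" "cmod y \<le> b" for x y
      proof -
        have "cmod (x - \<i> * y) \<le> cmod x + cmod y" using norm_triangle_ineq4[of x "\<i> * y"] by (simp add: norm_mult)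
        then show ?thesis using that by (simp add: norm_mult)
      qed
      then show ?thesis unfolding eq using norm_triangle_le add_mono that by blast
    qed
    finally show ?thesis using res p1 p2 by (simp only: distrib_left)
  qed
  have "(\<lambda>n. nrm h * (nrm (\<lambda>y. ?R n y - ?F y) + (3 * (?M * ?Y) + 2 * inverse (real (Suc n))))) \<longlonglongrightarrow> nrm h * (0 + (3 * (?M * ?Y) + 2 * 0))"
    by (intro tendsto_mult tendsto_add tendsto_const F(2) LIMSEQ_inverse_real_of_nat)
  then have "r\<^sup>2 * bump_mass * cmod (h z) \<le> nrm h * (0 + (3 * (?M * ?Y) + 2 * 0))"
    by (rule LIMSEQ_le_const) (use bound in \<open>auto simp: inverse_eq_divide\<close>)
  then show ?thesis by simp
qed

text \<open>The difference of the two kernels is orthogonal to the Bergman space of \<open>S\<close>, and its squared norm is its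
  value at \<open>w\<close>; hence the pointwise bound applies twice.\<close>
lemma bergman_kernel_difference:
  assumes S: "open S" and E: "closed E" and r: "r > 0"
    and z: "ball z (2 * r) \<subseteq> S - E" and w: "ball w (2 * r) \<subseteq> S - E"
    and cap: "\<And>K. compact K \<Longrightarrow> K \<subseteq> E \<Longrightarrow> robin_const K > ereal L" and L: "L - 1 + ln r > 0"
  shows "cmod (bergman_kernel (S - E) z w - bergman_kernel S z w)
     \<le> (3 * (6 * r + 1) / (r\<^sup>2 * bump_mass))\<^sup>2 * (32 * pi) / (L - 1 + ln r)"
proof -
  let ?D = "S - E"
  have D: "open ?D" using S E by (rule open_Diff)
  have "z \<in> ball z (2 * r)" "w \<in> ball w (2 * r)" using r by auto
  then have zw: "z \<in> ?D" "w \<in> ?D" using z w by blast+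
  let ?f = "\<lambda>y. bergman_kernel ?D y w" and ?k = "\<lambda>y. bergman_kernel S y w"
  have f: "?f \<in> bergman_space ?D" "\<And>F. F \<in> bergman_space ?D \<Longrightarrow> F w = (LINT y:?D|lborel. F y * cnj (?f y))"
    using bergman_kernel_exists[OF D] zw unfolding is_bergman_kernel_def by blast+
  have k: "?k \<in> bergman_space S" "\<And>F. F \<in> bergman_space S \<Longrightarrow> F w = (LINT y:S|lborel. F y * cnj (?k y))"
    using bergman_kernel_exists[OF S] zw unfolding is_bergman_kernel_def by blast+
  define f' where "f' = (\<lambda>y. indicator ?D y *\<^sub>R ?f y)"
  define k' where "k' = (\<lambda>y. indicator S y *\<^sub>R ?k y)"
  define h where "h = (\<lambda>y. f' y - k' y)"
  have fL: "f' \<in> L2" "?f holomorphic_on ?D" using f(1) bergman_space_iff[OF D] by (auto simp: f'_def)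
  have kL: "k' \<in> L2" "?k holomorphic_on S" using k(1) bergman_space_iff[OF S] by (auto simp: k'_def)
  have hL: "h \<in> L2" unfolding h_def by (rule L2_diff[OF fL(1) kL(1)])
  have h_eq: "h y = ?f y - ?k y" if "y \<in> ?D" for y using that by (simp add: h_def f'_def k'_def)
  have hh: "h holomorphic_on ?D"
  proof (rule holomorphic_transform)
    show "(\<lambda>y. ?f y - ?k y) holomorphic_on ?D"
      using fL(2) holomorphic_on_subset[OF kL(2)] by (intro holomorphic_on_diff) auto
  qed (simp add: h_eq)
  have hD: "h \<in> bergman_space ?D" unfolding bergman_space_iff[OF D] using hh hL D by (auto intro: L2_indicator)
  have repD: "(\<integral>y. F y * cnj (f' y) \<partial>lborel) = F w" if "F \<in> bergman_space ?D" for F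
    unfolding f(2)[OF that] set_lebesgue_integral_def f'_def
    by (rule Bochner_Integration.integral_cong) (auto simp: scaleR_conv_of_real mult_ac)
  \<comment> \<open>Functions in the Bergman space of \<open>S\<close> restrict to that of
    \<open>S - E\<close>, so both kernels reproduce \<open>F w\<close>.\<close>
  have orth: "(\<integral>y. h y * cnj (indicator S y *\<^sub>R F y) \<partial>lborel) = 0" if F: "F \<in> bergman_space S" for F
  proof -
    let ?F = "\<lambda>y. indicator S y *\<^sub>R F y"
    have FL: "?F \<in> L2" "F holomorphic_on S" using F bergman_space_iff[OF S] by auto
    have FD: "F \<in> bergman_space ?D"
    proof -
      have "(\<lambda>y. indicator ?D y *\<^sub>R ?F y) \<in> L2" by (rule L2_indicator[OF FL(1)]) (use D in auto)
      moreover have "(\<lambda>y. indicator ?D y *\<^sub>R ?F y) = (\<lambda>y. indicator ?D y *\<^sub>R F y)" by (auto simp: fun_eq_iff indicator_def)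
      ultimately show ?thesis unfolding bergman_space_iff[OF D] using holomorphic_on_subset[OF FL(2)] by auto
    qed
    have a: "(\<integral>y. ?F y * cnj (f' y) \<partial>lborel) = F w"
    proof -
      have "?F y * cnj (f' y) = F y * cnj (f' y)" for y by (cases "y \<in> S") (auto simp: f'_def)
      then show ?thesis using repD[OF FD] by simp
    qed
    have b: "(\<integral>y. ?F y * cnj (k' y) \<partial>lborel) = F w"
      unfolding k(2)[OF F] set_lebesgue_integral_def k'_def
      by (rule Bochner_Integration.integral_cong) (auto simp: indicator_def)
    have "(\<integral>y. h y * cnj (?F y) \<partial>lborel) = cnj (\<integral>y. ?F y * cnj (h y) \<partial>lborel)"
    proof -
      have "(\<lambda>y. h y * cnj (?F y)) = (\<lambda>y. cnj (?F y * cnj (h y)))" by (rule ext) simp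
      then show ?thesis by (simp only: Bochner_Integration.integral_cnj)
    qed
    also have "(\<integral>y. ?F y * cnj (h y) \<partial>lborel) = (\<integral>y. ?F y * cnj (f' y) \<partial>lborel) - (\<integral>y. ?F y * cnj (k' y) \<partial>lborel)"
      using L2_mult_integrable[OF FL(1) L2_cnj[OF fL(1)]] L2_mult_integrable[OF FL(1) L2_cnj[OF kL(1)]]
      by (simp add: h_def right_diff_distrib)
    finally show ?thesis unfolding a b by simp
  qed
  \<comment> \<open>\<open>h\<close> is orthogonal to the kernel of \<open>S\<close>, so its pairing
    with itself is its pairing with the kernel of \<open>S - E\<close>, which evaluates
    \<open>h\<close> at \<open>w\<close>.\<close>
  have norm_h: "(nrm h)\<^sup>2 = cmod (h w)"
  proof -
    have "complex_of_real ((nrm h)\<^sup>2) = (\<integral>y. h y * cnj (h y) \<partial>lborel)"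
      unfolding nrm_sq integral_complex_of_real[symmetric] by (simp only: complex_norm_square)
    also have "\<dots> = (\<integral>y. h y * cnj (f' y) \<partial>lborel) - (\<integral>y. h y * cnj (k' y) \<partial>lborel)"
      using L2_mult_integrable[OF hL L2_cnj[OF fL(1)]] L2_mult_integrable[OF hL L2_cnj[OF kL(1)]]
      by (simp add: h_def right_diff_distrib)
    also have "\<dots> = h w" using repD[OF hD] orth[OF k(1)] by (simp add: k'_def)
    finally have "cmod (complex_of_real ((nrm h)\<^sup>2)) = cmod (h w)" by (simp only:)
    then show ?thesis by (simp only: norm_of_real abs_power2)
  qed
  let ?c = "r\<^sup>2 * bump_mass" and ?B = "3 * ((6 * r + 1) * sqrt (32 * pi / (L - 1 + ln r)))"
  have c: "?c > 0" using r bump_mass_pos by simp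
  have B0: "?B \<ge> 0" using r L by simp
  have pb: "?c * cmod (h x) \<le> nrm h * ?B" if "ball x (2 * r) \<subseteq> ?D" for x
    by (rule orthogonal_pointwise_bound[OF S E hh hL orth r that cap L])
  have nB: "nrm h \<le> ?B / ?c"
  proof (cases "nrm h = 0")
    case False
    then have n: "nrm h > 0" using nrm_nonneg[of h] by linarith
    have "nrm h * (?c * nrm h) \<le> nrm h * ?B" using pb[OF w] unfolding norm_h[symmetric] by (simp add: power2_eq_square mult_ac)
    then have "?c * nrm h \<le> ?B" using n by (rule mult_left_le_imp_le)
    then show ?thesis using c by (simp add: pos_le_divide_eq mult.commute)
  qed (use c B0 in simp)
  have "cmod (h z) \<le> nrm h * ?B / ?c" using pb[OF z] c by (simp only: pos_le_divide_eq mult.commute)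
  also have "\<dots> \<le> (?B / ?c) * ?B / ?c" using nB B0 c by (intro divide_right_mono mult_right_mono) auto
  also have "\<dots> = (?B / ?c)\<^sup>2" by (simp only: power2_eq_square times_divide_eq_right)
  also have "?B / ?c = (3 * (6 * r + 1) / ?c) * sqrt (32 * pi / (L - 1 + ln r))" by simp
  also have "((3 * (6 * r + 1) / ?c) * sqrt (32 * pi / (L - 1 + ln r)))\<^sup>2 = (3 * (6 * r + 1) / ?c)\<^sup>2 * (32 * pi) / (L - 1 + ln r)"
    using L by (simp only: power_mult_distrib real_sqrt_pow2) (simp add: power_mult_distrib)
  finally show ?thesis unfolding h_eq[OF zw(1)] .
qed

section \<open>From small capacity to the final estimate\<close>

lemma log_capacity_nonneg: "log_capacity E \<ge> 0"
proof -
  have "ereal (log_capacity_compact {}) \<le> log_capacity E"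
    unfolding log_capacity_def by (rule SUP_upper) auto
  moreover have "ereal (log_capacity_compact {}) \<ge> 0" by (simp add: log_capacity_compact_def)
  ultimately show ?thesis by (rule order_trans[rotated])
qed

text \<open>Capacity at most \<open>c\<close> makes the Robin constant at least -ln c; the
  additional -1 buys strictness.\<close>

lemma robin_const_lower_bound:
  assumes K: "compact K" "K \<subseteq> E" and cap: "log_capacity E \<le> ereal c" and c: "0 < c" "c < 1"
  shows "robin_const K > ereal (- ln c - 1)"
proof -
  have "ereal (log_capacity_compact K) \<le> log_capacity E"
    unfolding log_capacity_def by (rule SUP_upper) (use K in auto)
  then have le: "log_capacity_compact K \<le> c" using cap by (metis ereal_less_eq(3) order_trans)
  show ?thesis
  proof (cases "robin_const K")
    case (real \<rho>)
    then have "exp (- \<rho>) \<le> c" using le by (simp add: log_capacity_compact_def)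
    then have "- \<rho> \<le> ln c" using c by (simp add: ln_ge_iff)
    then show ?thesis using real by simp
  next
    case PInf
    then show ?thesis by simp
  next
    \<comment> \<open>\<open>real_of_ereal\<close> sends minus infinity to 0, so the compact
      capacity would be exp 0 = 1, which \<open>c < 1\<close> excludes.\<close>
    case MInf
    then show ?thesis using le c by (simp add: log_capacity_compact_def)
  qed
qed

theorem theorem1p4:
  fixes \<Omega> :: "complex set" and \<rho> :: "complex \<Rightarrow> real" and A c :: real
  assumes "open \<Omega>" and "connected \<Omega>" and "\<Omega> \<noteq> {}"
    and "continuous_subharmonic_on \<Omega> \<rho>"
    and "\<forall>z\<in>\<Omega>. \<rho> z < 0"
    and "A > 0" and "c > 0"
    and "\<forall>z\<in>\<Omega>. - \<rho> z \<le> A * (bdist \<Omega> z) powr c"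
  shows "\<exists>R>0. \<forall>r0. 0 < r0 \<and> r0 < R \<longrightarrow>
           (\<forall>\<alpha>. 0 < \<alpha> \<and> \<alpha> < 1/3 \<longrightarrow>
              (\<exists>C>0. \<exists>\<epsilon>>0. \<forall>E. closed E \<and> log_capacity E < ereal \<epsilon> \<longrightarrow>
                 (\<forall>z\<in>\<Omega>. \<forall>w\<in>\<Omega>.
                    min (bdist (\<Omega> - E) z) (bdist (\<Omega> - E) w) \<ge> r0 \<longrightarrow>
                    cmod (bergman_kernel (\<Omega> - E) z w - bergman_kernel \<Omega> z w)
                      \<le> (if log_capacity E = 0 then 0
                         else C * (ln (r0 / real_of_ereal (log_capacity E))) powr (- \<alpha>)))))"
proof (rule exI[of _ 1], intro conjI allI impI)
  fix r0 \<alpha> :: real assume r0: "0 < r0 \<and> r0 < 1" and \<alpha>: "0 < \<alpha> \<and> \<alpha> < 1/3"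
  \<comment> \<open>The kernel estimate wants discs of radius 2r in the smaller domain, and distance
    \<open>r0\<close> to its complement provides them.\<close>
  define r where "r = r0 / 2"
  have r: "r > 0" using r0 by (simp add: r_def)
  define C where "C = (3 * (6 * r + 1) / (r\<^sup>2 * bump_mass))\<^sup>2 * (32 * pi)"
  have C: "C > 0" using r bump_mass_pos by (simp add: C_def)
  \<comment> \<open>The factor exp (-6) makes the logarithm exceed 6, the point from which T - 3 is
    at least T / 2. As r0 < 1, it also keeps the capacity below 1.\<close>
  define \<epsilon> where "\<epsilon> = r0 * exp (- 6)"
  have \<epsilon>: "\<epsilon> > 0" "\<epsilon> < 1"
  proof -
    show "\<epsilon> > 0" using r0 by (simp add: \<epsilon>_def)
    have "r0 * exp (- 6) < 1 * 1" using r0 by (intro mult_strict_mono) auto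
    then show "\<epsilon> < 1" by (simp add: \<epsilon>_def)
  qed
  have small: "g * exp 6 < r0" if "g < \<epsilon>" for g
  proof -
    have "g * exp 6 < (r0 * exp (- 6)) * exp 6" using that unfolding \<epsilon>_def by (rule mult_strict_right_mono) simp
    also have "\<dots> = r0 * (exp (- 6) * exp 6)" by (rule mult.assoc)
    also have "exp (- 6) * exp 6 = (1::real)" by (simp only: exp_add[symmetric]) simp
    finally show ?thesis by simp
  qed
  have lnr: "ln r \<ge> ln r0 - 1"
  proof -
    have "ln (2::real) \<le> 1" using ln_2_less_1 by simp
    then show ?thesis using r0 by (simp add: r_def ln_div)
  qed
  \<comment> \<open>Stated for any upper bound \<open>g\<close> of the capacity, so that capacity 0
    can be reached by letting \<open>g\<close> tend to 0.\<close>
  have key: "cmod (bergman_kernel (\<Omega> - E) z w - bergman_kernel \<Omega> z w) \<le> 2 * C / (ln (r0 / g))"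
    if E: "closed E" and g: "log_capacity E \<le> ereal g" "0 < g" "g < \<epsilon>"
      and zw: "min (bdist (\<Omega> - E) z) (bdist (\<Omega> - E) w) \<ge> r0" for E z w g
  proof -
    have ball: "ball x (2 * r) \<subseteq> \<Omega> - E" if "bdist (\<Omega> - E) x \<ge> r0" for x
    proof
      fix y assume y: "y \<in> ball x (2 * r)"
      show "y \<in> \<Omega> - E"
      proof (rule ccontr)
        assume "y \<notin> \<Omega> - E"
        then have "infdist x (- (\<Omega> - E)) \<le> dist x y" by (intro infdist_le) auto
        then show False using that y by (simp add: bdist_def r_def)
      qed
    qed
    define T where "T = ln (r0 / g)"
    have "exp 6 < r0 / g"
    proof -
      have "g * exp 6 < r0" by (rule small[OF g(3)])
      then show ?thesis using g by (simp add: pos_less_divide_eq mult.commute)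
    qed
    then have T6: "T > 6" using ln_less_cancel_iff[of "exp 6" "r0 / g"] r0 g by (simp add: T_def)
    define L where "L = - ln g - 1"
    have Tg: "T = ln r0 - ln g" using r0 g by (simp add: T_def ln_div)
    \<comment> \<open>Three units are lost: one for strictness in \<open>L\<close>, one in the
      cutoff, one for ln 2 from halving the radius.\<close>
    have L: "L - 1 + ln r \<ge> T - 3" using lnr by (simp add: L_def Tg)
    then have L0: "L - 1 + ln r > 0" using T6 by linarith
    have half: "L - 1 + ln r \<ge> T / 2" using L T6 by simp
    have "cmod (bergman_kernel (\<Omega> - E) z w - bergman_kernel \<Omega> z w) \<le> C / (L - 1 + ln r)"
      unfolding C_def
    proof (rule bergman_kernel_difference[OF assms(1) E r _ _ _ L0])
      show "ball z (2 * r) \<subseteq> \<Omega> - E" "ball w (2 * r) \<subseteq> \<Omega> - E" using zw by (auto intro!: ball)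
      show "ereal L < robin_const K" if "compact K" "K \<subseteq> E" for K
        unfolding L_def by (rule robin_const_lower_bound[OF that g(1,2)]) (use g(3) \<epsilon>(2) in linarith)
    qed
    also have "\<dots> \<le> C / (T / 2)" using half T6 C by (intro divide_left_mono) auto
    finally show ?thesis by (simp add: T_def mult.commute)
  qed
  show "\<exists>C>0. \<exists>\<epsilon>>0. \<forall>E. closed E \<and> log_capacity E < ereal \<epsilon> \<longrightarrow>
                 (\<forall>z\<in>\<Omega>. \<forall>w\<in>\<Omega>.
                    min (bdist (\<Omega> - E) z) (bdist (\<Omega> - E) w) \<ge> r0 \<longrightarrow>
                    cmod (bergman_kernel (\<Omega> - E) z w - bergman_kernel \<Omega> z w)
                      \<le> (if log_capacity E = 0 then 0
                         else C * (ln (r0 / real_of_ereal (log_capacity E))) powr (- \<alpha>)))"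
  proof (rule exI[of _ "2 * C"], rule conjI, use C in simp, rule exI[of _ \<epsilon>], intro conjI allI impI ballI)
    fix E z w
    assume E: "closed E \<and> log_capacity E < ereal \<epsilon>"
      and zw: "min (bdist (\<Omega> - E) z) (bdist (\<Omega> - E) w) \<ge> r0"
    let ?d = "cmod (bergman_kernel (\<Omega> - E) z w - bergman_kernel \<Omega> z w)"
    show "?d \<le> (if log_capacity E = 0 then 0 else 2 * C * (ln (r0 / real_of_ereal (log_capacity E))) powr (- \<alpha>))"
    proof (cases "log_capacity E = 0")
      case True
      \<comment> \<open>Every small positive \<open>g\<close> is an admissible bound, and the
        estimate vanishes in the limit, so the kernels agree.\<close>
      have lim: "((\<lambda>g. 2 * C / ln (r0 / g)) \<longlongrightarrow> 0) (at_right 0)"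
        using r0 C by real_asymp
      have "?d \<le> 0"
      proof (rule tendsto_lowerbound[OF lim])
        show "\<forall>\<^sub>F g in at_right 0. ?d \<le> 2 * C / ln (r0 / g)"
          unfolding eventually_at_right_field
          by (intro exI[of _ \<epsilon>]) (use \<epsilon> key[OF conjunct1[OF E] _ _ _ zw] True in auto)
      qed simp
      then show ?thesis using True by simp
    next
      case False
      obtain g where g: "log_capacity E = ereal g" "0 < g" "g < \<epsilon>"
        using E False log_capacity_nonneg[of E] by (cases "log_capacity E") auto
      have d: "?d \<le> 2 * C / ln (r0 / g)" by (rule key[OF conjunct1[OF E] _ g(2,3) zw]) (simp add: g(1))
      have "exp 1 < r0 / g"
      proof -
        have "g * exp 1 \<le> g * exp 6" using g by simp
        also have "\<dots> < r0" by (rule small[OF g(3)])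
        finally show ?thesis using g by (simp add: pos_less_divide_eq mult.commute)
      qed
      then have T1: "ln (r0 / g) \<ge> 1" using ln_less_cancel_iff[of "exp 1" "r0 / g"] r0 g by simp
      have "2 * C / ln (r0 / g) = 2 * C * ln (r0 / g) powr (- 1)"
        using T1 by (simp add: powr_minus divide_inverse)
      \<comment> \<open>For a base at least 1, the power -1 is at most the power -\<alpha> as
        \<alpha> < 1.\<close>
      also have "\<dots> \<le> 2 * C * ln (r0 / g) powr (- \<alpha>)"
        using T1 \<alpha> C by (intro mult_left_mono powr_mono) auto
      finally show ?thesis using d g(1) False by simp
    qed
  qed (use \<epsilon> in auto)
qed simp

end
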